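(* Let $u\in C^\infty(M)$. At any $x\in M$ with $du_x\neq 0$, we have $$\Delta^{du}_{\mathfrak m}\big(\mathbf H(du)\big)-d(\mathbf\Delta^{\mathbf H}_{\mathfrak m}u)(\nabla u)=\mathrm{Ric}^{\mathbf H}_\infty(du)+\big\|\mathrm{Hess}^{\mathbf H}u\big\|^2_{HS(du)},$$ and, for every $N\in[n,\infty)$, $$\Delta^{du}_{\mathfrak m}\big(\mathbf H(du)\big)-d(\mathbf\Delta^{\mathbf H}_{\mathfrak m}u)(\nabla u)\ \ge\ \mathrm{Ric}^{\mathbf H}_N(du)+\frac{(\mathbf\Delta^{\mathbf H}_{\mathfrak m}u)^2}{N},$$ where $$\Delta^{du}_{\mathfrak m}f:=\mathrm{div}_{\mathfrak m}\Big(\sum_{i,j=1}^n\mathbf H_{\alpha_i\alpha_j}(du)\frac{\partial f}{\partial x^j}\,\partial_{x^i}\Big).$$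
   Context: $M$ is a connected $C^\infty$-manifold without boundary of dimension $n\ge2$, with a fixed positive $C^\infty$-measure $\mathfrak m$. Lagrangian: a function $\mathbf L:TM\to[0,\infty)$ with (1) $\mathbf L\in C^1(TM)\cap C^\infty(TM\setminus 0_{TM})$ and $\mathbf L\equiv0$ on the zero section $0_{TM}$; (2) there are a complete Riemannian metric $g$ of $M$ and $C>0$ with $\mathbf L(v)\ge|v|_g-C$ for all $v\in TM$; (3) for every $x$, $\mathbf L|_{T_xM}$ has positive-definite Hessian at every $v\in T_xM\setminus\{0\}$. Hamiltonian: $\mathbf H(\alpha):=\sup_{v\in T_xM}\{\alpha(v)-\mathbf L(v)\}$ for $\alpha\in T_x^*M$; it is $C^1$ on $T^*M$, vanishes on the zero section, and is positive and $C^\infty$ off it. A fixed Lagrangian $\mathbf L$ with Hamiltonian $\mathbf H$ is given. For local coordinates $(x^i)$ of $M$ use fiber coordinates $v=\sum v^i\partial_{x^i}$, $\alpha=\sum\alpha_i dx^i$; subscripts on $\mathbf L,\mathbf H$ denote partial derivatives. Legendre transform: $\tau^*(\alpha)=\sum_i\mathbf H_{\alpha_i}(\alpha)\partial_{x^i}$, with inverse $\tau(v)=\sum_i\mathbf L_{v^i}(v)dx^i$. Hamiltonian vector field: $\vec{\mathbf H}=\sum_i\{\mathbf H_{\alpha_i}\partial_{x^i}-\mathbf H_{x^i}\partial_{\alpha_i}\}$, with (local) flow $\Phi_t$ on $T^*M$. $\pi_M:T^*M\to M$ is the projection, $\omega=\sum_i d\alpha_i\wedge dx^i$. Curvature. For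 $\alpha\in T^*_xM\setminus\{0\}$ let $\boldsymbol\alpha(t)=\Phi_t(\alpha)$, $t\in(-\varepsilon,\varepsilon)$, $\mathcal V_{\boldsymbol\alpha(t)}=\mathrm{span}\{\partial_{\alpha_i}\}\subset T_{\boldsymbol\alpha(t)}(T^*M)$ and $\mathcal J^t_\alpha=(d\Phi_t)^{-1}(\mathcal V_{\boldsymbol\alpha(t)})\subset T_\alpha(T^*M)$. On $\mathcal V_\alpha$ use the inner product $\langle\sum_i\xi^i\partial_{\alpha_i},\sum_j\zeta^j\partial_{\alpha_j}\rangle_\alpha=\sum_{i,j}\mathbf H_{\alpha_i\alpha_j}(\alpha)\xi^i\zeta^j$. A canonical frame along $\boldsymbol\alpha$ is a family of smooth curves $e_i^t\in\mathcal J^t_\alpha$, $i=1,\dots,n$, with $\omega(\dot e_i^t,e_j^t)=\delta_{ij}$ and $\ddot e_i^t\in\mathcal J_\alpha^t$ for all $t$ (derivatives in the fixed vector space $T_\alpha(T^*M)$); it exists and is unique up to a constant orthogonal matrix. The curvature operator is the linear map $\mathbf R^t_\alpha:\mathcal J^t_\alpha\to\mathcal J^t_\alpha$, $\mathbf R^t_\alpha(e_i^t)=-\ddot e_i^t$. $\mathrm{Ric}^{\mathbf H}(\alpha)$ is the trace of $\mathbf R^0_\alpha:\mathcal V_\alpha\to\mathcal V_\alpha$. Weighted Ricci curvature. Let $\eta(t)=\pi_M(\boldsymbol\alpha(t))$ and write, along $\eta$, $\mathfrak m=e^{-\psi}\sqrt{\det[\mathbf L_{v^iv^j}(\dot\eta)]}\,dx^1\cdots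 dx^n$. Then $\mathrm{Ric}^{\mathbf H}_N(\alpha)=\mathrm{Ric}^{\mathbf H}(\alpha)+(\psi\circ\eta)''(0)-\frac{(\psi\circ\eta)'(0)^2}{N-n}$ for $N\in(n,\infty)$; $\mathrm{Ric}^{\mathbf H}_\infty(\alpha)=\mathrm{Ric}^{\mathbf H}(\alpha)+(\psi\circ\eta)''(0)$; $\mathrm{Ric}^{\mathbf H}_n(\alpha)=\mathrm{Ric}^{\mathbf H}(\alpha)+(\psi\circ\eta)''(0)$ if $(\psi\circ\eta)'(0)=0$ and $-\infty$ otherwise. Laplacian and Hessian. $\nabla u(x)=\tau^*(du_x)$. For $\mathfrak m=e^{-\varsigma}dx^1\cdots dx^n$ and a differentiable vector field $V=\sum V^i\partial_{x^i}$, $\mathrm{div}_{\mathfrak m}V=\sum_i\{\partial_{x^i}V^i-V^i\partial_{x^i}\varsigma\}$; $\mathbf\Delta^{\mathbf H}_{\mathfrak m}u=\mathrm{div}_{\mathfrak m}(\nabla u)$ (smooth where $du\ne0$). At $x$ with $du_x\ne0$, take a canonical frame $(e_i^t)$ along $\Phi_t(du_x)$, and put $\mathcal H_{du_x}=\mathrm{span}\{\dot e_i^0\}$, so $T_{du_x}(T^*M)=\mathcal V_{du_x}\oplus\mathcal H_{du_x}$. The image of $d(du)_x:T_xM\to T_{du_x}(T^*M)$ is the graph of a linear map $\mathcal H_{du_x}\to\mathcal V_{du_x}$, and $\mathrm{Hess}^{\mathbf H}u(x):\mathcal H_{du_x}\to\mathcal V_{du_x}$ is the negative of this map. Writing $\mathrm{Hess}^{\mathbf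 H}u(\dot e_i^0)=\sum_j h_{ij}e_j^0$, $\|\mathrm{Hess}^{\mathbf H}u\|_{HS(du)}^2=\sum_{i,j}h_{ij}^2$ (independent of the canonical frame). *)

theory Defs
  imports "HOL-Analysis.Analysis"
begin

section \<open>Differentiability classes\<close>

text \<open>Only used on open sets of Euclidean spaces, where \<open>differentiable_on\<close> is the
  two-sided notion and \<open>frechet_derivative\<close> at a point is the genuine derivative.\<close>

primrec Ck_on ::
  "nat \<Rightarrow> ('a::euclidean_space \<Rightarrow> 'b::real_normed_vector) \<Rightarrow> 'a set \<Rightarrow> bool" where
  "Ck_on 0 f S \<longleftrightarrow> continuous_on S f"
| "Ck_on (Suc k) f S \<longleftrightarrow>
     f differentiable_on S \<and> (\<forall>v. Ck_on k (\<lambda>x. frechet_derivative f (at x) v) S)"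

definition smooth_on ::
  "'a::euclidean_space set \<Rightarrow> ('a \<Rightarrow> 'b::real_normed_vector) \<Rightarrow> bool" where
  "smooth_on S f \<longleftrightarrow> (\<forall>k. Ck_on k f S)"


section \<open>Manifolds, tangent vectors, curves\<close>

text \<open>A chart is a pair of its domain and its coordinate map (arbitrary outside the domain).
  The manifold is a whole Hausdorff, second countable type \<open>'m\<close>, its dimension is
  \<open>CARD('n)\<close>; it has no boundary since charts have open images.\<close>

type_synonym ('m, 'n) chart = "'m set \<times> ('m \<Rightarrow> real ^ 'n)"

definition coord_dom :: "('m, 'n::finite) chart \<Rightarrow> (real ^ 'n) set" where
  "coord_dom c = snd c ` fst c"

definition coord_inv :: "('m, 'n::finite) chart \<Rightarrow> real ^ 'n \<Rightarrow> 'm" where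
  "coord_inv c = inv_into (fst c) (snd c)"

definition smooth_atlas :: "('m::topological_space, 'n::finite) chart set \<Rightarrow> bool" where
  "smooth_atlas A \<longleftrightarrow>
     (\<Union>c\<in>A. fst c) = UNIV \<and>
     (\<forall>c\<in>A. open (fst c) \<and> open (coord_dom c) \<and>
        homeomorphism (fst c) (coord_dom c) (snd c) (coord_inv c)) \<and>
     (\<forall>c\<in>A. \<forall>c'\<in>A. smooth_on (snd c ` (fst c \<inter> fst c')) (snd c' \<circ> coord_inv c))"

text \<open>A tangent vector at \<open>p\<close> is the family of its component vectors in all charts around
  \<open>p\<close>, related by the derivatives of the coordinate changes (and \<open>0\<close> for the irrelevant
  indices, so that a tangent vector is determined by its components in one chart around \<open>p\<close>).
  Vector space operations are pointwise.\<close>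

type_synonym ('m, 'n) tvec = "('m, 'n) chart \<Rightarrow> real ^ 'n"

definition tangent ::
  "('m, 'n::finite) chart set \<Rightarrow> 'm \<Rightarrow> ('m, 'n) tvec set" where
  "tangent A p = {v.
     (\<forall>c\<in>A. \<forall>c'\<in>A. p \<in> fst c \<inter> fst c' \<longrightarrow>
        v c' = frechet_derivative (snd c' \<circ> coord_inv c) (at (snd c p)) (v c)) \<and>
     (\<forall>c. \<not> (c \<in> A \<and> p \<in> fst c) \<longrightarrow> v c = 0)}"

definition tvec_of ::
  "('m, 'n::finite) chart set \<Rightarrow> ('m, 'n) chart \<Rightarrow> 'm \<Rightarrow> real ^ 'n \<Rightarrow> ('m, 'n) tvec" where
  "tvec_of A c p w = (\<lambda>c'. if c' \<in> A \<and> p \<in> fst c'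
     then frechet_derivative (snd c' \<circ> coord_inv c) (at (snd c p)) w else 0)"

definition C1_curve ::
  "('m::topological_space, 'n::finite) chart set \<Rightarrow> (real \<Rightarrow> 'm) \<Rightarrow> bool" where
  "C1_curve A \<gamma> \<longleftrightarrow> continuous_on UNIV \<gamma> \<and>
     (\<forall>c\<in>A. (snd c \<circ> \<gamma>) C1_differentiable_on {t. \<gamma> t \<in> fst c})"

definition velocity ::
  "('m, 'n::finite) chart set \<Rightarrow> (real \<Rightarrow> 'm) \<Rightarrow> real \<Rightarrow> ('m, 'n) tvec" where
  "velocity A \<gamma> t = (\<lambda>c. if c \<in> A \<and> \<gamma> t \<in> fst c
     then vector_derivative (snd c \<circ> \<gamma>) (at t) else 0)"

definition smooth_function :: "('m, 'n::finite) chart set \<Rightarrow> ('m \<Rightarrow> real) \<Rightarrow> bool" where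
  "smooth_function A u \<longleftrightarrow> (\<forall>c\<in>A. smooth_on (coord_dom c) (u \<circ> coord_inv c))"


section \<open>Complete Riemannian metrics\<close>

definition riemannian_metric ::
  "('m, 'n::finite) chart set \<Rightarrow> ('m \<Rightarrow> ('m, 'n) tvec \<Rightarrow> ('m, 'n) tvec \<Rightarrow> real) \<Rightarrow> bool" where
  "riemannian_metric A g \<longleftrightarrow>
     (\<forall>c\<in>A. \<forall>G. G = (\<lambda>x w w'. g (coord_inv c x)
          (tvec_of A c (coord_inv c x) w) (tvec_of A c (coord_inv c x) w')) \<longrightarrow>
        (\<forall>w w'. smooth_on (coord_dom c) (\<lambda>x. G x w w')) \<and>
        (\<forall>x\<in>coord_dom c. bilinear (G x) \<and> (\<forall>w w'. G x w w' = G x w' w) \<and>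
           (\<forall>w. w \<noteq> 0 \<longrightarrow> 0 < G x w w)))"

text \<open>The infimum over \<open>C\<^sup>1\<close> curves equals the one over piecewise \<open>C\<^sup>1\<close> curves: a corner can be
  traversed with vanishing velocity, and a curve on \<open>[0,1]\<close> can likewise be extended by
  constants to the whole line.\<close>

definition riemannian_dist ::
  "('m::topological_space, 'n::finite) chart set \<Rightarrow>
   ('m \<Rightarrow> ('m, 'n) tvec \<Rightarrow> ('m, 'n) tvec \<Rightarrow> real) \<Rightarrow> 'm \<Rightarrow> 'm \<Rightarrow> real" where
  "riemannian_dist A g p q =
     Inf {integral {0..1} (\<lambda>t. sqrt (g (\<gamma> t) (velocity A \<gamma> t) (velocity A \<gamma> t))) | \<gamma>.
            C1_curve A \<gamma> \<and> \<gamma> 0 = p \<and> \<gamma> 1 = q}"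

definition complete_riemannian_metric ::
  "('m::topological_space, 'n::finite) chart set \<Rightarrow>
   ('m \<Rightarrow> ('m, 'n) tvec \<Rightarrow> ('m, 'n) tvec \<Rightarrow> real) \<Rightarrow> bool" where
  "complete_riemannian_metric A g \<longleftrightarrow> riemannian_metric A g \<and>
     (\<forall>s :: nat \<Rightarrow> 'm.
        (\<forall>e>0. \<exists>K. \<forall>i\<ge>K. \<forall>j\<ge>K. riemannian_dist A g (s i) (s j) < e) \<longrightarrow> (\<exists>p. s \<longlonglongrightarrow> p))"


section \<open>Smooth positive measures\<close>

text \<open>\<open>\<mm> = exp (- \<sigma>) dx\<^sup>1 \<dots> dx\<^sup>n\<close> on the chart \<open>c\<close>\<close>

definition is_log_density ::
  "('m::topological_space, 'n::finite) chart \<Rightarrow> 'm measure \<Rightarrow> (real ^ 'n \<Rightarrow> real) \<Rightarrow> bool" where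
  "is_log_density c \<mm> \<sigma> \<longleftrightarrow> smooth_on (coord_dom c) \<sigma> \<and>
     (\<forall>B\<in>sets borel. B \<subseteq> fst c \<longrightarrow>
        emeasure \<mm> B = (\<integral>\<^sup>+x\<in>snd c ` B. ennreal (exp (- \<sigma> x)) \<partial>lborel))"

definition smooth_positive_measure ::
  "('m::topological_space, 'n::finite) chart set \<Rightarrow> 'm measure \<Rightarrow> bool" where
  "smooth_positive_measure A \<mm> \<longleftrightarrow>
     sets \<mm> = sets borel \<and> (\<forall>c\<in>A. \<exists>\<sigma>. is_log_density c \<mm> \<sigma>)"

text \<open>Unique on \<open>coord_dom c\<close> by continuity.\<close>

definition log_density ::
  "('m::topological_space, 'n::finite) chart \<Rightarrow> 'm measure \<Rightarrow> real ^ 'n \<Rightarrow> real" where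
  "log_density c \<mm> = (SOME \<sigma>. is_log_density c \<mm> \<sigma>)"


section \<open>Lagrangians and Hamiltonians\<close>

text \<open>Coordinates of \<open>TM\<close> and \<open>T\<^sup>*M\<close> over a chart are pairs (base point, fibre component).\<close>

definition pdx ::
  "'n \<Rightarrow> ((real ^ 'n) \<times> (real ^ 'n::finite) \<Rightarrow> real) \<Rightarrow> (real ^ 'n) \<times> (real ^ 'n) \<Rightarrow> real" where
  "pdx i F z = frechet_derivative F (at z) (axis i 1, 0)"

definition pdv ::
  "'n \<Rightarrow> ((real ^ 'n) \<times> (real ^ 'n::finite) \<Rightarrow> real) \<Rightarrow> (real ^ 'n) \<times> (real ^ 'n) \<Rightarrow> real" where
  "pdv i F z = frechet_derivative F (at z) (0, axis i 1)"

definition fibre_hessian ::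
  "((real ^ 'n) \<times> (real ^ 'n::finite) \<Rightarrow> real) \<Rightarrow> (real ^ 'n) \<times> (real ^ 'n) \<Rightarrow> real ^ 'n ^ 'n" where
  "fibre_hessian F z = (\<chi> i j. pdv i (pdv j F) z)"

definition lag_in ::
  "('m, 'n::finite) chart set \<Rightarrow> ('m \<Rightarrow> ('m, 'n) tvec \<Rightarrow> real) \<Rightarrow> ('m, 'n) chart
   \<Rightarrow> (real ^ 'n) \<times> (real ^ 'n) \<Rightarrow> real" where
  "lag_in A L c = (\<lambda>(x, w). L (coord_inv c x) (tvec_of A c (coord_inv c x) w))"

definition lagrangian ::
  "('m::topological_space, 'n::finite) chart set \<Rightarrow> ('m \<Rightarrow> ('m, 'n) tvec \<Rightarrow> real) \<Rightarrow> bool" where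
  "lagrangian A L \<longleftrightarrow>
     (\<forall>p. \<forall>v\<in>tangent A p. 0 \<le> L p v) \<and>
     (\<forall>c\<in>A. Ck_on 1 (lag_in A L c) (coord_dom c \<times> UNIV) \<and>
        smooth_on (coord_dom c \<times> (- {0})) (lag_in A L c)) \<and>
     (\<forall>p. L p (\<lambda>_. 0) = 0) \<and>
     (\<exists>g C. complete_riemannian_metric A g \<and> C > 0 \<and>
        (\<forall>p. \<forall>v\<in>tangent A p. sqrt (g p v v) - C \<le> L p v)) \<and>
     (\<forall>c\<in>A. \<forall>x\<in>coord_dom c. \<forall>v. v \<noteq> 0 \<longrightarrow>
        (\<forall>\<xi>. \<xi> \<noteq> 0 \<longrightarrow> 0 < \<xi> \<bullet> (fibre_hessian (lag_in A L c) (x, v) *v \<xi>)))"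

text \<open>A covector at \<open>p\<close> is a linear functional on \<open>tangent A p\<close>.\<close>

definition hamiltonian ::
  "('m, 'n::finite) chart set \<Rightarrow> ('m \<Rightarrow> ('m, 'n) tvec \<Rightarrow> real)
   \<Rightarrow> 'm \<Rightarrow> (('m, 'n) tvec \<Rightarrow> real) \<Rightarrow> real" where
  "hamiltonian A L p \<alpha> = (SUP v\<in>tangent A p. \<alpha> v - L p v)"

text \<open>The covector with components \<open>a\<close> in the chart \<open>c\<close> is \<open>v \<mapsto> \<Sum>i. a\<^sub>i v\<^sup>i\<close>.\<close>

definition covec_of ::
  "('m, 'n::finite) chart \<Rightarrow> real ^ 'n \<Rightarrow> ('m, 'n) tvec \<Rightarrow> real" where
  "covec_of c a = (\<lambda>v. a \<bullet> v c)"

definition ham_in ::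
  "('m, 'n::finite) chart set \<Rightarrow> ('m \<Rightarrow> ('m, 'n) tvec \<Rightarrow> real) \<Rightarrow> ('m, 'n) chart
   \<Rightarrow> (real ^ 'n) \<times> (real ^ 'n) \<Rightarrow> real" where
  "ham_in A L c = (\<lambda>(x, a). hamiltonian A L (coord_inv c x) (covec_of c a))"

text \<open>The standing regularity of the Hamiltonian. Finiteness of the supremum has to be stated:
  the linear growth of \<open>L\<close> alone does not give it
  (on flat space take \<open>L v = sqrt (1 + \<bar>v\<bar>\<^sup>2) - 1\<close>).\<close>

definition regular_hamiltonian ::
  "('m, 'n::finite) chart set \<Rightarrow> ('m \<Rightarrow> ('m, 'n) tvec \<Rightarrow> real) \<Rightarrow> bool" where
  "regular_hamiltonian A L \<longleftrightarrow>
     (\<forall>c\<in>A. (\<forall>p\<in>fst c. \<forall>a. bdd_above ((\<lambda>v. covec_of c a v - L p v) ` tangent A p)) \<and>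
        Ck_on 1 (ham_in A L c) (coord_dom c \<times> UNIV) \<and>
        smooth_on (coord_dom c \<times> (- {0})) (ham_in A L c))"


section \<open>Hamiltonian flow, canonical frames and curvature\<close>

text \<open>From here on everything is expressed in one chart: \<open>H\<close>, \<open>L\<close>, \<open>u\<close>, \<open>\<sigma>\<close> are
  coordinate expressions.\<close>

definition hamiltonian_vf ::
  "((real ^ 'n) \<times> (real ^ 'n::finite) \<Rightarrow> real) \<Rightarrow> (real ^ 'n) \<times> (real ^ 'n)
   \<Rightarrow> (real ^ 'n) \<times> (real ^ 'n)" where
  "hamiltonian_vf H z = ((\<chi> i. pdv i H z), (\<chi> i. - pdx i H z))"

text \<open>\<open>\<Phi>\<close> is the local flow of \<open>X\<close>, on initial values in \<open>W\<close> and times in \<open>(-\<epsilon>, \<epsilon>)\<close>,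
  inside \<open>D\<close>.\<close>

definition local_flow ::
  "('a::euclidean_space \<Rightarrow> 'a) \<Rightarrow> 'a set \<Rightarrow> 'a set \<Rightarrow> real \<Rightarrow> (real \<Rightarrow> 'a \<Rightarrow> 'a) \<Rightarrow> bool" where
  "local_flow X D W \<epsilon> \<Phi> \<longleftrightarrow> 0 < \<epsilon> \<and> open W \<and>
     smooth_on ({-\<epsilon><..<\<epsilon>} \<times> W) (\<lambda>(t, z). \<Phi> t z) \<and>
     (\<forall>z\<in>W. \<Phi> 0 z = z \<and>
        (\<forall>t\<in>{-\<epsilon><..<\<epsilon>}. \<Phi> t z \<in> D \<and>
           ((\<lambda>s. \<Phi> s z) has_vector_derivative X (\<Phi> t z)) (at t)))"

definition vertical :: "((real ^ 'n) \<times> (real ^ 'n::finite)) set" where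
  "vertical = {0} \<times> UNIV"

definition symp :: "(real ^ 'n) \<times> (real ^ 'n::finite) \<Rightarrow> (real ^ 'n) \<times> (real ^ 'n) \<Rightarrow> real" where
  "symp X Y = (\<Sum>i\<in>UNIV. snd X $ i * fst Y $ i - snd Y $ i * fst X $ i)"

definition jacobi_space ::
  "(real \<Rightarrow> (real ^ 'n) \<times> (real ^ 'n) \<Rightarrow> (real ^ 'n) \<times> (real ^ 'n::finite))
   \<Rightarrow> (real ^ 'n) \<times> (real ^ 'n) \<Rightarrow> real \<Rightarrow> ((real ^ 'n) \<times> (real ^ 'n)) set" where
  "jacobi_space \<Phi> \<alpha> t = {\<xi>. frechet_derivative (\<Phi> t) (at \<alpha>) \<xi> \<in> vertical}"

definition vd :: "(real \<Rightarrow> 'a::real_normed_vector) \<Rightarrow> real \<Rightarrow> 'a" where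
  "vd f t = vector_derivative f (at t)"

definition canonical_frame ::
  "(real \<Rightarrow> (real ^ 'n) \<times> (real ^ 'n) \<Rightarrow> (real ^ 'n) \<times> (real ^ 'n::finite))
   \<Rightarrow> (real ^ 'n) \<times> (real ^ 'n) \<Rightarrow> real \<Rightarrow> ('n \<Rightarrow> real \<Rightarrow> (real ^ 'n) \<times> (real ^ 'n)) \<Rightarrow> bool" where
  "canonical_frame \<Phi> \<alpha> \<epsilon> e \<longleftrightarrow>
     (\<forall>i. smooth_on {-\<epsilon><..<\<epsilon>} (e i)) \<and>
     (\<forall>t\<in>{-\<epsilon><..<\<epsilon>}.
        (\<forall>i. e i t \<in> jacobi_space \<Phi> \<alpha> t) \<and>
        (\<forall>i j. symp (vd (e i) t) (e j t) = (if i = j then 1 else 0)) \<and>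
        (\<forall>i. vd (vd (e i)) t \<in> jacobi_space \<Phi> \<alpha> t))"

text \<open>The coefficient of \<open>w\<close> along \<open>b i\<close> in the basis \<open>b\<close> of its span.\<close>

definition coeff_in :: "('n::finite \<Rightarrow> 'a::real_vector) \<Rightarrow> 'a \<Rightarrow> 'n \<Rightarrow> real" where
  "coeff_in b w i = representation (range b) w (b i)"

text \<open>The linear map on the span of \<open>e i t\<close> that sends \<open>e i t\<close> to \<open>- vd (vd (e i)) t\<close>.\<close>

definition curvature_op ::
  "('n::finite \<Rightarrow> real \<Rightarrow> 'a::real_normed_vector) \<Rightarrow> real \<Rightarrow> 'a \<Rightarrow> 'a" where
  "curvature_op e t w = (\<Sum>i\<in>UNIV. coeff_in (\<lambda>i. e i t) w i *\<^sub>R (- vd (vd (e i)) t))"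

definition ricci :: "('n::finite \<Rightarrow> real \<Rightarrow> 'a::real_normed_vector) \<Rightarrow> real" where
  "ricci e = (\<Sum>i\<in>UNIV. coeff_in (\<lambda>i. e i 0) (curvature_op e 0 (e i 0)) i)"

text \<open>\<open>\<psi> \<circ> \<eta>\<close>, where \<open>exp (- \<psi>) * sqrt (det L\<^sub>v\<^sub>v(\<eta>')) = exp (- \<sigma>)\<close> along \<open>\<eta>\<close>.\<close>

definition weight_along ::
  "((real ^ 'n) \<times> (real ^ 'n) \<Rightarrow> real) \<Rightarrow> (real ^ 'n \<Rightarrow> real) \<Rightarrow> (real \<Rightarrow> real ^ 'n::finite)
   \<Rightarrow> real \<Rightarrow> real" where
  "weight_along L \<sigma> \<eta> t = \<sigma> (\<eta> t) + ln (sqrt (det (fibre_hessian L (\<eta> t, vd \<eta> t))))"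

text \<open>\<open>Ric\<^sub>N\<close> for \<open>N \<in> [n, \<infinity>]\<close>, from \<open>r = Ric\<close> and \<open>\<psi> = \<psi> \<circ> \<eta>\<close>\<close>

definition weighted_ricci :: "real \<Rightarrow> ereal \<Rightarrow> real \<Rightarrow> (real \<Rightarrow> real) \<Rightarrow> ereal" where
  "weighted_ricci n N r \<psi> =
     (if N = \<infinity> then ereal (r + deriv (deriv \<psi>) 0)
      else if N = ereal n then (if deriv \<psi> 0 = 0 then ereal (r + deriv (deriv \<psi>) 0) else - \<infinity>)
      else ereal (r + deriv (deriv \<psi>) 0 - (deriv \<psi> 0)\<^sup>2 / (real_of_ereal N - n)))"


section \<open>Differential, gradient, Laplacians, Hessian\<close>

definition pd :: "'n \<Rightarrow> (real ^ 'n::finite \<Rightarrow> real) \<Rightarrow> real ^ 'n \<Rightarrow> real" where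
  "pd i f x = frechet_derivative f (at x) (axis i 1)"

text \<open>The point \<open>du\<^sub>x\<close> of the cotangent bundle in coordinates.\<close>

definition dsec :: "(real ^ 'n::finite \<Rightarrow> real) \<Rightarrow> real ^ 'n \<Rightarrow> (real ^ 'n) \<times> (real ^ 'n)" where
  "dsec u x = (x, \<chi> i. pd i u x)"

definition ham_grad ::
  "((real ^ 'n) \<times> (real ^ 'n) \<Rightarrow> real) \<Rightarrow> (real ^ 'n \<Rightarrow> real) \<Rightarrow> real ^ 'n \<Rightarrow> real ^ 'n::finite" where
  "ham_grad H u x = (\<chi> i. pdv i H (dsec u x))"

definition divergence ::
  "(real ^ 'n \<Rightarrow> real) \<Rightarrow> (real ^ 'n \<Rightarrow> real ^ 'n::finite) \<Rightarrow> real ^ 'n \<Rightarrow> real" where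
  "divergence \<sigma> V x = (\<Sum>i\<in>UNIV. pd i (\<lambda>y. V y $ i) x - V x $ i * pd i \<sigma> x)"

definition ham_laplacian ::
  "((real ^ 'n) \<times> (real ^ 'n) \<Rightarrow> real) \<Rightarrow> (real ^ 'n \<Rightarrow> real) \<Rightarrow> (real ^ 'n \<Rightarrow> real)
   \<Rightarrow> real ^ 'n::finite \<Rightarrow> real" where
  "ham_laplacian H \<sigma> u = divergence \<sigma> (ham_grad H u)"

definition lin_laplacian ::
  "((real ^ 'n) \<times> (real ^ 'n) \<Rightarrow> real) \<Rightarrow> (real ^ 'n \<Rightarrow> real) \<Rightarrow> (real ^ 'n \<Rightarrow> real)
   \<Rightarrow> (real ^ 'n \<Rightarrow> real) \<Rightarrow> real ^ 'n::finite \<Rightarrow> real" where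
  "lin_laplacian H \<sigma> u f = divergence \<sigma>
     (\<lambda>x. \<chi> i. \<Sum>j\<in>UNIV. fibre_hessian H (dsec u x) $ i $ j * pd j f x)"

text \<open>\<open>d(du)\<^sub>x\<close> has image \<open>S\<close>, the graph of a linear map from the horizontal to the vertical
  space: \<open>h\<close> is sent to the unique vertical \<open>w\<close> with \<open>h + w \<in> S\<close>. The Hessian is its negative.\<close>

definition ham_hess ::
  "(real ^ 'n \<Rightarrow> real) \<Rightarrow> real ^ 'n \<Rightarrow> (real ^ 'n) \<times> (real ^ 'n) \<Rightarrow> (real ^ 'n) \<times> (real ^ 'n::finite)"
  where
  "ham_hess u x h = - (THE w. w \<in> vertical \<and> h + w \<in> range (frechet_derivative (dsec u) (at x)))"

definition hess_HS_sq ::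
  "('n \<Rightarrow> real \<Rightarrow> (real ^ 'n) \<times> (real ^ 'n)) \<Rightarrow> (real ^ 'n \<Rightarrow> real) \<Rightarrow> real ^ 'n::finite \<Rightarrow> real" where
  "hess_HS_sq e u x =
     (\<Sum>i\<in>UNIV. \<Sum>j\<in>UNIV. (coeff_in (\<lambda>k. e k 0) (ham_hess u x (vd (e i) 0)) j)\<^sup>2)"

text \<open>The left-hand side \<open>\<Delta>\<^sup>d\<^sup>u (H(du)) - d(\<Delta>\<^sup>H u)(\<nabla>u)\<close> of the Bochner--Weitzenboeck formula.\<close>

definition bochner_lhs ::
  "((real ^ 'n) \<times> (real ^ 'n) \<Rightarrow> real) \<Rightarrow> (real ^ 'n \<Rightarrow> real) \<Rightarrow> (real ^ 'n \<Rightarrow> real)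
   \<Rightarrow> real ^ 'n::finite \<Rightarrow> real" where
  "bochner_lhs H \<sigma> u x = lin_laplacian H \<sigma> u (\<lambda>y. H (dsec u y)) x
     - frechet_derivative (ham_laplacian H \<sigma> u) (at x) (ham_grad H u x)"

end

theory Submission
  imports Defs
begin

text \<open>Put \<open>Q = H\<^sub>\<alpha>\<^sub>\<alpha>\<close>, \<open>P = H\<^sub>\<alpha>\<^sub>x\<close> and \<open>S = D\<^sup>2u\<close>. Pushing the canonical frame forward by the flow gives vertical
  vectors along the orbit; let \<open>B(t)\<close> be the matrix with these as columns. The variational equation of the flow
  turns the conditions on the frame into \<open>2QB' = - Q'B + PQB - QP\<^sup>TB\<close>, \<open>B\<^sup>TQB = 1\<close>, and expresses the
  curvature through \<open>B, B', B''\<close>. By Legendre duality \<open>L\<^sub>v\<^sub>v\<close> is inverse to \<open>Q\<close>, so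
  \<open>\<psi> = \<sigma> + ln \<bar>det B\<bar>\<close> along the orbit, and \<open>(ln \<bar>det B\<bar>)'\<close> is the trace of \<open>M = B'B\<^sup>-\<^sup>1\<close>.
  The Hessian is \<open>SQ + M + P\<^sup>T\<close> up to conjugation by \<open>B\<close>.

  On the other side, with \<open>V = \<nabla>u\<close> one has \<open>H\<^sub>\<alpha>\<^sub>\<alpha>(du) d(H(du)) = DV V - Z(du)\<close>, where \<open>Z\<close> is the acceleration of
  Hamiltonian orbits, so the left-hand side is \<open>tr((P + QS)\<^sup>2) - div(Z(du)) + (\<sigma> \<circ> \<eta>)''\<close>.
  Both sides then agree by expanding traces. The inequality follows from \<open>tr Hess = \<Delta>u + \<psi>'\<close> and
  Cauchy--Schwarz.\<close>

section \<open>Smooth maps\<close>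

text \<open>The chart is arbitrary, so neither \<open>P\<close> nor \<open>Q'\<close> can be assumed
  to vanish at the point, and the final comparison has to carry both. The relation for
  \<open>2QB'\<close> comes from computing the derivative of the base component of the
  pushed-forward frame velocity twice: that component is \<open>- QB\<close>, because the frame
  stays vertical, and it obeys the variational equation, to which the second derivative of the frame
  contributes nothing, being vertical too. After multiplication by \<open>B^-1\<close> on the right,
  its symmetric part is the derivative of \<open>B^T Q B = 1\<close>; its skew part is what makes
  the Hessian symmetric. Writing \<open>H_aa(du) d(H(du))\<close> through \<open>DV\<close> disposes
  of the third derivatives of \<open>u\<close>: both terms of the left-hand side contain the same
  second derivatives of \<open>V\<close>. Smoothness holds only off the zero section. Convex duality
  must therefore get past the origin, and the calculus on the cotangent bundle stays on the set
  where the covector is nonzero. For \<open>N > n\<close>, completing a square trades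
  \<open>(\<Delta>u + \<psi>')^2 / n\<close> for the term in \<open>N\<close> and the correction in
  \<open>Ric_N\<close>.\<close>

lemma Ck_on_cong:
  assumes "open S" "\<And>x. x \<in> S \<Longrightarrow> f x = g x" "Ck_on k f S"
  shows "Ck_on k g S"
  using assms(2,3)
proof (induction k arbitrary: f g)
  case 0
  then show ?case by (simp cong: continuous_on_cong)
next
  case (Suc k)
  have d: "f differentiable at x" if "x \<in> S" for x
    using Suc.prems that \<open>open S\<close> by (auto simp: differentiable_on_eq_differentiable_at)
  have g: "(g has_derivative frechet_derivative f (at x)) (at x)" if "x \<in> S" for x
    using d[OF that] Suc.prems(1) that \<open>open S\<close>
    by (auto simp: frechet_derivative_works intro: has_derivative_transform_within_open)
  have "frechet_derivative f (at x) v = frechet_derivative g (at x) v" if "x \<in> S" for x v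
    using frechet_derivative_at[OF g[OF that]] by simp
  then have "Ck_on k (\<lambda>x. frechet_derivative g (at x) v) S" for v
    using Suc.prems(2)
    by (intro Suc.IH[of "\<lambda>x. frechet_derivative f (at x) v" "\<lambda>x. frechet_derivative g (at x) v"]) simp_all
  moreover have "g differentiable_on S"
    using g \<open>open S\<close> by (auto simp: differentiable_on_eq_differentiable_at differentiable_def)
  ultimately show ?case by simp
qed

lemma Ck_on_subset:
  assumes "open S" "T \<subseteq> S" "Ck_on k f S" shows "Ck_on k f T"
  using assms(3)
proof (induction k arbitrary: f)
  case 0
  then show ?case using assms continuous_on_subset by auto
next
  case (Suc k)
  then show ?case using assms differentiable_on_subset by auto
qed

lemma Ck_on_SucD:
  assumes "Ck_on (Suc k) f S" shows "Ck_on k f S"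
  using assms
  by (induction k arbitrary: f) (auto simp: differentiable_imp_continuous_on)

text \<open>Replaces the chosen \<open>frechet_derivative\<close> by any witness \<open>f'\<close>,
  so that the closure proofs can supply the derivative given by the usual rules.\<close>

lemma Ck_on_Suc_open:
  assumes "open S"
  shows "Ck_on (Suc k) f S \<longleftrightarrow>
     (\<exists>f'. (\<forall>x\<in>S. (f has_derivative f' x) (at x)) \<and> (\<forall>v. Ck_on k (\<lambda>x. f' x v) S))"
proof
  assume "Ck_on (Suc k) f S"
  then show "\<exists>f'. (\<forall>x\<in>S. (f has_derivative f' x) (at x)) \<and> (\<forall>v. Ck_on k (\<lambda>x. f' x v) S)"
    using assms by (intro exI[of _ "\<lambda>x. frechet_derivative f (at x)"])
      (auto simp: differentiable_on_eq_differentiable_at frechet_derivative_works[symmetric])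
next
  assume "\<exists>f'. (\<forall>x\<in>S. (f has_derivative f' x) (at x)) \<and> (\<forall>v. Ck_on k (\<lambda>x. f' x v) S)"
  then obtain f' where f': "\<And>x. x\<in>S \<Longrightarrow> (f has_derivative f' x) (at x)"
    "\<And>v. Ck_on k (\<lambda>x. f' x v) S" by blast
  have "f' x = frechet_derivative f (at x)" if "x \<in> S" for x
    using frechet_derivative_at[OF f'(1)[OF that]] .
  then show "Ck_on (Suc k) f S"
    using f' assms Ck_on_cong[OF assms _ f'(2)]
    by (auto simp: differentiable_on_eq_differentiable_at differentiable_def)
qed

lemma Ck_on_const: "Ck_on k (\<lambda>x. c) S"
  by (induction k arbitrary: c) auto

lemma Ck_on_add:
  assumes "open S" "Ck_on k f S" "Ck_on k g S"
  shows "Ck_on k (\<lambda>x. f x + g x) S"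
  using assms(2,3)
proof (induction k arbitrary: f g)
  case 0
  then show ?case by (auto intro: continuous_intros)
next
  case (Suc k)
  then obtain f' g' where
    "\<forall>x\<in>S. (f has_derivative f' x) (at x)" "\<forall>v. Ck_on k (\<lambda>x. f' x v) S"
    "\<forall>x\<in>S. (g has_derivative g' x) (at x)" "\<forall>v. Ck_on k (\<lambda>x. g' x v) S"
    using assms(1) by (auto simp only: Ck_on_Suc_open)
  then show ?case unfolding Ck_on_Suc_open[OF assms(1)] using Suc.IH
    by (intro exI[of _ "\<lambda>x v. f' x v + g' x v"]) (auto intro!: has_derivative_add)
qed

lemma Ck_on_bounded_linear:
  assumes "open S" "bounded_linear l" "Ck_on k f S"
  shows "Ck_on k (\<lambda>x. l (f x)) S"
  using assms(3)
proof (induction k arbitrary: f)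
  case 0
  then show ?case by (simp add: assms(2) bounded_linear.continuous_on)
next
  case (Suc k)
  then obtain f' where
    "\<forall>x\<in>S. (f has_derivative f' x) (at x)" "\<forall>v. Ck_on k (\<lambda>x. f' x v) S"
    using assms(1) by (auto simp only: Ck_on_Suc_open)
  then show ?case unfolding Ck_on_Suc_open[OF assms(1)] using Suc.IH
    by (intro exI[of _ "\<lambda>x v. l (f' x v)"])
      (auto intro!: bounded_linear.has_derivative[OF assms(2)])
qed

lemma Ck_on_scaleR:
  assumes "open S" "Ck_on k r S" "Ck_on k f S"
  shows "Ck_on k (\<lambda>x. r x *\<^sub>R f x) S"
  using assms(2,3)
proof (induction k arbitrary: r f)
  case 0
  then show ?case by (auto intro: continuous_intros)
next
  case (Suc k)
  note prems = Suc.prems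
  then obtain r' f' where
    "\<forall>x\<in>S. (r has_derivative r' x) (at x)" "\<And>v. Ck_on k (\<lambda>x. r' x v) S"
    "\<forall>x\<in>S. (f has_derivative f' x) (at x)" "\<And>v. Ck_on k (\<lambda>x. f' x v) S"
    using assms(1) unfolding Ck_on_Suc_open[OF assms(1)] by metis
  then show ?case unfolding Ck_on_Suc_open[OF assms(1)]
    using Suc.IH prems[THEN Ck_on_SucD]
    by (intro exI[of _ "\<lambda>x v. r x *\<^sub>R f' x v + r' x v *\<^sub>R f x"])
      (auto intro!: has_derivative_scaleR Ck_on_add assms)
qed

lemma Ck_on_sum:
  assumes "open S" "\<And>i. i \<in> I \<Longrightarrow> Ck_on k (f i) S"
  shows "Ck_on k (\<lambda>x. \<Sum>i\<in>I. f i x) S"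
  using assms(2)
  by (induction I rule: infinite_finite_induct) (auto intro!: Ck_on_const Ck_on_add assms(1))

lemma Ck_on_compose:
  fixes f :: "'b::euclidean_space \<Rightarrow> 'c::real_normed_vector"
    and g :: "'a::euclidean_space \<Rightarrow> 'b"
  assumes "open S" "open T" "g ` S \<subseteq> T" "Ck_on k f T" "Ck_on k g S"
  shows "Ck_on k (\<lambda>x. f (g x)) S"
  using assms(4,5)
proof (induction k arbitrary: f)
  case 0
  then show ?case using assms(3) by (auto intro: continuous_on_compose2)
next
  case (Suc k)
  note prems = Suc.prems
  then obtain f' g' where *:
    "\<And>y. y\<in>T \<Longrightarrow> (f has_derivative f' y) (at y)" "\<And>v. Ck_on k (\<lambda>x. f' x v) T"
    "\<And>x. x\<in>S \<Longrightarrow> (g has_derivative g' x) (at x)" "\<And>v. Ck_on k (\<lambda>x. g' x v) S"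
    using assms(1,2) unfolding Ck_on_Suc_open[OF assms(1)] Ck_on_Suc_open[OF assms(2)] by metis
  \<comment> \<open>The class controls derivatives in fixed directions only, whereas the chain rule
    differentiates \<open>f\<close> in the moving direction \<open>g' x v\<close>. Expansion in
    \<open>Basis\<close> reduces this to fixed directions with scalar coefficients.\<close>
  have eq: "f' (g x) (g' x v) = (\<Sum>b\<in>Basis. (g' x v \<bullet> b) *\<^sub>R f' (g x) b)" if "x \<in> S" for x v
  proof -
    have "linear (f' (g x))"
      using *(1) that assms(3) by (auto intro: has_derivative_linear)
    then have "f' (g x) (\<Sum>b\<in>Basis. (g' x v \<bullet> b) *\<^sub>R b) = (\<Sum>b\<in>Basis. (g' x v \<bullet> b) *\<^sub>R f' (g x) b)"
      by (simp add: linear_sum linear_scale)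
    then show ?thesis by (simp add: euclidean_representation)
  qed
  have "Ck_on k (\<lambda>x. \<Sum>b\<in>Basis. (g' x v \<bullet> b) *\<^sub>R f' (g x) b) S" for v
    using prems(2)[THEN Ck_on_SucD] *(2,4) Suc.IH
    by (auto intro!: Ck_on_sum Ck_on_scaleR assms(1) Ck_on_bounded_linear[OF assms(1) bounded_linear_inner_left])
  then have "Ck_on k (\<lambda>x. f' (g x) (g' x v)) S" for v
    by (rule Ck_on_cong[OF assms(1), rotated]) (simp add: eq)
  moreover have "((\<lambda>x. f (g x)) has_derivative (\<lambda>v. f' (g x) (g' x v))) (at x)" if "x \<in> S" for x
    using *(1,3) that assms(3) by (intro has_derivative_compose[of g _ _ _ f]) auto
  ultimately show ?case unfolding Ck_on_Suc_open[OF assms(1)]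
    by (intro exI[of _ "\<lambda>x v. f' (g x) (g' x v)"]) simp
qed

lemma Ck_on_ident: "Ck_on k (\<lambda>x. x) S"
  by (cases k) (auto intro: Ck_on_const continuous_intros)

section \<open>Calculus of smooth maps on open sets\<close>

lemma smooth_on_frechet_derivative:
  assumes "smooth_on S f" shows "smooth_on S (\<lambda>x. frechet_derivative f (at x) v)"
  using assms unfolding smooth_on_def by (metis Ck_on.simps(2))

lemma smooth_on_has_derivative:
  assumes "smooth_on S f" "open S" "x \<in> S"
  shows "(f has_derivative frechet_derivative f (at x)) (at x)"
  using assms unfolding smooth_on_def
  by (metis Ck_on.simps(2) differentiable_on_eq_differentiable_at frechet_derivative_works)

lemma smooth_on_imp_differentiable:
  assumes "smooth_on S f" "open S" "x \<in> S"
  shows "f differentiable (at x)"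
  using smooth_on_has_derivative[OF assms] by (auto simp: differentiable_def)

lemma smooth_on_imp_continuous_on: "smooth_on S f \<Longrightarrow> continuous_on S f"
  unfolding smooth_on_def by (metis Ck_on.simps(1))

lemma smooth_on_cong:
  "open S \<Longrightarrow> smooth_on S f \<Longrightarrow> (\<And>x. x \<in> S \<Longrightarrow> f x = g x) \<Longrightarrow> smooth_on S g"
  unfolding smooth_on_def using Ck_on_cong by blast

lemma smooth_on_subset: "open S \<Longrightarrow> smooth_on S f \<Longrightarrow> T \<subseteq> S \<Longrightarrow> smooth_on T f"
  unfolding smooth_on_def using Ck_on_subset by blast

lemma smooth_on_const: "smooth_on S (\<lambda>x. c)"
  by (simp add: smooth_on_def Ck_on_const)

lemma smooth_on_ident: "smooth_on S (\<lambda>x. x)"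
  by (simp add: smooth_on_def Ck_on_ident)

lemma smooth_on_add:
  "open S \<Longrightarrow> smooth_on S f \<Longrightarrow> smooth_on S g \<Longrightarrow> smooth_on S (\<lambda>x. f x + g x)"
  by (simp add: smooth_on_def Ck_on_add)

lemma smooth_on_bounded_linear:
  "open S \<Longrightarrow> smooth_on S f \<Longrightarrow> bounded_linear l \<Longrightarrow> smooth_on S (\<lambda>x. l (f x))"
  by (simp add: smooth_on_def Ck_on_bounded_linear)

lemma smooth_on_scaleR:
  "open S \<Longrightarrow> smooth_on S r \<Longrightarrow> smooth_on S f \<Longrightarrow> smooth_on S (\<lambda>x. r x *\<^sub>R f x)"
  by (simp add: smooth_on_def Ck_on_scaleR)

lemma smooth_on_mult:
  fixes f g :: "_ \<Rightarrow> real"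
  shows "open S \<Longrightarrow> smooth_on S f \<Longrightarrow> smooth_on S g \<Longrightarrow> smooth_on S (\<lambda>x. f x * g x)"
  using smooth_on_scaleR[of S f g] by simp

lemma smooth_on_minus: "open S \<Longrightarrow> smooth_on S f \<Longrightarrow> smooth_on S (\<lambda>x. - f x)"
  using smooth_on_bounded_linear[OF _ _ bounded_linear_minus[OF bounded_linear_ident]] .

lemma smooth_on_diff:
  "open S \<Longrightarrow> smooth_on S f \<Longrightarrow> smooth_on S g \<Longrightarrow> smooth_on S (\<lambda>x. f x - g x)"
  using smooth_on_add[OF _ _ smooth_on_minus, of S f g] by simp

lemma smooth_on_sum:
  "open S \<Longrightarrow> (\<And>i. i \<in> I \<Longrightarrow> smooth_on S (f i)) \<Longrightarrow> smooth_on S (\<lambda>x. \<Sum>i\<in>I. f i x)"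
  by (simp add: smooth_on_def Ck_on_sum)

lemma smooth_on_compose:
  assumes "smooth_on T f" "smooth_on S g" "open S" "open T" "g ` S \<subseteq> T"
  shows "smooth_on S (\<lambda>x. f (g x))"
  using assms by (auto simp: smooth_on_def intro: Ck_on_compose)

lemma smooth_on_Pair:
  assumes "open S" "smooth_on S f" "smooth_on S g"
  shows "smooth_on S (\<lambda>x. (f x, g x))"
proof -
  have *: "bounded_linear (\<lambda>a. (a, 0))" "bounded_linear (\<lambda>b. (0, b))"
    by (intro bounded_linear_Pair bounded_linear_ident bounded_linear_zero)+
  have "smooth_on S (\<lambda>x. (f x, 0) + (0, g x))"
    by (intro smooth_on_add assms smooth_on_bounded_linear[OF _ _ *(1)] smooth_on_bounded_linear[OF _ _ *(2)])
  then show ?thesis by simp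
qed

lemma smooth_on_vec_lambda:
  fixes f :: "'n::finite \<Rightarrow> 'a::euclidean_space \<Rightarrow> real"
  assumes "open S" "\<And>i. smooth_on S (f i)"
  shows "smooth_on S (\<lambda>x. \<chi> i. f i x)"
proof -
  have "smooth_on S (\<lambda>x. \<Sum>i\<in>UNIV. f i x *\<^sub>R axis i (1::real))"
    by (intro smooth_on_sum smooth_on_scaleR assms smooth_on_const)
  moreover have "(\<Sum>i\<in>UNIV. f i x *\<^sub>R axis i 1) = (\<chi> i. f i x)" for x
    by (simp add: vec_eq_iff axis_def if_distrib sum.delta cong: if_cong)
  ultimately show ?thesis by simp
qed

text \<open>Both mixed derivatives are limits of the same second difference quotient, by applying the
  mean value theorem twice, in either order.\<close>

lemma second_difference:
  fixes f :: "'a::euclidean_space \<Rightarrow> real"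
  assumes f: "smooth_on S f" and S: "open S" and h: "0 < h"
    and dom: "\<And>s r. 0 \<le> s \<Longrightarrow> s \<le> h \<Longrightarrow> 0 \<le> r \<Longrightarrow> r \<le> h \<Longrightarrow> x + s *\<^sub>R v + r *\<^sub>R w \<in> S"
  obtains s r where "0 < s" "s < h" "0 < r" "r < h"
    "f (x + h *\<^sub>R v + h *\<^sub>R w) - f (x + h *\<^sub>R v) - f (x + h *\<^sub>R w) + f x =
     h\<^sup>2 * frechet_derivative (\<lambda>y. frechet_derivative f (at y) v) (at (x + s *\<^sub>R v + r *\<^sub>R w)) w"
proof -
  let ?D = "\<lambda>y. frechet_derivative f (at y) v"
  have der: "((\<lambda>s. g (a + s *\<^sub>R b)) has_real_derivative frechet_derivative g (at (a + s *\<^sub>R b)) b) (at s)"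
    if "smooth_on S g" "a + s *\<^sub>R b \<in> S" for g :: "'a \<Rightarrow> real" and a b s
  proof -
    have g: "(g has_derivative frechet_derivative g (at (a + s *\<^sub>R b))) (at (a + s *\<^sub>R b))"
      using smooth_on_has_derivative that S by blast
    have "((\<lambda>s. g (a + s *\<^sub>R b)) has_derivative (\<lambda>t. frechet_derivative g (at (a + s *\<^sub>R b)) (t *\<^sub>R b))) (at s)"
      by (rule has_derivative_compose[of "\<lambda>s. a + s *\<^sub>R b", OF _ g]) (auto intro!: derivative_eq_intros)
    then show ?thesis
      using linear_frechet_derivative[OF differentiableI[OF g]]
      by (simp add: has_field_derivative_def linear_scale mult_commute_abs)
  qed
  let ?g = "\<lambda>s. f (x + h *\<^sub>R w + s *\<^sub>R v) - f (x + s *\<^sub>R v)"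
  have "\<exists>s. 0 < s \<and> s < h \<and> ?g h - ?g 0 = (h - 0) * (?D (x + h *\<^sub>R w + s *\<^sub>R v) - ?D (x + s *\<^sub>R v))"
  proof (rule MVT2[OF h])
    fix s assume s: "0 \<le> s" "s \<le> h"
    then have "x + h *\<^sub>R w + s *\<^sub>R v \<in> S" "x + s *\<^sub>R v \<in> S"
      using dom[of s h] dom[of s 0] h by (auto simp: algebra_simps)
    then show "(?g has_real_derivative ?D (x + h *\<^sub>R w + s *\<^sub>R v) - ?D (x + s *\<^sub>R v)) (at s)"
      by (intro DERIV_diff der f)
  qed
  then obtain s where s: "0 < s" "s < h"
    "?g h - ?g 0 = h * (?D (x + h *\<^sub>R w + s *\<^sub>R v) - ?D (x + s *\<^sub>R v))" by auto
  let ?k = "\<lambda>r. ?D (x + s *\<^sub>R v + r *\<^sub>R w)"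
  have "\<exists>r. 0 < r \<and> r < h \<and> ?k h - ?k 0 = (h - 0) * frechet_derivative ?D (at (x + s *\<^sub>R v + r *\<^sub>R w)) w"
  proof (rule MVT2[OF h])
    fix r assume r: "0 \<le> r" "r \<le> h"
    then show "(?k has_real_derivative frechet_derivative ?D (at (x + s *\<^sub>R v + r *\<^sub>R w)) w) (at r)"
      using dom[of s r] s by (intro der smooth_on_frechet_derivative f) auto
  qed
  then obtain r where r: "0 < r" "r < h"
    "?k h - ?k 0 = h * frechet_derivative ?D (at (x + s *\<^sub>R v + r *\<^sub>R w)) w" by auto
  show ?thesis
  proof (rule that[OF s(1,2) r(1,2)])
    have "?g h - ?g 0 = h * (?k h - ?k 0)"
      using s(3) by (simp add: algebra_simps)
    then show "f (x + h *\<^sub>R v + h *\<^sub>R w) - f (x + h *\<^sub>R v) - f (x + h *\<^sub>R w) + f x =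
     h\<^sup>2 * frechet_derivative ?D (at (x + s *\<^sub>R v + r *\<^sub>R w)) w"
      using r(3) by (simp add: algebra_simps power2_eq_square)
  qed
qed

lemma mixed_derivatives_commute:
  fixes f :: "'a::euclidean_space \<Rightarrow> real"
  assumes f: "smooth_on S f" and S: "open S" and x: "x \<in> S"
  shows "frechet_derivative (\<lambda>y. frechet_derivative f (at y) v) (at x) w =
         frechet_derivative (\<lambda>y. frechet_derivative f (at y) w) (at x) v"
proof -
  define F where "F = (\<lambda>y. frechet_derivative (\<lambda>y. frechet_derivative f (at y) v) (at y) w)"
  define G where "G = (\<lambda>y. frechet_derivative (\<lambda>y. frechet_derivative f (at y) w) (at y) v)"
  have cont: "continuous_on S F" "continuous_on S G"
    unfolding F_def G_def by (intro smooth_on_imp_continuous_on smooth_on_frechet_derivative f)+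
  have "\<bar>F x - G x\<bar> < e" if "e > 0" for e
  proof -
    have "\<forall>\<^sub>F y in nhds x. y \<in> S" using S x by (rule eventually_nhds_in_open)
    moreover have "\<forall>\<^sub>F y in nhds x. dist (F y) (F x) < e/2" "\<forall>\<^sub>F y in nhds x. dist (G y) (G x) < e/2"
      using cont S x that by (auto simp: continuous_on_eq_continuous_at isCont_def tendsto_iff eventually_at_filter
          elim!: allE[of _ "e/2"] eventually_mono)
    ultimately have "\<forall>\<^sub>F y in nhds x. y \<in> S \<and> dist (F y) (F x) < e/2 \<and> dist (G y) (G x) < e/2"
      by (simp add: eventually_conj)
    then obtain d where d: "d > 0" "\<And>y. dist y x < d \<Longrightarrow> y \<in> S \<and> dist (F y) (F x) < e/2 \<and> dist (G y) (G x) < e/2"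
      unfolding eventually_nhds_metric by blast
    \<comment> \<open>The summand 1 keeps \<open>K\<close> positive even for
      \<open>v = w = 0\<close>; with this \<open>h\<close> the whole parallelogram lies in the ball
      of radius \<open>d\<close>.\<close>
    define K where "K = norm v + norm w + 1"
    define h where "h = d / (2 * K)"
    have h: "h > 0" "h * (norm v + norm w) < d"
    proof -
      have K: "K > 0" by (simp add: K_def add_nonneg_pos)
      then show "h > 0" using d(1) by (simp add: h_def)
      have "h * K = d / 2" using K by (simp add: h_def)
      then show "h * (norm v + norm w) < d" using d(1) \<open>h > 0\<close> by (simp add: K_def algebra_simps)
    qed
    have near: "dist (x + s *\<^sub>R v + r *\<^sub>R w) x < d" if "0 \<le> s" "s \<le> h" "0 \<le> r" "r \<le> h" for s r
    proof -
      have "dist (x + s *\<^sub>R v + r *\<^sub>R w) x = norm (s *\<^sub>R v + r *\<^sub>R w)" by (simp add: dist_norm algebra_simps)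
      also have "\<dots> \<le> s * norm v + r * norm w"
        using norm_triangle_ineq[of "s *\<^sub>R v" "r *\<^sub>R w"] that by simp
      also have "\<dots> \<le> h * norm v + h * norm w" using that by (intro add_mono mult_right_mono) auto
      finally show ?thesis using h(2) by (simp add: algebra_simps)
    qed
    obtain s r where 1: "0 < s" "s < h" "0 < r" "r < h"
      "f (x + h *\<^sub>R v + h *\<^sub>R w) - f (x + h *\<^sub>R v) - f (x + h *\<^sub>R w) + f x = h\<^sup>2 * F (x + s *\<^sub>R v + r *\<^sub>R w)"
      using second_difference[OF f S h(1), of x v w] near d(2) unfolding F_def by metis
    have near': "dist (x + s *\<^sub>R w + r *\<^sub>R v) x < d" if "0 \<le> s" "s \<le> h" "0 \<le> r" "r \<le> h" for s r
      using near[OF that(3,4,1,2)] by (simp add: add.commute add.left_commute)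
    obtain s' r' where 2: "0 < s'" "s' < h" "0 < r'" "r' < h"
      "f (x + h *\<^sub>R w + h *\<^sub>R v) - f (x + h *\<^sub>R w) - f (x + h *\<^sub>R v) + f x = h\<^sup>2 * G (x + s' *\<^sub>R w + r' *\<^sub>R v)"
      using second_difference[OF f S h(1), of x w v] near' d(2) unfolding G_def by metis
    have "h\<^sup>2 * F (x + s *\<^sub>R v + r *\<^sub>R w) = h\<^sup>2 * G (x + s' *\<^sub>R w + r' *\<^sub>R v)"
    proof -
      have eq: "x + h *\<^sub>R w + h *\<^sub>R v = x + h *\<^sub>R v + h *\<^sub>R w" by simp
      show ?thesis using 1(5) 2(5)[unfolded eq] by linarith
    qed
    then have "F (x + s *\<^sub>R v + r *\<^sub>R w) = G (x + s' *\<^sub>R w + r' *\<^sub>R v)" using h(1) by simp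
    moreover have "dist (F (x + s *\<^sub>R v + r *\<^sub>R w)) (F x) < e/2" using d(2) near 1 by auto
    moreover have "dist (G (x + s' *\<^sub>R w + r' *\<^sub>R v)) (G x) < e/2" using d(2) near' 2 by auto
    ultimately show ?thesis unfolding dist_real_def by linarith
  qed
  then have "F x = G x" by (metis abs_le_zero_iff eq_iff_diff_eq_0 linorder_not_less order.irrefl zero_less_abs_iff)
  then show ?thesis by (simp add: F_def G_def)
qed

section \<open>Charts and the Legendre transform\<close>

lemma transition_smooth:
  assumes A: "smooth_atlas A" and c: "c \<in> A" "c' \<in> A"
  shows "open (snd c ` (fst c \<inter> fst c'))"
    and "smooth_on (snd c ` (fst c \<inter> fst c')) (snd c' \<circ> coord_inv c)"
proof -
  show "smooth_on (snd c ` (fst c \<inter> fst c')) (snd c' \<circ> coord_inv c)"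
    using A c by (simp add: smooth_atlas_def)
  have h: "open (coord_dom c)" "open (fst c')" "homeomorphism (fst c) (coord_dom c) (snd c) (coord_inv c)"
    using A c by (auto simp: smooth_atlas_def)
  then have "open (coord_dom c \<inter> coord_inv c -` fst c')"
    by (intro continuous_open_preimage) (auto simp: homeomorphism_def)
  also have "coord_dom c \<inter> coord_inv c -` fst c' = snd c ` (fst c \<inter> fst c')"
    using h(3) by (force simp: homeomorphism_def coord_dom_def)
  finally show "open (snd c ` (fst c \<inter> fst c'))" .
qed

lemma coord_inv_chart:
  assumes "smooth_atlas A" "c \<in> A" "p \<in> fst c"
  shows "coord_inv c (snd c p) = p" "snd c p \<in> coord_dom c"
  using assms by (auto simp: smooth_atlas_def homeomorphism_def coord_dom_def)

lemma chart_coord_inv: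
  assumes "smooth_atlas A" "c \<in> A" "x \<in> coord_dom c"
  shows "snd c (coord_inv c x) = x" "coord_inv c x \<in> fst c"
  using assms by (auto simp: smooth_atlas_def homeomorphism_def coord_dom_def)

lemma open_coord_dom: "smooth_atlas A \<Longrightarrow> c \<in> A \<Longrightarrow> open (coord_dom c)"
  by (simp add: smooth_atlas_def)

lemma transition_differentiable:
  assumes "smooth_atlas A" "c \<in> A" "c' \<in> A" "p \<in> fst c \<inter> fst c'"
  shows "(snd c' \<circ> coord_inv c) differentiable (at (snd c p))"
  using smooth_on_imp_differentiable[OF transition_smooth(2,1)[OF assms(1-3)]] assms(4) by blast

text \<open>Compatibility of the components is the chain rule for the cocycle identity of the
  coordinate changes from \<open>c\<close> through \<open>c1\<close> to \<open>c2\<close>.\<close>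

lemma tvec_of_in_tangent:
  assumes A: "smooth_atlas A" and c: "c \<in> A" and p: "p \<in> fst c"
  shows "tvec_of A c p w \<in> tangent A p"
proof -
  have chain: "frechet_derivative (snd c2 \<circ> coord_inv c) (at (snd c p)) w =
     frechet_derivative (snd c2 \<circ> coord_inv c1) (at (snd c1 p)) (frechet_derivative (snd c1 \<circ> coord_inv c) (at (snd c p)) w)"
    if c12: "c1 \<in> A" "c2 \<in> A" "p \<in> fst c1" "p \<in> fst c2" for c1 c2
  proof -
    let ?g = "snd c1 \<circ> coord_inv c" and ?f = "snd c2 \<circ> coord_inv c1"
    have gp: "?g (snd c p) = snd c1 p" using coord_inv_chart[OF A c p] by simp
    have d: "?g differentiable (at (snd c p))" "?f differentiable (at (?g (snd c p)))"
      unfolding gp using transition_differentiable[OF A] c p c12 by simp_all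
    have "frechet_derivative (snd c2 \<circ> coord_inv c) (at (snd c p)) = frechet_derivative (?f \<circ> ?g) (at (snd c p))"
    proof (rule frechet_derivative_transform_within_open)
      show "(snd c2 \<circ> coord_inv c) differentiable (at (snd c p))"
        using transition_differentiable[OF A] c p c12 by simp
      show "open (snd c ` (fst c \<inter> fst c1))" by (rule transition_smooth[OF A c c12(1)])
      show "snd c p \<in> snd c ` (fst c \<inter> fst c1)" using p c12 by simp
      \<comment> \<open>Membership in \<open>fst c2\<close> is not asked for: both sides are
        \<open>snd c2 q\<close>, whether or not that value is meaningful.\<close>
      fix y assume "y \<in> snd c ` (fst c \<inter> fst c1)"
      then obtain q where q: "y = snd c q" "q \<in> fst c" "q \<in> fst c1" by auto
      then show "(snd c2 \<circ> coord_inv c) y = (?f \<circ> ?g) y"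
        using coord_inv_chart[OF A c q(2)] coord_inv_chart[OF A c12(1) q(3)] by simp
    qed
    then show ?thesis using frechet_derivative_compose[OF d] gp by (simp add: o_def)
  qed
  have val: "tvec_of A c p w c1 = frechet_derivative (snd c1 \<circ> coord_inv c) (at (snd c p)) w"
    if "c1 \<in> A" "p \<in> fst c1" for c1
    using that by (simp add: tvec_of_def)
  show ?thesis
    unfolding tangent_def mem_Collect_eq
  proof (intro conjI ballI allI impI)
    fix c1 c2 assume "c1 \<in> A" "c2 \<in> A" "p \<in> fst c1 \<inter> fst c2"
    then show "tvec_of A c p w c2 =
        frechet_derivative (snd c2 \<circ> coord_inv c1) (at (snd c1 p)) (tvec_of A c p w c1)"
      using val chain[of c1 c2] by (metis IntD1 IntD2)
  qed (auto simp: tvec_of_def)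
qed

lemma tvec_of_same_chart:
  assumes A: "smooth_atlas A" and c: "c \<in> A" and p: "p \<in> fst c"
  shows "tvec_of A c p w c = w"
proof -
  have "frechet_derivative (\<lambda>y. y) (at (snd c p)) = frechet_derivative (snd c \<circ> coord_inv c) (at (snd c p))"
    by (rule frechet_derivative_transform_within_open[OF _ open_coord_dom[OF A c]])
      (use coord_inv_chart[OF A c p] chart_coord_inv[OF A c] in auto)
  then show ?thesis using c p by (metis frechet_derivative_ident tvec_of_def)
qed

text \<open>Compatibility fixes the components in the charts around \<open>p\<close>; the convention
  of zero at all other indices settles the rest. Hence the components in one chart identify the
  tangent space with \<open>real ^ 'n\<close>.\<close>

lemma tangent_eq_tvec_of:
  assumes c: "c \<in> A" and p: "p \<in> fst c" and v: "v \<in> tangent A p"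
  shows "v = tvec_of A c p (v c)"
proof
  fix c'
  have *: "\<forall>c\<in>A. \<forall>c'\<in>A. p \<in> fst c \<inter> fst c' \<longrightarrow>
        v c' = frechet_derivative (snd c' \<circ> coord_inv c) (at (snd c p)) (v c)"
    "\<forall>c. \<not> (c \<in> A \<and> p \<in> fst c) \<longrightarrow> v c = 0"
    using v unfolding tangent_def by blast+
  show "v c' = tvec_of A c p (v c) c'"
  proof (cases "c' \<in> A \<and> p \<in> fst c'")
    case True
    then have "v c' = frechet_derivative (snd c' \<circ> coord_inv c) (at (snd c p)) (v c)"
      using *(1) c p by blast
    then show ?thesis unfolding tvec_of_def if_P[OF True] .
  next
    case False
    then show ?thesis using *(2) unfolding tvec_of_def if_not_P[OF False] by blast
  qed
qed

lemma tvec_of_0: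
  assumes A: "smooth_atlas A" and c: "c \<in> A" and p: "p \<in> fst c"
  shows "tvec_of A c p 0 = (\<lambda>_. 0)"
  using linear_0[OF linear_frechet_derivative[OF transition_differentiable[OF A c]]] p
  by (auto simp: tvec_of_def fun_eq_iff)

text \<open>Moves the supremum defining the Hamiltonian from abstract tangent vectors to
  coordinates, where duality becomes a statement about one function on a Euclidean space.\<close>

lemma covec_lag_image:
  assumes A: "smooth_atlas A" and c: "c \<in> A" and x: "x \<in> coord_dom c"
  shows "(\<lambda>v. covec_of c a v - \<L> (coord_inv c x) v) ` tangent A (coord_inv c x) =
     range (\<lambda>w. a \<bullet> w - lag_in A \<L> c (x, w))"
proof -
  let ?p = "coord_inv c x"
  have p: "?p \<in> fst c" using chart_coord_inv[OF A c x] by simp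
  have *: "covec_of c a (tvec_of A c ?p w) - \<L> ?p (tvec_of A c ?p w) = a \<bullet> w - lag_in A \<L> c (x, w)" for w
    using tvec_of_same_chart[OF A c p] by (simp add: covec_of_def lag_in_def)
  have "tangent A ?p = range (tvec_of A c ?p)"
    using tvec_of_in_tangent[OF A c p] tangent_eq_tvec_of[OF c p] by blast
  then show ?thesis by (simp add: image_image *)
qed

lemma ham_in_eq_SUP:
  assumes A: "smooth_atlas A" and c: "c \<in> A" and x: "x \<in> coord_dom c"
  shows "ham_in A \<L> c (x, a) = (SUP w. a \<bullet> w - lag_in A \<L> c (x, w))"
  unfolding ham_in_def hamiltonian_def by (simp add: covec_lag_image[OF A c x])

section \<open>Convexity and Legendre duality in a single fibre\<close>

text \<open>The slope of \<open>f\<close> along the segment is nondecreasing, and by the mean value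
  theorem the increment of \<open>f\<close> is the slope at an intermediate point. The gradient is
  differentiable only off the origin, so the segment has to avoid it.\<close>

lemma convex_gradient_bound_segment:
  fixes f :: "'a::euclidean_space \<Rightarrow> real"
  assumes df: "\<And>w. (f has_derivative (\<lambda>v. g w \<bullet> v)) (at w)"
    and dg: "\<And>w. w \<noteq> 0 \<Longrightarrow> (g has_derivative g' w) (at w)"
    and pos: "\<And>w v. w \<noteq> 0 \<Longrightarrow> 0 \<le> v \<bullet> g' w v"
    and seg: "\<And>s. 0 \<le> s \<Longrightarrow> s \<le> 1 \<Longrightarrow> w + s *\<^sub>R v \<noteq> 0"
  shows "f w + g w \<bullet> v \<le> f (w + v)"
proof -
  let ?\<phi> = "\<lambda>s. f (w + s *\<^sub>R v)" and ?\<phi>' = "\<lambda>s. g (w + s *\<^sub>R v) \<bullet> v"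
  have l: "((\<lambda>s. w + s *\<^sub>R v) has_derivative (\<lambda>t. t *\<^sub>R v)) (at s)" for s
    by (auto intro!: derivative_eq_intros)
  have 1: "(?\<phi> has_real_derivative ?\<phi>' s) (at s)" for s
    using has_derivative_compose[OF l df, of s]
    by (simp add: has_field_derivative_def mult_commute_abs)
  have 2: "(?\<phi>' has_real_derivative v \<bullet> g' (w + s *\<^sub>R v) v) (at s)" if "0 \<le> s" "s \<le> 1" for s
  proof -
    have lin: "linear (g' (w + s *\<^sub>R v))" using dg[OF seg[OF that]] has_derivative_linear by blast
    have "((\<lambda>s. g (w + s *\<^sub>R v) \<bullet> v) has_derivative (\<lambda>t. g' (w + s *\<^sub>R v) (t *\<^sub>R v) \<bullet> v)) (at s)"
      by (intro has_derivative_inner_left has_derivative_compose[OF l dg] seg that)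
    then show ?thesis using lin
      by (simp add: has_field_derivative_def mult_commute_abs linear_scale inner_commute)
  qed
  obtain z where z: "0 < z" "z < 1" "?\<phi> 1 - ?\<phi> 0 = (1 - 0) * ?\<phi>' z"
    using MVT2[of 0 1 ?\<phi> ?\<phi>'] 1 by auto
  have "?\<phi>' 0 \<le> ?\<phi>' z"
  proof (rule DERIV_nonneg_imp_nondecreasing[of 0 z ?\<phi>'])
    fix s assume "0 \<le> s" "s \<le> z"
    then show "\<exists>y. (?\<phi>' has_real_derivative y) (at s) \<and> 0 \<le> y"
      using 2[of s] pos seg[of s] z by (intro exI[of _ "v \<bullet> g' (w + s *\<^sub>R v) v"]) auto
  qed (use z in simp)
  then show ?thesis using z by simp
qed

text \<open>Strict convexity is only available away from the origin, where \<open>f\<close> need not be twice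
  differentiable; there \<open>f 0 = 0 \<le> f\<close> replaces it.\<close>

lemma convex_gradient_bound:
  fixes f :: "'a::euclidean_space \<Rightarrow> real"
  assumes df: "\<And>w. (f has_derivative (\<lambda>v. g w \<bullet> v)) (at w)"
    and dg: "\<And>w. w \<noteq> 0 \<Longrightarrow> (g has_derivative g' w) (at w)"
    and pos: "\<And>w v. w \<noteq> 0 \<Longrightarrow> 0 \<le> v \<bullet> g' w v"
    and f0: "f 0 = 0" and f_nonneg: "\<And>w. 0 \<le> f w" and w: "w \<noteq> 0"
  shows "f w + g w \<bullet> (w' - w) \<le> f w'"
proof (cases "\<exists>s. 0 \<le> s \<and> s \<le> 1 \<and> w + s *\<^sub>R (w' - w) = 0")
  case False
  then show ?thesis
    using convex_gradient_bound_segment[where f=f and g=g and g'=g' and w=w and v="w'-w", OF df dg pos] by force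
next
  case True
  then obtain s where s: "0 \<le> s" "s \<le> 1" "w + s *\<^sub>R (w' - w) = 0" by blast
  have s0: "s > 0" using s w by (cases "s = 0") auto
  \<comment> \<open>If the segment to \<open>w'\<close> meets the origin, the origin is approached
    along the ray through \<open>w\<close>: the segments to \<open>d *\<^sub>R w\<close> avoid it,
    and the limit \<open>d\<close> to 0 yields \<open>f w \<le> g w \<bullet> w\<close>.\<close>
  have radial: "f w + g w \<bullet> (d *\<^sub>R w - w) \<le> f (d *\<^sub>R w)" if "0 < d" "d < 1" for d :: real
  proof -
    have "w + t *\<^sub>R (d *\<^sub>R w - w) \<noteq> 0" if "0 \<le> t" "t \<le> 1" for t
    proof -
      have "w + t *\<^sub>R (d *\<^sub>R w - w) = (1 - t * (1 - d)) *\<^sub>R w" by (simp add: algebra_simps)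
      moreover have "t * (1 - d) \<le> 1 * (1 - d)" using that \<open>d < 1\<close> by (intro mult_right_mono) auto
      ultimately show ?thesis using w \<open>0 < d\<close> by auto
    qed
    then show ?thesis
      using convex_gradient_bound_segment[where f=f and g=g and g'=g' and w=w and v="d *\<^sub>R w-w", OF df dg pos] by simp
  qed
  have "isCont f 0" using df[of 0] has_derivative_continuous by blast
  then have "((\<lambda>d. f (d *\<^sub>R w)) \<longlongrightarrow> f (0 *\<^sub>R w)) (at_right 0)"
    by (intro isCont_tendsto_compose[of _ f]) (auto intro!: tendsto_eq_intros)
  moreover have "((\<lambda>d. f w + g w \<bullet> (d *\<^sub>R w - w)) \<longlongrightarrow> f w + g w \<bullet> (0 *\<^sub>R w - w)) (at_right 0)"
    by (intro tendsto_intros)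
  moreover have "\<forall>\<^sub>F d in at_right 0. f w + g w \<bullet> (d *\<^sub>R w - w) \<le> f (d *\<^sub>R w)"
    using radial by (auto simp: eventually_at_right_field intro!: exI[of _ 1])
  ultimately have "f w + g w \<bullet> (0 *\<^sub>R w - w) \<le> f (0 *\<^sub>R w)"
    by (intro tendsto_le[of "at_right 0" _ _ _ ]) auto
  then have 1: "f w \<le> g w \<bullet> w" using f0 by simp
  \<comment> \<open>Here \<open>w'\<close> lies at or beyond the origin,
    \<open>w' - w = - w / s\<close> with \<open>s \<le> 1\<close>. The affine minorant is at most
    its value at the origin there, which is nonpositive, while \<open>f w'\<close> is
    nonnegative.\<close>
  have "s *\<^sub>R (w' - w) = - w" using s(3) by (simp add: eq_neg_iff_add_eq_0 add.commute)
  then have "s * (g w \<bullet> (w' - w)) = - (g w \<bullet> w)" by (metis inner_minus_right inner_scaleR_right)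
  then have "g w \<bullet> (w' - w) = - (g w \<bullet> w) / s" using s0 by (simp add: field_simps)
  moreover have "g w \<bullet> w \<le> (g w \<bullet> w) / s"
    using 1 f_nonneg[of w] s s0 by (simp add: le_divide_eq mult_right_le_one_le)
  ultimately have "f w + g w \<bullet> (w' - w) \<le> 0" using 1 by simp
  then show ?thesis using f_nonneg[of w'] by simp
qed

text \<open>By the gradient bound, \<open>w\<close> attains the supremum defining
  \<open>h (g w)\<close>; by Young's inequality \<open>h b - b \<bullet> w\<close> is then minimal
  at \<open>b = g w\<close>, so its derivative \<open>k (g w) - w\<close> vanishes. Conversely, a
  minimiser of \<open>f w - a \<bullet> w\<close> solves \<open>g w = a\<close>, and it is nonzero
  since \<open>g 0 = 0\<close>. That a minimiser exists follows from the finiteness and continuity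
  of \<open>h\<close>.\<close>

lemma legendre_dual_gradients:
  fixes f h :: "'a::euclidean_space \<Rightarrow> real"
  assumes df: "\<And>w. (f has_derivative (\<lambda>v. g w \<bullet> v)) (at w)"
    and dg: "\<And>w. w \<noteq> 0 \<Longrightarrow> (g has_derivative g' w) (at w)"
    and pos: "\<And>w v. w \<noteq> 0 \<Longrightarrow> 0 \<le> v \<bullet> g' w v"
    and f0: "f 0 = 0" and f_nonneg: "\<And>w. 0 \<le> f w"
    and h: "\<And>a. h a = (SUP w. a \<bullet> w - f w)"
    and bdd: "\<And>a. bdd_above (range (\<lambda>w. a \<bullet> w - f w))"
    and dh: "\<And>a. (h has_derivative (\<lambda>v. k a \<bullet> v)) (at a)"
  shows "w \<noteq> 0 \<Longrightarrow> k (g w) = w"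
    and "a \<noteq> 0 \<Longrightarrow> \<exists>w. w \<noteq> 0 \<and> g w = a"
proof -
  have young: "a \<bullet> w - f w \<le> h a" for a w
    unfolding h by (rule cSUP_upper[OF _ bdd]) simp
  have crit: "k0 = 0" if "(\<phi> has_derivative (\<lambda>v. k0 \<bullet> v)) (at a)" "\<And>b. \<phi> a \<le> \<phi> b"
    for \<phi> :: "'a \<Rightarrow> real" and a k0
  proof -
    have "(\<lambda>v. k0 \<bullet> v) = (\<lambda>v. 0)"
      by (rule has_derivative_local_min[OF that(1)]) (simp add: that(2))
    then have "k0 \<bullet> k0 = 0" by metis
    then show ?thesis by simp
  qed
  show "k (g w) = w" if "w \<noteq> 0"
  proof -
    have "h (g w) \<le> g w \<bullet> w - f w"
      unfolding h
    proof (rule cSUP_least)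
      fix w' show "g w \<bullet> w' - f w' \<le> g w \<bullet> w - f w"
        using convex_gradient_bound[OF df dg pos f0 f_nonneg that, of w'] by (simp add: inner_diff_right)
    qed simp
    then have "h (g w) - g w \<bullet> w \<le> h b - b \<bullet> w" for b
      using young[of b w] by simp
    then have "k (g w) - w = 0"
      by (intro crit[of "\<lambda>b. h b - b \<bullet> w" _ "g w"])
        (auto intro!: derivative_eq_intros dh simp: fun_eq_iff inner_diff_left inner_diff_right inner_commute)
    then show ?thesis by simp
  qed
  show "\<exists>w. w \<noteq> 0 \<and> g w = a" if a: "a \<noteq> 0"
  proof -
    have g0: "g 0 = 0" by (rule crit[OF df]) (simp add: f0 f_nonneg)
    have "continuous_on (sphere 0 (norm a + 1)) h"
      using has_derivative_continuous[OF dh] by (intro continuous_at_imp_continuous_on) blast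
    then have "bounded (h ` sphere 0 (norm a + 1))"
      by (intro compact_imp_bounded compact_continuous_image) auto
    then obtain K where "\<forall>y\<in>h ` sphere 0 (norm a + 1). norm y \<le> K"
      unfolding bounded_iff by blast
    then have K: "\<bar>h b\<bar> \<le> K" if "norm b = norm a + 1" for b
      using that by auto
    \<comment> \<open>Young's inequality for the covector of norm \<open>norm a + 1\<close> in the
      direction of \<open>w\<close>. A slope exceeding \<open>norm a\<close> makes
      \<open>f w - a \<bullet> w\<close> coercive.\<close>
    have growth: "norm w * (norm a + 1) - K \<le> f w" for w
    proof (cases "w = 0")
      case True
      \<comment> \<open>At \<open>w = 0\<close> the claim is \<open>K \<ge> 0\<close>, which any
        point of the sphere witnesses.\<close>
      obtain i :: 'a where "i \<in> Basis" using nonempty_Basis by blast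
      then have "\<bar>h ((norm a + 1) *\<^sub>R i)\<bar> \<le> K" by (intro K) simp
      then show ?thesis using True f0 by auto
    next
      case False
      let ?b = "((norm a + 1) / norm w) *\<^sub>R w"
      have "?b \<bullet> w - f w \<le> K" using young[of ?b w] K[of ?b] False by auto
      moreover have "?b \<bullet> w = norm w * (norm a + 1)" using False
        by (simp add: dot_square_norm power2_eq_square)
      ultimately show ?thesis by simp
    qed
    let ?\<phi> = "\<lambda>w. f w - a \<bullet> w"
    have lower: "norm w - K \<le> ?\<phi> w" for w
      using growth[of w] norm_cauchy_schwarz[of a w] by (simp add: algebra_simps)
    have cont: "continuous_on (cball 0 \<bar>K\<bar>) ?\<phi>"
      using has_derivative_continuous[OF df]
      by (intro continuous_intros continuous_at_imp_continuous_on) blast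
    obtain w where w: "w \<in> cball 0 \<bar>K\<bar>" "\<And>w'. w' \<in> cball 0 \<bar>K\<bar> \<Longrightarrow> ?\<phi> w \<le> ?\<phi> w'"
      using continuous_attains_inf[OF _ _ cont] by auto
    have "?\<phi> w \<le> ?\<phi> w'" for w'
    proof (cases "w' \<in> cball 0 \<bar>K\<bar>")
      case False
      then have "0 \<le> ?\<phi> w'" using lower[of w'] by simp
      moreover have "?\<phi> w \<le> 0" using w(2)[of 0] f0 by simp
      ultimately show ?thesis by simp
    qed (use w in simp)
    then have "g w - a = 0"
      by (intro crit[of ?\<phi> _ w]) (auto intro!: derivative_eq_intros df simp: fun_eq_iff inner_diff_left)
    then show ?thesis using g0 a by (intro exI[of _ w]) auto
  qed
qed

section \<open>Partial derivatives on the cotangent bundle\<close>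

lemma frechet_derivative_pdx_pdv:
  fixes F :: "(real ^ 'n) \<times> (real ^ 'n::finite) \<Rightarrow> real"
  assumes "F differentiable (at z)"
  shows "frechet_derivative F (at z) (h, k) = (\<Sum>i\<in>UNIV. h $ i * pdx i F z) + (\<Sum>i\<in>UNIV. k $ i * pdv i F z)"
proof -
  let ?D = "frechet_derivative F (at z)"
  have lin: "linear ?D" by (rule linear_frechet_derivative[OF assms])
  have v: "(\<Sum>i\<in>UNIV. w $ i *\<^sub>R axis i 1) = w" for w :: "real ^ 'n"
    by (simp add: vec_eq_iff axis_def if_distrib sum.delta cong: if_cong)
  have "(h, k) = (\<Sum>i\<in>UNIV. h $ i *\<^sub>R (axis i 1, 0)) + (\<Sum>i\<in>UNIV. k $ i *\<^sub>R (0, axis i 1))"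
    by (simp add: prod_eq_iff fst_sum snd_sum v)
  then show ?thesis
    by (simp add: linear_add[OF lin] linear_sum[OF lin] linear_scale[OF lin] pdx_def pdv_def o_def
        del: scaleR_Pair)
qed

lemma frechet_derivative_pd:
  fixes f :: "real ^ 'n::finite \<Rightarrow> real"
  assumes "f differentiable (at x)"
  shows "frechet_derivative f (at x) h = (\<Sum>i\<in>UNIV. h $ i * pd i f x)"
proof -
  let ?D = "frechet_derivative f (at x)"
  have lin: "linear ?D" by (rule linear_frechet_derivative[OF assms])
  have "?D (\<Sum>i\<in>UNIV. h $ i *\<^sub>R axis i 1) = (\<Sum>i\<in>UNIV. h $ i * pd i f x)"
    by (simp add: linear_sum[OF lin] linear_scale[OF lin] pd_def o_def)
  moreover have "(\<Sum>i\<in>UNIV. h $ i *\<^sub>R axis i 1) = h"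
    by (simp add: vec_eq_iff axis_def if_distrib sum.delta cong: if_cong)
  ultimately show ?thesis by simp
qed

lemma has_derivative_vec_lambda:
  fixes f :: "'n::finite \<Rightarrow> 'a::real_normed_vector \<Rightarrow> real"
  assumes "\<And>i. (f i has_derivative f' i) F"
  shows "((\<lambda>x. \<chi> i. f i x) has_derivative (\<lambda>h. \<chi> i. f' i h)) F"
proof -
  have "((\<lambda>x. \<Sum>i\<in>UNIV. f i x *\<^sub>R axis i (1::real)) has_derivative (\<lambda>h. \<Sum>i\<in>UNIV. f' i h *\<^sub>R axis i 1)) F"
    by (intro has_derivative_sum has_derivative_scaleR_left assms)
  moreover have "(\<Sum>i\<in>UNIV. g i *\<^sub>R axis i 1) = (\<chi> i. g i)" for g :: "'n \<Rightarrow> real"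
    by (simp add: vec_eq_iff axis_def if_distrib sum.delta cong: if_cong)
  ultimately show ?thesis by simp
qed

lemma has_derivative_fibre:
  fixes F :: "(real ^ 'n) \<times> (real ^ 'n::finite) \<Rightarrow> real"
  assumes "F differentiable (at (x, w))"
  shows "((\<lambda>w. F (x, w)) has_derivative (\<lambda>v. (\<chi> i. pdv i F (x, w)) \<bullet> v)) (at w)"
proof -
  have "((\<lambda>w. F (x, w)) has_derivative (\<lambda>v. frechet_derivative F (at (x, w)) (0, v))) (at w)"
    by (rule has_derivative_compose[of "\<lambda>w. (x, w)" _ _ _ F])
      (use assms in \<open>auto intro!: derivative_eq_intros simp: frechet_derivative_works[symmetric]\<close>)
  then show ?thesis
    by (simp add: frechet_derivative_pdx_pdv[OF assms] inner_vec_def mult.commute)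
qed

lemma smooth_on_pdx: "smooth_on S F \<Longrightarrow> smooth_on S (pdx i F)"
  unfolding pdx_def by (rule smooth_on_frechet_derivative)

lemma smooth_on_pdv: "smooth_on S F \<Longrightarrow> smooth_on S (pdv i F)"
  unfolding pdv_def by (rule smooth_on_frechet_derivative)

lemma smooth_on_pd: "smooth_on S f \<Longrightarrow> smooth_on S (pd i f)"
  unfolding pd_def by (rule smooth_on_frechet_derivative)

text \<open>The transpose records the index order of \<open>fibre_hessian\<close>: its row index is
  the outer derivative, while the rows of the Jacobian belong to the inner one.\<close>

lemma has_derivative_fibre_gradient:
  fixes F :: "(real ^ 'n) \<times> (real ^ 'n::finite) \<Rightarrow> real"
  assumes F: "smooth_on S F" and S: "open S" "(x, w) \<in> S"
  shows "((\<lambda>w. \<chi> i. pdv i F (x, w)) has_derivative (\<lambda>v. transpose (fibre_hessian F (x, w)) *v v)) (at w)"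
proof -
  have "((\<lambda>w. pdv i F (x, w)) has_derivative (\<lambda>v. (\<chi> j. pdv j (pdv i F) (x, w)) \<bullet> v)) (at w)" for i
    by (intro has_derivative_fibre smooth_on_imp_differentiable[OF smooth_on_pdv[OF F] S])
  then have "((\<lambda>w. \<chi> i. pdv i F (x, w)) has_derivative (\<lambda>v. \<chi> i. (\<chi> j. pdv j (pdv i F) (x, w)) \<bullet> v)) (at w)"
    by (rule has_derivative_vec_lambda)
  moreover have "(\<chi> i. (\<chi> j. pdv j (pdv i F) (x, w)) \<bullet> v) = transpose (fibre_hessian F (x, w)) *v v" for v
    by (simp add: vec_eq_iff matrix_vector_mult_def transpose_def fibre_hessian_def inner_vec_def)
  ultimately show ?thesis by simp
qed

text \<open>The fibre gradients of \<open>L\<close> and \<open>H\<close> are inverse to each other;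
  differentiating their composite gives inverse Hessians. This turns the determinant of
  \<open>L\<close> in the weight into one of \<open>H\<close>, the only trace that the Lagrangian
  leaves in the curvature computation.\<close>

lemma det_fibre_hessian_legendre:
  assumes A: "smooth_atlas A" and \<L>: "lagrangian A \<L>" and reg: "regular_hamiltonian A \<L>"
    and c: "c \<in> A" and x: "x \<in> coord_dom c" and a: "a \<noteq> 0"
  defines "L \<equiv> lag_in A \<L> c" and "H \<equiv> ham_in A \<L> c"
  shows "det (fibre_hessian L (x, \<chi> i. pdv i H (x, a))) * det (fibre_hessian H (x, a)) = 1"
proof -
  have U: "open (coord_dom c)" using open_coord_dom[OF A c] .
  have p: "coord_inv c x \<in> fst c" using chart_coord_inv[OF A c x] by simp
  have op: "open (coord_dom c \<times> (- {0} :: (real ^ 'n) set))" using U by (intro open_Times) auto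
  have op': "open (coord_dom c \<times> (UNIV :: (real ^ 'n) set))" using U by (intro open_Times) auto
  have C1: "Ck_on 1 L (coord_dom c \<times> UNIV)" "Ck_on 1 H (coord_dom c \<times> UNIV)"
    using \<L> reg c by (simp_all add: lagrangian_def regular_hamiltonian_def L_def H_def)
  then have "L differentiable_on coord_dom c \<times> UNIV" "H differentiable_on coord_dom c \<times> UNIV"
    by auto
  then have d: "L differentiable (at (x, w))" "H differentiable (at (x, w))" for w
    using x unfolding differentiable_on_eq_differentiable_at[OF op'] by blast+
  have smooth: "smooth_on (coord_dom c \<times> - {0}) L" "smooth_on (coord_dom c \<times> - {0}) H"
    using \<L> reg c by (simp_all add: lagrangian_def regular_hamiltonian_def L_def H_def)
  let ?g = "\<lambda>w. \<chi> i. pdv i L (x, w)" and ?k = "\<lambda>a. \<chi> i. pdv i H (x, a)"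
  let ?g' = "\<lambda>w v. transpose (fibre_hessian L (x, w)) *v v"
  have dg: "(?g has_derivative ?g' w) (at w)" if "w \<noteq> 0" for w
    by (rule has_derivative_fibre_gradient[OF smooth(1) op]) (use x that in auto)
  have pos: "0 \<le> v \<bullet> ?g' w v" if "w \<noteq> 0" for w v
  proof (cases "v = 0")
    case False
    have "0 < v \<bullet> (fibre_hessian L (x, w) *v v)"
      using \<L> c x that False by (simp add: lagrangian_def L_def)
    moreover have "v \<bullet> ?g' w v = v \<bullet> (fibre_hessian L (x, w) *v v)"
      by (metis dot_lmul_matrix inner_commute transpose_matrix_vector)
    ultimately show ?thesis by linarith
  qed simp
  have L0: "L (x, 0) = 0"
    using \<L> by (simp add: L_def lag_in_def tvec_of_0[OF A c p] lagrangian_def)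
  have L_nonneg: "0 \<le> L (x, w)" for w
    using \<L> tvec_of_in_tangent[OF A c p] by (simp add: L_def lag_in_def lagrangian_def)
  have H_SUP: "H (x, a) = (SUP w. a \<bullet> w - L (x, w))" for a
    unfolding H_def L_def by (rule ham_in_eq_SUP[OF A c x])
  have "\<forall>p\<in>fst c. \<forall>a. bdd_above ((\<lambda>v. covec_of c a v - \<L> p v) ` tangent A p)"
    using reg c by (simp add: regular_hamiltonian_def)
  from bspec[OF this p, THEN spec]
  have bdd: "bdd_above (range (\<lambda>w. a \<bullet> w - L (x, w)))" for a
    unfolding L_def covec_lag_image[OF A c x, symmetric] .
  note dual = legendre_dual_gradients[where f="\<lambda>w. L (x, w)" and h="\<lambda>a. H (x, a)" and g="?g" and g'="?g'" and k="?k",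
      OF has_derivative_fibre[OF d(1)] dg pos L0 L_nonneg H_SUP bdd has_derivative_fibre[OF d(2)]]
  \<comment> \<open>The composite is differentiated at a velocity, but the statement starts from a
    covector \<open>a\<close>; surjectivity of the fibre gradient of \<open>L\<close> supplies the
    velocity.\<close>
  obtain w where w: "w \<noteq> 0" "?g w = a" using dual(2)[OF _ _ a] by blast
  have kw: "?k a = w" using dual(1)[OF _ _ w(1)] w(2) by simp
  have "((\<lambda>y. ?k (?g y)) has_derivative (\<lambda>v. transpose (fibre_hessian H (x, a)) *v ?g' w v)) (at w)"
  proof (rule has_derivative_compose[OF dg[OF w(1)]])
    show "(?k has_derivative (*v) (transpose (fibre_hessian H (x, a)))) (at (?g w))"
      unfolding w(2) by (rule has_derivative_fibre_gradient[OF smooth(2) op]) (use x a in auto)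
  qed
  \<comment> \<open>The composite is known to be the identity off the origin only, which is a
    neighbourhood of \<open>w\<close>.\<close>
  then have "((\<lambda>y. y) has_derivative (\<lambda>v. transpose (fibre_hessian H (x, a)) *v ?g' w v)) (at w)"
    by (rule has_derivative_transform_within_open[of _ _ _ _ "- {0}"]) (use w(1) dual(1) in auto)
  then have "(\<lambda>v. transpose (fibre_hessian H (x, a)) *v ?g' w v) = (\<lambda>v. v)"
    by (rule has_derivative_unique) (rule has_derivative_ident)
  then have "(transpose (fibre_hessian H (x, a)) ** transpose (fibre_hessian L (x, w))) *v v = mat 1 *v v" for v
    by (metis matrix_vector_mul_assoc matrix_vector_mul_lid)
  then have "transpose (fibre_hessian H (x, a)) ** transpose (fibre_hessian L (x, w)) = mat 1"
    by (simp add: matrix_eq)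
  then have "det (transpose (fibre_hessian H (x, a))) * det (transpose (fibre_hessian L (x, w))) = 1"
    by (metis det_I det_mul)
  then show ?thesis unfolding kw by (simp add: det_transpose mult.commute)
qed

section \<open>Matrix calculus\<close>

lemma bounded_bilinear_matrix_mult:
  "bounded_bilinear ((**) :: real ^ 'n ^ 'm \<Rightarrow> real ^ 'p ^ 'n \<Rightarrow> real ^ 'p ^ 'm)"
  unfolding bilinear_conv_bounded_bilinear[symmetric] bilinear_def
  by (intro conjI allI linearI)
    (simp_all add: vec_eq_iff matrix_matrix_mult_def sum.distrib distrib_left distrib_right
      sum_distrib_left mult_ac)

lemma bounded_linear_matrix_transpose:
  "bounded_linear (transpose :: real ^ 'n ^ 'm \<Rightarrow> real ^ 'm ^ 'n)"
  unfolding linear_conv_bounded_linear[symmetric]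
  by (intro linearI) (simp_all add: vec_eq_iff transpose_def)

lemma bounded_linear_trace: "bounded_linear (trace :: real ^ 'n ^ 'n \<Rightarrow> real)"
  unfolding linear_conv_bounded_linear[symmetric]
  by (intro linearI) (simp_all add: trace_def sum.distrib sum_distrib_left)

lemmas matrix_mult_distribs =
  bounded_bilinear.add_left[OF bounded_bilinear_matrix_mult]
  bounded_bilinear.add_right[OF bounded_bilinear_matrix_mult]
  bounded_bilinear.diff_left[OF bounded_bilinear_matrix_mult]
  bounded_bilinear.diff_right[OF bounded_bilinear_matrix_mult]
  bounded_bilinear.minus_left[OF bounded_bilinear_matrix_mult]
  bounded_bilinear.minus_right[OF bounded_bilinear_matrix_mult]
  bounded_bilinear.scaleR_left[OF bounded_bilinear_matrix_mult]
  bounded_bilinear.scaleR_right[OF bounded_bilinear_matrix_mult]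

lemmas trace_linear =
  linear_add[OF bounded_linear.linear[OF bounded_linear_trace]]
  linear_diff[OF bounded_linear.linear[OF bounded_linear_trace]]
  linear_neg[OF bounded_linear.linear[OF bounded_linear_trace]]
  linear_scale[OF bounded_linear.linear[OF bounded_linear_trace]]

lemmas transpose_linear =
  linear_add[OF bounded_linear.linear[OF bounded_linear_matrix_transpose]]
  linear_diff[OF bounded_linear.linear[OF bounded_linear_matrix_transpose]]
  linear_neg[OF bounded_linear.linear[OF bounded_linear_matrix_transpose]]
  linear_scale[OF bounded_linear.linear[OF bounded_linear_matrix_transpose]]

lemmas has_vector_derivative_matrix_mult =
  bounded_bilinear.has_vector_derivative[OF bounded_bilinear_matrix_mult]

lemmas has_vector_derivative_transpose =
  bounded_linear.has_vector_derivative[OF bounded_linear_matrix_transpose]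

lemmas has_vector_derivative_trace =
  bounded_linear.has_vector_derivative[OF bounded_linear_trace]

lemma trace_transpose: "trace (transpose A) = trace A"
  by (simp add: trace_def transpose_def)

text \<open>Jacobi's formula without the adjugate. Since the derivative is \<open>M ** B t\<close>,
  its row \<open>i\<close> is the combination of the rows of \<open>B t\<close> with coefficients
  \<open>M $ i\<close>, and replacing row \<open>i\<close> by it multiplies the determinant by
  \<open>M $ i $ i\<close>.\<close>

lemma has_real_derivative_det:
  fixes B :: "real \<Rightarrow> real ^ 'n ^ 'n"
  assumes "(B has_vector_derivative M ** B t) (at t)"
  shows "((\<lambda>t. det (B t)) has_real_derivative trace M * det (B t)) (at t)"
proof -
  let ?B' = "M ** B t"
  have entry: "((\<lambda>t. B t $ i $ j) has_real_derivative ?B' $ i $ j) (at t)" for i j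
    unfolding has_real_derivative_iff_has_vector_derivative
    by (intro bounded_linear.has_vector_derivative[OF bounded_linear_vec_nth] assms)
  have "((\<lambda>t. det (B t)) has_real_derivative
      (\<Sum>p | p permutes UNIV. of_int (sign p) * (\<Sum>i\<in>UNIV. ?B' $ i $ p i * (\<Prod>j\<in>UNIV - {i}. B t $ j $ p j)))) (at t)"
    unfolding det_def by (intro DERIV_sum DERIV_cmult has_field_derivative_prod entry)
  also have "(\<Sum>p | p permutes UNIV. of_int (sign p) * (\<Sum>i\<in>UNIV. ?B' $ i $ p i * (\<Prod>j\<in>UNIV - {i}. B t $ j $ p j)))
    = (\<Sum>i\<in>UNIV. det (\<chi> r. if r = i then ?B' $ r else B t $ r))"
  proof -
    have "(\<Prod>j\<in>UNIV. (\<chi> r. if r = i then ?B' $ r else B t $ r) $ j $ p j) =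
        ?B' $ i $ p i * (\<Prod>j\<in>UNIV - {i}. B t $ j $ p j)" for i :: 'n and p
      by (subst prod.remove[of _ i]) (auto intro!: prod.cong)
    then show ?thesis
      unfolding det_def by (simp add: sum_distrib_left) (rule sum.swap)
  qed
  also have "\<dots> = (\<Sum>i\<in>UNIV. M $ i $ i * det (B t))"
  proof (rule sum.cong[OF refl])
    fix i :: 'n
    have "(\<chi> r. if r = i then ?B' $ r else B t $ r) =
        (\<chi> r. if r = i then (\<Sum>k\<in>UNIV. M $ i $ k *s row k (B t)) else row r (B t))"
      by (simp add: vec_eq_iff row_def matrix_matrix_mult_def)
    then show "det (\<chi> r. if r = i then ?B' $ r else B t $ r) = M $ i $ i * det (B t)"
      using cramer_lemma_transpose[where x="M $ i" and k=i and A="B t"] by simp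
  qed
  finally show ?thesis by (simp add: trace_def sum_distrib_right)
qed

text \<open>\<open>R\<close> is the inverse of the frame matrix \<open>B\<close>. In the proof \<open>M\<close> is the logarithmic derivative of
  the frame and \<open>K\<close> the Hessian before conjugation by \<open>B\<close>.\<close>

lemma trace_bochner_identity:
  fixes Q P S Q' P' Hxx B B1 B2 :: "real ^ 'n ^ 'n"
  assumes sym: "transpose Q = Q" "transpose Q' = Q'" "transpose S = S"
    and orth: "transpose B ** Q ** B = mat 1"
    and frame: "2 *\<^sub>R (Q ** B1) = - (Q' ** B) + P ** Q ** B - Q ** transpose P ** B"
  defines "R \<equiv> transpose B ** Q"
  defines "n \<equiv> B2 + transpose P' ** B + 2 *\<^sub>R (transpose P ** B1) - Hxx ** Q ** B + transpose P ** transpose P ** B"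
    and "G \<equiv> R ** (S ** Q ** B + B1 + transpose P ** B)"
  shows "trace ((P + Q ** S) ** (P + Q ** S)) - (trace P' + trace (P ** P) - trace (Hxx ** Q))
      - trace ((Q' + P ** Q - Q ** transpose P) ** S)
      = - trace (R ** n) + trace (G ** transpose G)
        + (trace (B2 ** R) + trace (B1 ** transpose B1 ** Q) + trace (B1 ** transpose B ** Q'))"
    and "trace G = trace (P + Q ** S) + trace (B1 ** R)"
proof -
  define M where "M = B1 ** R"
  have RB: "R ** B = mat 1" using orth by (simp add: R_def)
  then have BR: "B ** R = mat 1" by (simp add: matrix_left_right_inverse)
  have B1: "B1 = M ** B" by (simp add: M_def RB flip: matrix_mul_assoc)
  have QM: "2 *\<^sub>R (Q ** M) = - Q' + P ** Q - Q ** transpose P"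
  proof -
    have "2 *\<^sub>R (Q ** M) = 2 *\<^sub>R (Q ** B1) ** R" by (simp add: M_def matrix_mult_distribs matrix_mul_assoc)
    also have "\<dots> = - Q' + P ** Q - Q ** transpose P"
      unfolding frame by (simp add: matrix_mult_distribs BR flip: matrix_mul_assoc)
    finally show ?thesis .
  qed
  define K where "K = S ** Q + M + transpose P"
  have conj: "trace (R ** (X ** B)) = trace X" for X
    by (metis BR matrix_mul_assoc matrix_mul_rid trace_mul_sym)
  have G: "G = R ** (K ** B)"
    by (simp add: G_def K_def B1 matrix_mult_distribs flip: matrix_mul_assoc)
  show "trace G = trace (P + Q ** S) + trace (B1 ** R)"
    unfolding G conj by (simp add: K_def M_def trace_linear trace_transpose trace_mul_sym[of Q S])
  \<comment> \<open>By the frame equation, \<open>Q ** M\<close> turns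
    \<open>Q ** transpose P\<close> into the average of itself and its transpose
    \<open>P ** Q\<close>, up to the symmetric term in \<open>Q'\<close>.\<close>
  have QK: "transpose (Q ** K) = Q ** K"
  proof -
    have "2 *\<^sub>R (Q ** K) = 2 *\<^sub>R (Q ** S ** Q) - Q' + P ** Q + Q ** transpose P"
      by (simp add: K_def matrix_mult_distribs scaleR_add_right QM matrix_mul_assoc)
         (simp add: scaleR_2)
    moreover have "transpose (2 *\<^sub>R (Q ** S ** Q) - Q' + P ** Q + Q ** transpose P) =
        2 *\<^sub>R (Q ** S ** Q) - Q' + P ** Q + Q ** transpose P"
      by (simp add: transpose_linear matrix_transpose_mul sym matrix_mul_assoc)
    ultimately have "2 *\<^sub>R transpose (Q ** K) = 2 *\<^sub>R (Q ** K)" by (metis transpose_scalar)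
    then show ?thesis by simp
  qed
  have "transpose G = G"
  proof -
    have "G = transpose B ** (Q ** K) ** B" by (simp add: G R_def matrix_mul_assoc)
    then show ?thesis by (simp add: matrix_transpose_mul QK matrix_mul_assoc)
        (metis QK matrix_mul_assoc matrix_transpose_mul)
  qed
  then have "trace (G ** transpose G) = trace (R ** ((K ** K) ** B))"
    by (simp add: G) (metis BR matrix_mul_assoc matrix_mul_lid)
  then have hess: "trace (G ** transpose G) = trace (K ** K)" by (simp only: conj)
  \<comment> \<open>The left side is the derivative of \<open>R = B^-1\<close>, so this is the
    formula \<open>- B^-1 B' B^-1\<close>; here it follows from the transposed frame
    equation.\<close>
  have TR: "transpose B1 ** Q + transpose B ** Q' = - (R ** M)"
  proof -
    have "2 *\<^sub>R (transpose B1 ** Q) = transpose B ** transpose (2 *\<^sub>R (Q ** M))"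
      by (simp add: B1 matrix_transpose_mul transpose_linear sym matrix_mult_distribs matrix_mul_assoc)
    also have "\<dots> = transpose B ** (- Q' + Q ** transpose P - P ** Q)"
      unfolding QM by (simp add: transpose_linear matrix_transpose_mul sym)
    also have "\<dots> = transpose B ** (- 2 *\<^sub>R Q' - 2 *\<^sub>R (Q ** M))"
      unfolding QM by (simp add: algebra_simps scaleR_2)
    also have "\<dots> = 2 *\<^sub>R (- (transpose B ** Q') - R ** M)"
      by (simp add: R_def matrix_mult_distribs matrix_mul_assoc scaleR_diff_right)
    finally have "transpose B1 ** Q = - (transpose B ** Q') - R ** M" by simp
    then show ?thesis by simp
  qed
  have "trace (B1 ** transpose B1 ** Q) + trace (B1 ** transpose B ** Q') = trace (B1 ** (transpose B1 ** Q + transpose B ** Q'))"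
    by (simp add: matrix_mult_distribs trace_linear matrix_mul_assoc)
  also have "\<dots> = - trace (M ** M)"
    unfolding TR by (simp add: matrix_mult_distribs trace_linear M_def matrix_mul_assoc)
  finally have l2: "trace (B1 ** transpose B1 ** Q) + trace (B1 ** transpose B ** Q') = - trace (M ** M)" .
  have ric: "trace (R ** n) = trace (B2 ** R) + trace P' + 2 * trace (transpose P ** M)
      - trace (Hxx ** Q) + trace (P ** P)"
  proof -
    have "R ** n = R ** B2 + R ** (transpose P' ** B) + 2 *\<^sub>R (R ** (transpose P ** M ** B))
       - R ** (Hxx ** Q ** B) + R ** (transpose P ** transpose P ** B)"
      by (simp add: n_def B1 matrix_mult_distribs matrix_mul_assoc)
    then show ?thesis
      by (simp add: trace_linear conj trace_transpose trace_mul_sym[of R B2])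
        (metis matrix_transpose_mul trace_transpose)
  qed
  \<comment> \<open>The mixed terms in \<open>S\<close> and \<open>M\<close> are collected as
    \<open>2 *\<^sub>R (Q ** M)\<close>, which the frame equation eliminates. The remaining terms in
    \<open>M\<close> cancel against those of \<open>ric\<close> and \<open>l2\<close>.\<close>
  have KK: "trace (K ** K) = trace (S ** Q ** S ** Q) + trace (S ** (2 *\<^sub>R (Q ** M))) + 2 * trace (S ** Q ** transpose P)
      + trace (M ** M) + 2 * trace (transpose P ** M) + trace (P ** P)"
  proof -
    have "trace (transpose P ** transpose P) = trace (P ** P)" by (metis matrix_transpose_mul trace_transpose)
    then show ?thesis
      using trace_mul_sym[of M "S ** Q"] trace_mul_sym[of "transpose P" "S ** Q"] trace_mul_sym[of M "transpose P"]
      by (simp add: K_def matrix_mult_distribs trace_linear matrix_mul_assoc)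
  qed
  have l: "trace ((P + Q ** S) ** (P + Q ** S)) = trace (P ** P) + 2 * trace (P ** Q ** S) + trace (S ** Q ** S ** Q)"
  proof -
    have "trace (Q ** S ** (Q ** S)) = trace (S ** Q ** S ** Q)"
      by (metis matrix_mul_assoc trace_mul_sym)
    then show ?thesis using trace_mul_sym[of "Q ** S" P]
      by (simp add: matrix_mult_distribs trace_linear matrix_mul_assoc)
  qed
  have SPQ: "trace (S ** Q ** transpose P) = trace (P ** Q ** S)"
    using trace_transpose[of "P ** Q ** S"] by (simp add: matrix_transpose_mul sym matrix_mul_assoc)
  have "trace (S ** (2 *\<^sub>R (Q ** M))) = - trace (Q' ** S) + trace (P ** Q ** S) - trace (Q ** transpose P ** S)"
    unfolding QM using trace_mul_sym[of S Q'] trace_mul_sym[of S "P ** Q"] trace_mul_sym[of S "Q ** transpose P"]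
    by (simp add: matrix_mult_distribs trace_linear)
  moreover have "trace (Q ** transpose P ** S) = trace (P ** Q ** S)"
    using trace_mul_sym[of S "Q ** transpose P"] SPQ by (simp add: matrix_mul_assoc)
  ultimately show "trace ((P + Q ** S) ** (P + Q ** S)) - (trace P' + trace (P ** P) - trace (Hxx ** Q))
      - trace ((Q' + P ** Q - Q ** transpose P) ** S)
      = - trace (R ** n) + trace (G ** transpose G)
        + (trace (B2 ** R) + trace (B1 ** transpose B1 ** Q) + trace (B1 ** transpose B ** Q'))"
    unfolding hess ric KK l add.assoc[of "trace (B2 ** R)"] l2 
    by (simp add: SPQ matrix_mult_distribs trace_linear)
qed

section \<open>The left-hand side in coordinates\<close>

text \<open>With this sign the bracket is the derivative of \<open>F\<close> along
  \<open>hamiltonian_vf H\<close>, hence along the orbits.\<close>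

definition poisson ::
  "((real ^ 'n) \<times> (real ^ 'n::finite) \<Rightarrow> real) \<Rightarrow> ((real ^ 'n) \<times> (real ^ 'n) \<Rightarrow> real)
   \<Rightarrow> (real ^ 'n) \<times> (real ^ 'n) \<Rightarrow> real" where
  "poisson H F z = (\<Sum>k\<in>UNIV. pdx k F z * pdv k H z - pdv k F z * pdx k H z)"

text \<open>Fibre index first, base index second: this is the Jacobian of the base velocity in the
  base point.\<close>

definition mixed_hessian ::
  "((real ^ 'n) \<times> (real ^ 'n::finite) \<Rightarrow> real) \<Rightarrow> (real ^ 'n) \<times> (real ^ 'n) \<Rightarrow> real ^ 'n ^ 'n" where
  "mixed_hessian H z = (\<chi> i j. pdx j (pdv i H) z)"

definition base_hessian ::
  "((real ^ 'n) \<times> (real ^ 'n::finite) \<Rightarrow> real) \<Rightarrow> (real ^ 'n) \<times> (real ^ 'n) \<Rightarrow> real ^ 'n ^ 'n" where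
  "base_hessian H z = (\<chi> i j. pdx j (pdx i H) z)"

definition second_partials :: "(real ^ 'n::finite \<Rightarrow> real) \<Rightarrow> real ^ 'n \<Rightarrow> real ^ 'n ^ 'n" where
  "second_partials u x = (\<chi> i j. pd i (pd j u) x)"

text \<open>The base component of the acceleration of a Hamiltonian orbit.\<close>

definition orbit_accel ::
  "((real ^ 'n) \<times> (real ^ 'n::finite) \<Rightarrow> real) \<Rightarrow> (real ^ 'n) \<times> (real ^ 'n) \<Rightarrow> 'n \<Rightarrow> real" where
  "orbit_accel H z i = (\<Sum>j\<in>UNIV. pdx j (pdv i H) z * pdv j H z - pdv i (pdv j H) z * pdx j H z)"

lemma pdv_pdv_commute: "smooth_on S F \<Longrightarrow> open S \<Longrightarrow> z \<in> S \<Longrightarrow> pdv i (pdv j F) z = pdv j (pdv i F) z"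
  unfolding pdv_def by (rule mixed_derivatives_commute)

lemma pdx_pdx_commute: "smooth_on S F \<Longrightarrow> open S \<Longrightarrow> z \<in> S \<Longrightarrow> pdx i (pdx j F) z = pdx j (pdx i F) z"
  unfolding pdx_def by (rule mixed_derivatives_commute)

lemma pdv_pdx_commute: "smooth_on S F \<Longrightarrow> open S \<Longrightarrow> z \<in> S \<Longrightarrow> pdv i (pdx j F) z = pdx j (pdv i F) z"
  unfolding pdx_def pdv_def by (rule mixed_derivatives_commute)

lemma pd_pd_commute: "smooth_on S f \<Longrightarrow> open S \<Longrightarrow> x \<in> S \<Longrightarrow> pd i (pd j f) x = pd j (pd i f) x"
  unfolding pd_def by (rule mixed_derivatives_commute)

lemma transpose_fibre_hessian:
  "smooth_on S F \<Longrightarrow> open S \<Longrightarrow> z \<in> S \<Longrightarrow> transpose (fibre_hessian F z) = fibre_hessian F z"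
  by (simp add: vec_eq_iff transpose_def fibre_hessian_def pdv_pdv_commute)

lemma transpose_second_partials:
  "smooth_on S f \<Longrightarrow> open S \<Longrightarrow> x \<in> S \<Longrightarrow> transpose (second_partials f x) = second_partials f x"
  by (simp add: vec_eq_iff transpose_def second_partials_def pd_pd_commute)

text \<open>Both functions have the same derivatives at \<open>x\<close>, if any, so the choice in
  \<open>frechet_derivative\<close> returns the same map even where neither is
  differentiable.\<close>

lemma frechet_derivative_cong_open:
  assumes "open S" "x \<in> S" "\<And>y. y \<in> S \<Longrightarrow> f y = g y"
  shows "frechet_derivative f (at x) = frechet_derivative g (at x)"
proof -
  have "(f has_derivative D) (at x) \<longleftrightarrow> (g has_derivative D) (at x)" for D
    using has_derivative_transform_within_open[of f D x UNIV S g]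
      has_derivative_transform_within_open[of g D x UNIV S f] assms by auto
  then show ?thesis unfolding frechet_derivative_def by simp
qed

lemma pd_cong_open: "open S \<Longrightarrow> x \<in> S \<Longrightarrow> (\<And>y. y \<in> S \<Longrightarrow> f y = g y) \<Longrightarrow> pd i f x = pd i g x"
  unfolding pd_def using frechet_derivative_cong_open[of S x f g] by simp

lemma pd_diff:
  assumes "f differentiable (at x)" "g differentiable (at x)"
  shows "pd i (\<lambda>y. f y - g y) x = pd i f x - pd i g x"
  using frechet_derivative_at[OF has_derivative_diff[OF assms[unfolded frechet_derivative_works]]]
  unfolding pd_def by metis

lemma pd_mult:
  assumes "f differentiable (at x)" "g differentiable (at x)"
  shows "pd i (\<lambda>y. f y * g y) x = f x * pd i g x + pd i f x * g x"
  using frechet_derivative_at[OF has_derivative_mult[OF assms[unfolded frechet_derivative_works]]]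
  unfolding pd_def by metis

lemma pd_sum:
  assumes "\<And>k. k \<in> I \<Longrightarrow> f k differentiable (at x)"
  shows "pd i (\<lambda>y. \<Sum>k\<in>I. f k y) x = (\<Sum>k\<in>I. pd i (f k) x)"
proof -
  have "((\<lambda>y. \<Sum>k\<in>I. f k y) has_derivative (\<lambda>h. \<Sum>k\<in>I. frechet_derivative (f k) (at x) h)) (at x)"
    using assms by (intro has_derivative_sum) (simp add: frechet_derivative_works)
  from frechet_derivative_at[OF this] show ?thesis unfolding pd_def by metis
qed

lemma directional_diff:
  assumes "f differentiable (at x)" "g differentiable (at x)"
  shows "frechet_derivative (\<lambda>y. f y - g y) (at x) v = frechet_derivative f (at x) v - frechet_derivative g (at x) v"
  using frechet_derivative_at[OF has_derivative_diff[OF assms[unfolded frechet_derivative_works]]]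
  by metis

lemma directional_mult:
  fixes f g :: "'a::real_normed_vector \<Rightarrow> real"
  assumes "f differentiable (at x)" "g differentiable (at x)"
  shows "frechet_derivative (\<lambda>y. f y * g y) (at x) v =
     f x * frechet_derivative g (at x) v + frechet_derivative f (at x) v * g x"
  using frechet_derivative_at[OF has_derivative_mult[OF assms[unfolded frechet_derivative_works]]]
  by metis

lemma directional_sum:
  assumes "\<And>k. k \<in> I \<Longrightarrow> f k differentiable (at x)"
  shows "frechet_derivative (\<lambda>y. \<Sum>k\<in>I. f k y) (at x) v = (\<Sum>k\<in>I. frechet_derivative (f k) (at x) v)"
proof -
  have "((\<lambda>y. \<Sum>k\<in>I. f k y) has_derivative (\<lambda>h. \<Sum>k\<in>I. frechet_derivative (f k) (at x) h)) (at x)"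
    using assms by (intro has_derivative_sum) (simp add: frechet_derivative_works)
  from frechet_derivative_at[OF this] show ?thesis by metis
qed

lemma smooth_on_dsec:
  assumes "smooth_on U u" "open U" shows "smooth_on U (dsec u)"
  unfolding dsec_def[abs_def] using assms
  by (intro smooth_on_Pair smooth_on_ident smooth_on_vec_lambda smooth_on_pd) auto

lemma dsec_has_derivative:
  assumes "smooth_on U u" "open U" "x \<in> U"
  shows "(dsec u has_derivative (\<lambda>h. (h, h v* second_partials u x))) (at x)"
proof -
  have "((\<lambda>y. \<chi> i. pd i u y) has_derivative (\<lambda>h. \<chi> i. \<Sum>j\<in>UNIV. h $ j * pd j (pd i u) x)) (at x)"
  proof (rule has_derivative_vec_lambda)
    fix i
    have s: "smooth_on U (pd i u)" by (rule smooth_on_pd[OF assms(1)])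
    have "frechet_derivative (pd i u) (at x) = (\<lambda>h. \<Sum>j\<in>UNIV. h $ j * pd j (pd i u) x)"
      using frechet_derivative_pd[OF smooth_on_imp_differentiable[OF s assms(2,3)]] by blast
    then show "((\<lambda>y. pd i u y) has_derivative (\<lambda>h. \<Sum>j\<in>UNIV. h $ j * pd j (pd i u) x)) (at x)"
      using smooth_on_has_derivative[OF s assms(2,3)] by simp
  qed
  then have "((\<lambda>y. (y, \<chi> i. pd i u y)) has_derivative (\<lambda>h. (h, \<chi> i. \<Sum>j\<in>UNIV. h $ j * pd j (pd i u) x))) (at x)"
    by (intro has_derivative_Pair has_derivative_ident)
  moreover have "(\<chi> i. \<Sum>j\<in>UNIV. h $ j * pd j (pd i u) x) = h v* second_partials u x" for h
    by (simp add: vector_matrix_mult_def second_partials_def mult.commute)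
  ultimately show ?thesis unfolding dsec_def[abs_def] by simp
qed

lemma pd_along_dsec:
  assumes u: "smooth_on U u" "open U" "x \<in> U" and F: "F differentiable (at (dsec u x))"
  shows "pd i (\<lambda>y. F (dsec u y)) x =
     pdx i F (dsec u x) + (\<Sum>k\<in>UNIV. pdv k F (dsec u x) * pd i (pd k u) x)"
proof -
  have "((\<lambda>y. F (dsec u y)) has_derivative
      (\<lambda>h. frechet_derivative F (at (dsec u x)) (h, h v* second_partials u x))) (at x)"
    by (rule has_derivative_compose[where g=F and g'="frechet_derivative F (at (dsec u x))",
          OF dsec_has_derivative[OF u] F[unfolded frechet_derivative_works]])
  then have "pd i (\<lambda>y. F (dsec u y)) x = frechet_derivative F (at (dsec u x)) (axis i 1, axis i 1 v* second_partials u x)"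
    unfolding pd_def by (rule fun_cong[OF frechet_derivative_at, symmetric])
  also have "\<dots> = pdx i F (dsec u x) + (\<Sum>k\<in>UNIV. pdv k F (dsec u x) * pd i (pd k u) x)"
    unfolding frechet_derivative_pdx_pdv[OF F]
    by (simp add: axis_def vector_matrix_mult_def second_partials_def if_distrib if_distribR mult.commute cong: if_cong)
  finally show ?thesis .
qed

text \<open>The divergence of \<open>DV V\<close> and the derivative of \<open>div V\<close> along
  \<open>V\<close> share the second derivatives of \<open>V\<close>, which cancel and leave the
  trace of the square of \<open>DV\<close>. The density terms combine in the same way into the
  second derivative of \<open>\<sigma>\<close> along the orbit.\<close>

lemma bochner_lhs_flat:
  fixes H :: "(real ^ 'n) \<times> (real ^ 'n::finite) \<Rightarrow> real"
  assumes U: "open U" and H: "smooth_on (U \<times> - {0}) H"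
    and u: "smooth_on U u" and \<sigma>: "smooth_on U \<sigma>" and x: "x \<in> U" "snd (dsec u x) \<noteq> 0"
  defines "V \<equiv> \<lambda>i y. pdv i H (dsec u y)" and "Z \<equiv> \<lambda>i z. orbit_accel H z i"
  shows "bochner_lhs H \<sigma> u x =
     (\<Sum>i\<in>UNIV. \<Sum>k\<in>UNIV. pd k (V i) x * pd i (V k) x) - (\<Sum>i\<in>UNIV. pd i (\<lambda>y. Z i (dsec u y)) x)
     + (\<Sum>i\<in>UNIV. Z i (dsec u x) * pd i \<sigma> x)
     + (\<Sum>k\<in>UNIV. \<Sum>i\<in>UNIV. V k x * V i x * pd k (pd i \<sigma>) x)"
proof -
  let ?\<Omega> = "U \<times> - {0 :: real ^ 'n}"
  have \<Omega>: "open ?\<Omega>" using U by (intro open_Times) auto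
  \<comment> \<open>\<open>H\<close> is smooth only off the zero section, so the calculus is done on
    the open set where \<open>du\<close> is nonzero.\<close>
  define N where "N = U \<inter> dsec u -` ?\<Omega>"
  have N: "open N" unfolding N_def
    using smooth_on_imp_continuous_on[OF smooth_on_dsec[OF u U]] U \<Omega> by (rule continuous_open_preimage)
  have NU: "N \<subseteq> U" "dsec u ` N \<subseteq> ?\<Omega>" by (auto simp: N_def)
  have xN: "x \<in> N" using x by (simp add: N_def dsec_def)
  have along: "smooth_on N (\<lambda>y. F (dsec u y))" if "smooth_on ?\<Omega> F" for F :: "_ \<Rightarrow> real"
    by (rule smooth_on_compose[OF that smooth_on_subset[OF U smooth_on_dsec[OF u U] NU(1)] N \<Omega> NU(2)])
  have V: "smooth_on N (V i)" for i
    unfolding V_def by (intro along smooth_on_pdv H)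
  have "smooth_on ?\<Omega> (Z i)" for i
    unfolding Z_def orbit_accel_def
    by (intro smooth_on_sum smooth_on_diff smooth_on_mult smooth_on_pdv smooth_on_pdx H \<Omega>)
  then have Zu: "smooth_on N (\<lambda>y. Z i (dsec u y))" for i by (rule along)
  have \<sigma>N: "smooth_on N \<sigma>" by (rule smooth_on_subset[OF U \<sigma> NU(1)])
  note d = smooth_on_imp_differentiable[OF _ N xN]
  note sm = smooth_on_sum smooth_on_diff smooth_on_mult smooth_on_pd V Zu \<sigma>N N
  \<comment> \<open>With \<open>H_x\<close> the base gradient, the left side is
    \<open>Q H_x + Q S V\<close>, while \<open>DV V = P V + Q S V\<close> and the acceleration is
    \<open>P V - Q H_x\<close>. The equality is proved near \<open>x\<close>, since its divergence
    is taken next.\<close>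
  have flux: "(\<Sum>j\<in>UNIV. fibre_hessian H (dsec u y) $ i $ j * pd j (\<lambda>y. H (dsec u y)) y) =
      (\<Sum>k\<in>UNIV. pd k (V i) y * V k y) - Z i (dsec u y)" if y: "y \<in> N" for i y
  proof -
    have yU: "y \<in> U" "dsec u y \<in> ?\<Omega>" using y NU by auto
    note chain = pd_along_dsec[OF u U yU(1) smooth_on_imp_differentiable[OF _ \<Omega> yU(2)]]
    have s: "pdv k (pdv i H) (dsec u y) = pdv i (pdv k H) (dsec u y)"
      "pd j (pd k u) y = pd k (pd j u) y" for i j k
      using pdv_pdv_commute[OF H \<Omega> yU(2)] pd_pd_commute[OF u U yU(1)] by auto
    have "(\<Sum>j\<in>UNIV. \<Sum>k\<in>UNIV. pdv i (pdv j H) (dsec u y) * (pdv k H (dsec u y) * pd j (pd k u) y)) =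
       (\<Sum>k\<in>UNIV. \<Sum>j\<in>UNIV. pdv j (pdv i H) (dsec u y) * pd k (pd j u) y * pdv k H (dsec u y))"
      by (subst sum.swap) (simp add: s mult_ac)
    then show ?thesis
      by (simp add: V_def Z_def orbit_accel_def fibre_hessian_def chain[OF H] chain[OF smooth_on_pdv[OF H]]
          distrib_left distrib_right sum_distrib_left sum_distrib_right sum.distrib sum_subtractf)
  qed
  have lin: "lin_laplacian H \<sigma> u (\<lambda>y. H (dsec u y)) x =
     (\<Sum>i\<in>UNIV. (\<Sum>k\<in>UNIV. pd k (V i) x * pd i (V k) x + pd i (pd k (V i)) x * V k x) - pd i (\<lambda>y. Z i (dsec u y)) x
        - ((\<Sum>k\<in>UNIV. pd k (V i) x * V k x) - Z i (dsec u x)) * pd i \<sigma> x)"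
  proof -
    have "pd i (\<lambda>y. \<Sum>j\<in>UNIV. fibre_hessian H (dsec u y) $ i $ j * pd j (\<lambda>y. H (dsec u y)) y) x =
        pd i (\<lambda>y. (\<Sum>k\<in>UNIV. pd k (V i) y * V k y) - Z i (dsec u y)) x" for i
      by (rule pd_cong_open[OF N xN flux])
    also have "\<dots> i = (\<Sum>k\<in>UNIV. pd k (V i) x * pd i (V k) x + pd i (pd k (V i)) x * V k x) - pd i (\<lambda>y. Z i (dsec u y)) x" for i
      by (subst pd_diff pd_sum pd_mult; (intro d sm)?)+ simp
    finally show ?thesis
      unfolding lin_laplacian_def divergence_def by (simp add: flux[OF xN])
  qed
  have "frechet_derivative (ham_laplacian H \<sigma> u) (at x) v =
      (\<Sum>i\<in>UNIV. frechet_derivative (pd i (V i)) (at x) v -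
        (V i x * frechet_derivative (pd i \<sigma>) (at x) v + frechet_derivative (V i) (at x) v * pd i \<sigma> x))" for v
  proof -
    have "ham_laplacian H \<sigma> u = (\<lambda>y. \<Sum>i\<in>UNIV. pd i (V i) y - V i y * pd i \<sigma> y)"
      by (simp add: ham_laplacian_def divergence_def fun_eq_iff ham_grad_def V_def)
    then show ?thesis
      by (simp only:, (subst directional_sum directional_diff directional_mult; (intro d sm)?)+) (rule refl)
  qed
  moreover have "ham_grad H u x $ k = V k x" for k by (simp add: ham_grad_def V_def)
  ultimately have lap: "frechet_derivative (ham_laplacian H \<sigma> u) (at x) (ham_grad H u x) =
      (\<Sum>i\<in>UNIV. (\<Sum>k\<in>UNIV. V k x * pd k (pd i (V i)) x) -
        (V i x * (\<Sum>k\<in>UNIV. V k x * pd k (pd i \<sigma>) x) + (\<Sum>k\<in>UNIV. V k x * pd k (V i) x) * pd i \<sigma> x))"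
    by (simp add: frechet_derivative_pd[OF d] V \<sigma>N smooth_on_pd)
  have comm: "pd k (pd i (V i)) x = pd i (pd k (V i)) x" for i k
    by (rule pd_pd_commute[OF V N xN])
  have sw: "(\<Sum>k\<in>UNIV. \<Sum>i\<in>UNIV. V k x * V i x * pd k (pd i \<sigma>) x) = (\<Sum>i\<in>UNIV. V i x * (\<Sum>k\<in>UNIV. V k x * pd k (pd i \<sigma>) x))"
    by (subst sum.swap) (simp add: sum_distrib_left mult_ac)
  show ?thesis
    unfolding bochner_lhs_def lin lap comm sw
    by (simp add: sum_subtractf sum.distrib algebra_simps)
qed

text \<open>The chain rule separates the base derivatives of the acceleration from its fibre
  derivatives, the latter paired with the second derivatives of \<open>u\<close>. The third
  derivatives of \<open>H\<close> regroup into derivatives of \<open>P\<close> and \<open>Q\<close>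
  along the flow.\<close>

lemma sum_pd_orbit_accel:
  fixes H :: "(real ^ 'n) \<times> (real ^ 'n::finite) \<Rightarrow> real"
  assumes U: "open U" and H: "smooth_on (U \<times> - {0}) H"
    and u: "smooth_on U u" and x: "x \<in> U" "snd (dsec u x) \<noteq> 0"
  defines "z \<equiv> dsec u x"
  defines "Q \<equiv> fibre_hessian H z" and "P \<equiv> mixed_hessian H z"
    and "Q' \<equiv> \<chi> i j. poisson H (\<lambda>z. fibre_hessian H z $ i $ j) z"
    and "P' \<equiv> \<chi> i j. poisson H (\<lambda>z. mixed_hessian H z $ i $ j) z"
  shows "(\<Sum>i\<in>UNIV. pd i (\<lambda>y. orbit_accel H (dsec u y) i) x) =
     trace P' + trace (P ** P) - trace (base_hessian H z ** Q)
     + trace ((Q' + P ** Q - Q ** transpose P) ** second_partials u x)"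
proof -
  let ?\<Omega> = "U \<times> - {0 :: real ^ 'n}"
  have \<Omega>: "open ?\<Omega>" using U by (intro open_Times) auto
  have z: "z \<in> ?\<Omega>" using x by (simp add: z_def dsec_def)
  note d = smooth_on_imp_differentiable[OF _ \<Omega> z]
  note sm = smooth_on_sum smooth_on_diff smooth_on_mult smooth_on_pdv smooth_on_pdx H \<Omega>
  have D: "frechet_derivative (\<lambda>z. orbit_accel H z i) (at z) v =
     (\<Sum>j\<in>UNIV. (pdx j (pdv i H) z * frechet_derivative (pdv j H) (at z) v + frechet_derivative (pdx j (pdv i H)) (at z) v * pdv j H z)
       - (pdv i (pdv j H) z * frechet_derivative (pdx j H) (at z) v + frechet_derivative (pdv i (pdv j H)) (at z) v * pdx j H z))" for i v
    unfolding orbit_accel_def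
    by ((subst directional_sum directional_diff directional_mult; (intro d sm)?)+) (rule refl)
  have dx: "pdx i (\<lambda>z. orbit_accel H z i) z =
     (\<Sum>j\<in>UNIV. (pdx j (pdv i H) z * pdx i (pdv j H) z + pdx i (pdx j (pdv i H)) z * pdv j H z)
       - (pdv i (pdv j H) z * pdx i (pdx j H) z + pdx i (pdv i (pdv j H)) z * pdx j H z))" for i
    unfolding pdx_def[of i] D ..
  have dv: "pdv k (\<lambda>z. orbit_accel H z i) z =
     (\<Sum>j\<in>UNIV. (pdx j (pdv i H) z * pdv k (pdv j H) z + pdv k (pdx j (pdv i H)) z * pdv j H z)
       - (pdv i (pdv j H) z * pdv k (pdx j H) z + pdv k (pdv i (pdv j H)) z * pdx j H z))" for i k
    unfolding pdv_def[of k] D ..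
  note Hv = smooth_on_pdv[OF H] and Hx = smooth_on_pdx[OF H]
  \<comment> \<open>\<open>c1\<close> and \<open>c2\<close> bring the third derivatives into the
    index order of \<open>trace P'\<close>, \<open>c3\<close> and \<open>c4\<close> into that of
    \<open>Q'\<close>.\<close>
  have c1: "pdx i (pdx j (pdv i H)) z = pdx j (pdx i (pdv i H)) z" for i j
    by (rule pdx_pdx_commute[OF Hv \<Omega> z])
  have c2: "pdx i (pdv i (pdv j H)) z = pdv j (pdx i (pdv i H)) z" for i j
  proof -
    \<comment> \<open>Exchanging the two inner derivatives under an outer one takes their symmetry
      on an open set, not just at \<open>z\<close>.\<close>
    have "pdx i (pdv i (pdv j H)) z = pdx i (pdv j (pdv i H)) z"
      unfolding pdx_def by (rule arg_cong[where f="\<lambda>D. D _"], rule frechet_derivative_cong_open[OF \<Omega> z])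
        (rule pdv_pdv_commute[OF H \<Omega>])
    also have "\<dots> = pdv j (pdx i (pdv i H)) z" by (rule pdv_pdx_commute[OF Hv \<Omega> z, symmetric])
    finally show ?thesis .
  qed
  have c3: "pdv k (pdx j (pdv i H)) z = pdx j (pdv i (pdv k H)) z" for i j k
  proof -
    have "pdv k (pdx j (pdv i H)) z = pdx j (pdv k (pdv i H)) z" by (rule pdv_pdx_commute[OF Hv \<Omega> z])
    also have "\<dots> = pdx j (pdv i (pdv k H)) z"
      unfolding pdx_def by (rule arg_cong[where f="\<lambda>D. D _"], rule frechet_derivative_cong_open[OF \<Omega> z])
        (rule pdv_pdv_commute[OF H \<Omega>])
    finally show ?thesis .
  qed
  have c4: "pdv k (pdv i (pdv j H)) z = pdv j (pdv i (pdv k H)) z" for i j k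
  proof -
    have "pdv k (pdv i (pdv j H)) z = pdv k (pdv j (pdv i H)) z"
      unfolding pdv_def[of k] by (rule arg_cong[where f="\<lambda>D. D _"], rule frechet_derivative_cong_open[OF \<Omega> z])
        (rule pdv_pdv_commute[OF H \<Omega>])
    also have "\<dots> = pdv j (pdv k (pdv i H)) z" by (rule pdv_pdv_commute[OF Hv \<Omega> z])
    also have "\<dots> = pdv j (pdv i (pdv k H)) z"
      unfolding pdv_def[of j] by (rule arg_cong[where f="\<lambda>D. D _"], rule frechet_derivative_cong_open[OF \<Omega> z])
        (rule pdv_pdv_commute[OF H \<Omega>])
    finally show ?thesis .
  qed
  have c5: "pdv k (pdx j H) z = pdx j (pdv k H) z" for j k by (rule pdv_pdx_commute[OF H \<Omega> z])
  have c6: "pdv k (pdv j H) z = pdv j (pdv k H) z" for j k by (rule pdv_pdv_commute[OF H \<Omega> z])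
  have c7: "pdx k (pdx j H) z = pdx j (pdx k H) z" for j k by (rule pdx_pdx_commute[OF H \<Omega> z])
  have X: "(\<Sum>i\<in>UNIV. pdx i (\<lambda>z. orbit_accel H z i) z) = trace P' + trace (P ** P) - trace (base_hessian H z ** Q)"
  proof -
    have 1: "trace P' = (\<Sum>i\<in>UNIV. \<Sum>j\<in>UNIV. pdx j (pdx i (pdv i H)) z * pdv j H z - pdv j (pdx i (pdv i H)) z * pdx j H z)"
      by (simp add: trace_def P'_def poisson_def mixed_hessian_def)
    have 4: "pdx i (\<lambda>z. orbit_accel H z i) z =
     (\<Sum>j\<in>UNIV. (pdx j (pdv i H) z * pdx i (pdv j H) z + pdx j (pdx i (pdv i H)) z * pdv j H z)
       - (pdv i (pdv j H) z * pdx i (pdx j H) z + pdv j (pdx i (pdv i H)) z * pdx j H z))" for i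
      unfolding dx c1[of i] c2[of i] ..
    have 2: "trace (P ** P) = (\<Sum>i\<in>UNIV. \<Sum>j\<in>UNIV. pdx j (pdv i H) z * pdx i (pdv j H) z)"
      by (simp add: trace_def P_def mixed_hessian_def matrix_matrix_mult_def)
    have 3: "trace (base_hessian H z ** Q) = (\<Sum>i\<in>UNIV. \<Sum>j\<in>UNIV. pdv i (pdv j H) z * pdx i (pdx j H) z)"
      unfolding trace_def base_hessian_def Q_def fibre_hessian_def matrix_matrix_mult_def
      by simp (simp add: c6 c7 mult.commute)
    show ?thesis unfolding 4 1 2 3 by (simp add: sum_subtractf sum.distrib)
  qed
  have Vd: "pdv k (\<lambda>z. orbit_accel H z i) z = (Q' + P ** Q - Q ** transpose P) $ i $ k" for i k
    unfolding dv
    by (simp add: Q'_def P_def Q_def poisson_def mixed_hessian_def fibre_hessian_def matrix_matrix_mult_def transpose_def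
        c3 c4 c5 c6[of k] sum_subtractf sum.distrib)
  have "smooth_on ?\<Omega> (\<lambda>z. orbit_accel H z i)" for i
    unfolding orbit_accel_def by (intro sm)
  then have "pd i (\<lambda>y. orbit_accel H (dsec u y) i) x = pdx i (\<lambda>z. orbit_accel H z i) z
      + (\<Sum>k\<in>UNIV. pdv k (\<lambda>z. orbit_accel H z i) z * pd i (pd k u) x)" for i
    using pd_along_dsec[OF u U x(1), of "\<lambda>z. orbit_accel H z i"] d[of "\<lambda>z. orbit_accel H z i"] by (simp add: z_def)
  then have "(\<Sum>i\<in>UNIV. pd i (\<lambda>y. orbit_accel H (dsec u y) i) x) = (\<Sum>i\<in>UNIV. pdx i (\<lambda>z. orbit_accel H z i) z)
     + (\<Sum>i\<in>UNIV. \<Sum>k\<in>UNIV. (Q' + P ** Q - Q ** transpose P) $ i $ k * pd i (pd k u) x)"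
    by (simp add: sum.distrib Vd)
  moreover have "(\<Sum>i\<in>UNIV. \<Sum>k\<in>UNIV. (Q' + P ** Q - Q ** transpose P) $ i $ k * pd i (pd k u) x) =
     trace ((Q' + P ** Q - Q ** transpose P) ** second_partials u x)"
    unfolding trace_def matrix_matrix_mult_def[of _ "second_partials u x"]
    using pd_pd_commute[OF u U x(1)] by (simp add: second_partials_def)
  ultimately show ?thesis using X by simp
qed

lemma pd_ham_grad:
  fixes H :: "(real ^ 'n) \<times> (real ^ 'n::finite) \<Rightarrow> real"
  assumes U: "open U" and H: "smooth_on (U \<times> - {0}) H"
    and u: "smooth_on U u" and x: "x \<in> U" "snd (dsec u x) \<noteq> 0"
  shows "pd k (\<lambda>y. pdv i H (dsec u y)) x =
    (mixed_hessian H (dsec u x) + fibre_hessian H (dsec u x) ** second_partials u x) $ i $ k"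
proof -
  have \<Omega>: "open (U \<times> - {0 :: real ^ 'n})" using U by (intro open_Times) auto
  have z: "dsec u x \<in> U \<times> - {0}" using x by (simp add: dsec_def)
  show ?thesis
    using pd_along_dsec[OF u U x(1) smooth_on_imp_differentiable[OF smooth_on_pdv[OF H, of i] \<Omega> z], of k]
      pdv_pdv_commute[OF H \<Omega> z] pd_pd_commute[OF u U x(1)]
    by (simp add: mixed_hessian_def fibre_hessian_def second_partials_def matrix_matrix_mult_def)
qed

section \<open>The frame transported along the orbit\<close>

lemma frechet_derivative_inner_left:
  assumes "f differentiable (at y)"
  shows "frechet_derivative (\<lambda>y. f y \<bullet> b) (at y) v = frechet_derivative f (at y) v \<bullet> b"
proof -
  have "((\<lambda>y. f y \<bullet> b) has_derivative (\<lambda>h. frechet_derivative f (at y) h \<bullet> b)) (at y)"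
    by (intro has_derivative_inner_left assms[unfolded frechet_derivative_works])
  from fun_cong[OF frechet_derivative_at[OF this], of v] show ?thesis by (rule sym)
qed

text \<open>Serves the flow map, whose time and space derivatives are interchanged in
  \<open>variational_equation\<close>.\<close>

lemma mixed_derivatives_commute_euclidean:
  fixes f :: "'a::euclidean_space \<Rightarrow> 'b::euclidean_space"
  assumes f: "smooth_on S f" and S: "open S" and x: "x \<in> S"
  shows "frechet_derivative (\<lambda>y. frechet_derivative f (at y) v) (at x) w =
         frechet_derivative (\<lambda>y. frechet_derivative f (at y) w) (at x) v"
proof (rule euclidean_eqI)
  fix b :: 'b
  have fb: "smooth_on S (\<lambda>y. f y \<bullet> b)"
    by (rule smooth_on_bounded_linear[OF S f bounded_linear_inner_left])
  have "frechet_derivative (\<lambda>y. frechet_derivative f (at y) v) (at x) w \<bullet> b =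
      frechet_derivative (\<lambda>y. frechet_derivative (\<lambda>y. f y \<bullet> b) (at y) v) (at x) w" for v w
  proof -
    have "frechet_derivative (\<lambda>y. frechet_derivative f (at y) v) (at x) w \<bullet> b =
        frechet_derivative (\<lambda>y. frechet_derivative f (at y) v \<bullet> b) (at x) w"
      by (rule frechet_derivative_inner_left[symmetric])
        (rule smooth_on_imp_differentiable[OF smooth_on_frechet_derivative[OF f] S x])
    also have "\<dots> = frechet_derivative (\<lambda>y. frechet_derivative (\<lambda>y. f y \<bullet> b) (at y) v) (at x) w"
      by (rule fun_cong[OF frechet_derivative_cong_open[OF S x]])
        (rule frechet_derivative_inner_left[symmetric, OF smooth_on_imp_differentiable[OF f S]])
    finally show ?thesis .
  qed
  then show "frechet_derivative (\<lambda>y. frechet_derivative f (at y) v) (at x) w \<bullet> b =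
      frechet_derivative (\<lambda>y. frechet_derivative f (at y) w) (at x) v \<bullet> b"
    using mixed_derivatives_commute[OF fb S x] by simp
qed

lemma smooth_on_has_vector_derivative:
  assumes "smooth_on S f" "open S" "t \<in> S"
  shows "(f has_vector_derivative vd f t) (at t)"
  using smooth_on_imp_differentiable[OF assms] by (simp add: vd_def vector_derivative_works)

lemma smooth_on_vd:
  assumes "smooth_on S f" "open S" shows "smooth_on S (vd f)"
proof (rule smooth_on_cong[OF assms(2) smooth_on_frechet_derivative[OF assms(1), of 1]])
  show "frechet_derivative f (at t) 1 = vd f t" if "t \<in> S" for t
    using smooth_on_imp_differentiable[OF assms that] 
    by (simp add: vd_def frechet_derivative_eq_vector_derivative)
qed

lemma has_vector_derivative_matrixI:
  fixes M :: "real \<Rightarrow> real ^ 'n ^ 'm"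
  assumes "\<And>r i. ((\<lambda>t. M t $ r $ i) has_real_derivative M' $ r $ i) (at t)"
  shows "(M has_vector_derivative M') (at t)"
proof -
  have "((\<lambda>t. M t \<bullet> b) has_derivative (\<lambda>h. (h *\<^sub>R M') \<bullet> b)) (at t)" if b_Basis: "b \<in> Basis" for b
  proof -
    obtain r i where b: "b = axis r (axis i 1)" using b_Basis by (auto simp: Basis_vec_def)
    show ?thesis
      using assms[of r i] by (simp add: b inner_axis has_field_derivative_def mult_commute_abs)
  qed
  then show ?thesis
    unfolding has_vector_derivative_def using has_derivative_componentwise_within by blast
qed

lemma hamiltonian_vf_has_derivative:
  fixes H :: "(real ^ 'n) \<times> (real ^ 'n::finite) \<Rightarrow> real"
  assumes H: "smooth_on S H" and S: "open S" "w \<in> S"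
  shows "(hamiltonian_vf H has_derivative
     (\<lambda>v. (mixed_hessian H w *v fst v + fibre_hessian H w *v snd v,
       - (base_hessian H w *v fst v) - transpose (mixed_hessian H w) *v snd v))) (at w)"
proof -
  have d: "(G has_derivative (\<lambda>v. (\<Sum>i\<in>UNIV. fst v $ i * pdx i G w) + (\<Sum>i\<in>UNIV. snd v $ i * pdv i G w))) (at w)"
    if "smooth_on S G" for G :: "(real ^ 'n) \<times> (real ^ 'n) \<Rightarrow> real"
  proof -
    have "G differentiable (at w)" by (rule smooth_on_imp_differentiable[OF that S])
    then have "frechet_derivative G (at w) = (\<lambda>v. (\<Sum>i\<in>UNIV. fst v $ i * pdx i G w) + (\<Sum>i\<in>UNIV. snd v $ i * pdv i G w))"
      using frechet_derivative_pdx_pdv[of G w] by (auto simp: fun_eq_iff)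
    then show ?thesis using smooth_on_has_derivative[OF that S] by simp
  qed
  have 1: "((\<lambda>z. \<chi> i. pdv i H z) has_derivative
      (\<lambda>v. \<chi> i. (\<Sum>j\<in>UNIV. fst v $ j * pdx j (pdv i H) w) + (\<Sum>j\<in>UNIV. snd v $ j * pdv j (pdv i H) w))) (at w)"
    by (intro has_derivative_vec_lambda d smooth_on_pdv H)
  have 2: "((\<lambda>z. \<chi> i. - pdx i H z) has_derivative
      (\<lambda>v. \<chi> i. - ((\<Sum>j\<in>UNIV. fst v $ j * pdx j (pdx i H) w) + (\<Sum>j\<in>UNIV. snd v $ j * pdv j (pdx i H) w)))) (at w)"
    by (intro has_derivative_vec_lambda has_derivative_minus d smooth_on_pdx H)
  have 3: "(\<chi> i. (\<Sum>j\<in>UNIV. fst v $ j * pdx j (pdv i H) w) + (\<Sum>j\<in>UNIV. snd v $ j * pdv j (pdv i H) w)) =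
      mixed_hessian H w *v fst v + fibre_hessian H w *v snd v" for v
    using pdv_pdv_commute[OF H S]
    by (simp add: vec_eq_iff matrix_vector_mult_def mixed_hessian_def fibre_hessian_def mult.commute)
  have 4: "(\<chi> i. - ((\<Sum>j\<in>UNIV. fst v $ j * pdx j (pdx i H) w) + (\<Sum>j\<in>UNIV. snd v $ j * pdv j (pdx i H) w))) =
      - (base_hessian H w *v fst v) - transpose (mixed_hessian H w) *v snd v" for v
    using pdv_pdx_commute[OF H S]
    by (simp add: vec_eq_iff matrix_vector_mult_def mixed_hessian_def base_hessian_def transpose_def mult.commute
        del: transpose_matrix_vector)
  show ?thesis
    using has_derivative_Pair[OF 1 2] unfolding 3 4 hamiltonian_vf_def[abs_def] .
qed

definition matrix_of_columns where
  "matrix_of_columns f = (\<chi> r i. f i $ r)"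

lemma matrix_of_columns_mult: "matrix_of_columns (\<lambda>i. A *v f i) = A ** matrix_of_columns f"
  by (simp add: matrix_of_columns_def vec_eq_iff matrix_vector_mult_def matrix_matrix_mult_def)

lemma matrix_of_columns_linear:
  "matrix_of_columns (\<lambda>i. f i + g i) = matrix_of_columns f + matrix_of_columns g"
  "matrix_of_columns (\<lambda>i. f i - g i) = matrix_of_columns f - matrix_of_columns g"
  "matrix_of_columns (\<lambda>i. - f i) = - matrix_of_columns (f :: _ \<Rightarrow> real ^ _)"
  by (simp_all add: matrix_of_columns_def vec_eq_iff)

lemma matrix_of_columns_has_vector_derivative:
  fixes f :: "'n::finite \<Rightarrow> real \<Rightarrow> real ^ 'n"
  assumes "\<And>i. (f i has_vector_derivative f' i) (at t)"
  shows "((\<lambda>t. matrix_of_columns (\<lambda>i. f i t)) has_vector_derivative matrix_of_columns f') (at t)"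
  by (rule has_vector_derivative_matrixI)
    (simp add: matrix_of_columns_def has_real_derivative_iff_has_vector_derivative
      bounded_linear.has_vector_derivative[OF bounded_linear_vec_nth assms])

section \<open>The linearised flow and the equations of the frame\<close>

text \<open>Collects what the frame equations depend on: \<open>H\<close>, its flow and a canonical
  frame, in one chart. The function \<open>u\<close>, the density and the Lagrangian come in later
  as hypotheses of single lemmas.\<close>

locale framed_orbit =
  fixes U :: "(real ^ 'n::finite) set" and H :: "(real ^ 'n) \<times> (real ^ 'n) \<Rightarrow> real"
    and W :: "((real ^ 'n) \<times> (real ^ 'n)) set" and \<epsilon> :: real
    and \<Phi> :: "real \<Rightarrow> (real ^ 'n) \<times> (real ^ 'n) \<Rightarrow> (real ^ 'n) \<times> (real ^ 'n)"
    and \<alpha> :: "(real ^ 'n) \<times> (real ^ 'n)"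
    and e :: "'n \<Rightarrow> real \<Rightarrow> (real ^ 'n) \<times> (real ^ 'n)"
  assumes U: "open U" and H: "smooth_on (U \<times> - {0}) H"
    and flow: "local_flow (hamiltonian_vf H) (U \<times> - {0}) W \<epsilon> \<Phi>" and \<alpha>W: "\<alpha> \<in> W"
    and frame: "canonical_frame \<Phi> \<alpha> \<epsilon> e"
begin

abbreviation "\<Omega> \<equiv> U \<times> - {0 :: real ^ 'n}"
abbreviation "I \<equiv> {-\<epsilon><..<\<epsilon>}"
abbreviation "z t \<equiv> \<Phi> t \<alpha>"
abbreviation "Q t \<equiv> fibre_hessian H (z t)"
abbreviation "P t \<equiv> mixed_hessian H (z t)"
abbreviation "Q' t \<equiv> \<chi> i j. poisson H (\<lambda>z. fibre_hessian H z $ i $ j) (z t)"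
abbreviation "P' t \<equiv> \<chi> i j. poisson H (\<lambda>z. mixed_hessian H z $ i $ j) (z t)"

text \<open>The frame lives in the fixed tangent space at \<open>\<alpha>\<close>; after the
  push-forward by \<open>D t\<close>, membership in \<open>jacobi_space\<close> means a vanishing
  base component. Hence the frame and its second derivative need one matrix each, \<open>B\<close>
  and \<open>N\<close>, while its first derivative needs two, \<open>Y\<close> and
  \<open>Z\<close>.\<close>

definition "D t = frechet_derivative (\<Phi> t) (at \<alpha>)"
definition "B t = matrix_of_columns (\<lambda>i. snd (D t (e i t)))"
definition "Y t = matrix_of_columns (\<lambda>i. fst (D t (vd (e i) t)))"
definition "Z t = matrix_of_columns (\<lambda>i. snd (D t (vd (e i) t)))"
definition "N t = matrix_of_columns (\<lambda>i. snd (D t (vd (vd (e i)) t)))"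
text \<open>\<open>B1\<close> and \<open>B2\<close> are the values that the variational equation
  predicts for \<open>B'\<close> and \<open>B''\<close>; \<open>frame_structure\<close> and
  \<open>B1_has_vector_derivative\<close> confirm them.\<close>

definition "B1 t = Z t - transpose (P t) ** B t"
definition "B2 t = - base_hessian H (z t) ** Y t - transpose (P t) ** Z t + N t
   - (transpose (P t) ** B1 t + transpose (P' t) ** B t)"

lemma open_\<Omega>: "open \<Omega>" using U by (intro open_Times) auto

lemma zero_in_I: "0 \<in> I" using flow by (simp add: local_flow_def)

lemma z_in: "t \<in> I \<Longrightarrow> z t \<in> \<Omega>" using flow \<alpha>W unfolding local_flow_def by blast

lemma z_0: "z 0 = \<alpha>" using flow \<alpha>W unfolding local_flow_def by blast

lemma flow_smooth: "smooth_on (I \<times> W) (\<lambda>(t, z). \<Phi> t z)" and open_W: "open W"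
  using flow by (simp_all add: local_flow_def)

lemma flow_velocity: "w \<in> W \<Longrightarrow> t \<in> I \<Longrightarrow> ((\<lambda>s. \<Phi> s w) has_vector_derivative hamiltonian_vf H (\<Phi> t w)) (at t)"
  using flow unfolding local_flow_def by blast

lemma open_IW: "open (I \<times> W)" using open_W by (intro open_Times) auto

lemma flow_slice_has_derivative:
  assumes "t \<in> I" "w \<in> W"
  shows "(\<Phi> t has_derivative (\<lambda>\<xi>. frechet_derivative (\<lambda>(t, z). \<Phi> t z) (at (t, w)) (0, \<xi>))) (at w)"
proof -
  have "((\<lambda>(t, z). \<Phi> t z) has_derivative frechet_derivative (\<lambda>(t, z). \<Phi> t z) (at (t, w))) (at (t, w))"
    using smooth_on_has_derivative[OF flow_smooth open_IW] assms by blast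
  moreover have "((\<lambda>w. (t, w)) has_derivative (\<lambda>\<xi>. (0, \<xi>))) (at w)"
    by (auto intro!: derivative_eq_intros)
  ultimately have "((\<lambda>w. (\<lambda>(t, z). \<Phi> t z) (t, w)) has_derivative
     (\<lambda>\<xi>. frechet_derivative (\<lambda>(t, z). \<Phi> t z) (at (t, w)) (0, \<xi>))) (at w)"
    by (rule has_derivative_compose[rotated])
  then show ?thesis by simp
qed

text \<open>Expresses \<open>D t\<close> by the joint derivative in time and space, which can be
  differentiated in time.\<close>

lemma D_eq: "t \<in> I \<Longrightarrow> D t \<xi> = frechet_derivative (\<lambda>(t, z). \<Phi> t z) (at (t, \<alpha>)) (0, \<xi>)"
  unfolding D_def by (rule fun_cong[OF frechet_derivative_at[OF flow_slice_has_derivative[OF _ \<alpha>W], symmetric]])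

lemma linear_D: "t \<in> I \<Longrightarrow> linear (D t)"
  unfolding D_def
  by (rule linear_frechet_derivative) (rule differentiableI[OF flow_slice_has_derivative[OF _ \<alpha>W]])

lemma D_0: "D 0 \<xi> = \<xi>"
proof -
  have "frechet_derivative (\<Phi> 0) (at \<alpha>) = frechet_derivative (\<lambda>y. y) (at \<alpha>)"
    by (rule frechet_derivative_cong_open[OF open_W \<alpha>W]) (use flow in \<open>simp add: local_flow_def\<close>)
  then show ?thesis by (simp add: D_def)
qed

text \<open>The flow equation is differentiated in the initial value, and the time and space
  derivatives of the jointly smooth flow map are exchanged.\<close>

lemma variational_equation:
  assumes t: "t \<in> I"
  shows "((\<lambda>s. D s \<xi>) has_vector_derivative frechet_derivative (hamiltonian_vf H) (at (z t)) (D t \<xi>)) (at t)"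
proof -
  let ?\<Psi> = "\<lambda>(t, z). \<Phi> t z" and ?S = "I \<times> W" and ?X = "hamiltonian_vf H"
  have tS: "(t, \<alpha>) \<in> ?S" using t \<alpha>W by simp
  let ?G = "\<lambda>y. frechet_derivative ?\<Psi> (at y) (0, \<xi>)"
  have time: "((\<lambda>s. f (s, w)) has_vector_derivative frechet_derivative f (at (t, w)) (1, 0)) (at t)"
    if "f differentiable (at (t, w))" for f :: "real \<times> (real ^ 'n) \<times> (real ^ 'n) \<Rightarrow> (real ^ 'n) \<times> (real ^ 'n)" and t w
  proof -
    have lin: "linear (frechet_derivative f (at (t, w)))" by (rule linear_frechet_derivative[OF that])
    have f: "(f has_derivative frechet_derivative f (at (t, w))) (at (t, w))"
      using that by (simp add: frechet_derivative_works)
    have l: "((\<lambda>s. (s, w)) has_derivative (\<lambda>r. (r, 0))) (at t)" by (auto intro!: derivative_eq_intros)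
    have "((\<lambda>s. f (s, w)) has_derivative (\<lambda>r. frechet_derivative f (at (t, w)) (r, 0))) (at t)"
      by (rule has_derivative_compose[OF l f])
    moreover have "(\<lambda>r. frechet_derivative f (at (t, w)) (r, 0)) =
        (\<lambda>r. r *\<^sub>R frechet_derivative f (at (t, w)) (1, 0))"
    proof
      show "frechet_derivative f (at (t, w)) (r, 0) = r *\<^sub>R frechet_derivative f (at (t, w)) (1, 0)" for r
        using linear_scale[OF lin, of r "(1, 0)"] by simp
    qed
    ultimately show ?thesis by (simp only: has_vector_derivative_def)
  qed
  \<comment> \<open>Needed on all of \<open>I \<times> W\<close>, because this identity is
    differentiated in space afterwards.\<close>
  have dX: "frechet_derivative ?\<Psi> (at y) (1, 0) = ?X (?\<Psi> y)" if y_in: "y \<in> ?S" for y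
  proof -
    obtain s w where y: "y = (s, w)" "s \<in> I" "w \<in> W" using y_in by (rule SigmaE)
    have "((\<lambda>s. ?\<Psi> (s, w)) has_vector_derivative frechet_derivative ?\<Psi> (at (s, w)) (1, 0)) (at s)"
      by (rule time) (rule smooth_on_imp_differentiable[OF flow_smooth open_IW], use y in simp)
    moreover have "((\<lambda>s. ?\<Psi> (s, w)) has_vector_derivative ?X (?\<Psi> y)) (at s)"
      using flow_velocity[of w s] y by simp
    ultimately show ?thesis unfolding y by (rule vector_derivative_unique_at)
  qed
  have "((\<lambda>s. ?G (s, \<alpha>)) has_vector_derivative frechet_derivative ?G (at (t, \<alpha>)) (1, 0)) (at t)"
    by (rule time) (rule smooth_on_imp_differentiable[OF smooth_on_frechet_derivative[OF flow_smooth] open_IW tS])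
  also have "frechet_derivative ?G (at (t, \<alpha>)) (1, 0) =
      frechet_derivative (\<lambda>y. frechet_derivative ?\<Psi> (at y) (1, 0)) (at (t, \<alpha>)) (0, \<xi>)"
    by (rule mixed_derivatives_commute_euclidean[OF flow_smooth open_IW tS])
  also have "\<dots> = frechet_derivative (\<lambda>y. ?X (?\<Psi> y)) (at (t, \<alpha>)) (0, \<xi>)"
    by (rule fun_cong[OF frechet_derivative_cong_open[OF open_IW tS dX]])
  also have "\<dots> = frechet_derivative ?X (at (z t)) (frechet_derivative ?\<Psi> (at (t, \<alpha>)) (0, \<xi>))"
  proof -
    have "?X differentiable (at (?\<Psi> (t, \<alpha>)))"
      using differentiableI[OF hamiltonian_vf_has_derivative[OF H open_\<Omega> z_in[OF t]]] by simp
    then have "frechet_derivative (?X \<circ> ?\<Psi>) (at (t, \<alpha>)) =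
        frechet_derivative ?X (at (?\<Psi> (t, \<alpha>))) \<circ> frechet_derivative ?\<Psi> (at (t, \<alpha>))"
      by (rule frechet_derivative_compose[OF smooth_on_imp_differentiable[OF flow_smooth open_IW tS]])
    then show ?thesis by (simp add: o_def)
  qed
  finally show ?thesis
    unfolding D_eq[OF t, symmetric]
    by (rule has_vector_derivative_transform_within_open[OF _ _ t]) (auto simp: D_eq)
qed

text \<open>The product rule for a moving vector under a moving operator. The variational equation
  concerns fixed vectors, so \<open>f s\<close> is expanded in \<open>Basis\<close>.\<close>

lemma D_field_has_vector_derivative:
  assumes t: "t \<in> I" and f: "(f has_vector_derivative f') (at t)"
  shows "((\<lambda>s. D s (f s)) has_vector_derivative
     (P t *v fst (D t (f t)) + Q t *v snd (D t (f t)),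
       - (base_hessian H (z t) *v fst (D t (f t))) - transpose (P t) *v snd (D t (f t))) + D t f') (at t)"
proof -
  let ?DX = "frechet_derivative (hamiltonian_vf H) (at (z t))"
  have X: "(hamiltonian_vf H has_derivative ?DX) (at (z t))"
    using differentiableI[OF hamiltonian_vf_has_derivative[OF H open_\<Omega> z_in[OF t]]]
    by (simp add: frechet_derivative_works)
  then have linX: "linear ?DX" by (rule has_derivative_linear)
  have DX: "?DX v = (P t *v fst v + Q t *v snd v,
       - (base_hessian H (z t) *v fst v) - transpose (P t) *v snd v)" for v
    using fun_cong[OF has_derivative_unique[OF X hamiltonian_vf_has_derivative[OF H open_\<Omega> z_in[OF t]]], of v] .
  have expand: "l v = (\<Sum>b\<in>Basis. (v \<bullet> b) *\<^sub>R l b)" if "linear l" for l and v :: "(real ^ 'n) \<times> (real ^ 'n)"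
    using linear_sum[OF that, of "\<lambda>b. (v \<bullet> b) *\<^sub>R b" Basis]
    by (simp add: euclidean_representation linear_scale[OF that] o_def)
  have "((\<lambda>s. \<Sum>b\<in>Basis. (f s \<bullet> b) *\<^sub>R D s b) has_vector_derivative
      (\<Sum>b\<in>Basis. (f t \<bullet> b) *\<^sub>R ?DX (D t b) + (f' \<bullet> b) *\<^sub>R D t b)) (at t)"
    by (intro has_vector_derivative_sum
        bounded_bilinear.has_vector_derivative[OF bounded_bilinear_scaleR]
        bounded_linear.has_vector_derivative[OF bounded_linear_inner_left f] variational_equation[OF t])
  moreover have "(\<Sum>b\<in>Basis. (f t \<bullet> b) *\<^sub>R ?DX (D t b) + (f' \<bullet> b) *\<^sub>R D t b) = ?DX (D t (f t)) + D t f'"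
    using expand[OF linear_compose[OF linear_D[OF t] linX], of "f t"] expand[OF linear_D[OF t], of f']
    by (simp add: sum.distrib)
  ultimately have "((\<lambda>s. \<Sum>b\<in>Basis. (f s \<bullet> b) *\<^sub>R D s b) has_vector_derivative (?DX (D t (f t)) + D t f')) (at t)"
    by simp
  then show ?thesis
    unfolding DX
    by (rule has_vector_derivative_transform_within_open[OF _ _ t]) (use expand[OF linear_D] in auto)
qed

lemma frame_smooth: "smooth_on I (e i)" using frame by (simp add: canonical_frame_def)

lemma frame_has_vector_derivative:
  assumes "t \<in> I"
  shows "(e i has_vector_derivative vd (e i) t) (at t)"
    and "(vd (e i) has_vector_derivative vd (vd (e i)) t) (at t)"
  by (rule smooth_on_has_vector_derivative[OF frame_smooth open_greaterThanLessThan assms])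
    (rule smooth_on_has_vector_derivative[OF smooth_on_vd[OF frame_smooth open_greaterThanLessThan]
        open_greaterThanLessThan assms])

lemma frame_vertical:
  assumes "t \<in> I" shows "fst (D t (e i t)) = 0" "fst (D t (vd (vd (e i)) t)) = 0"
  using frame assms by (auto simp: canonical_frame_def jacobi_space_def vertical_def D_def mem_Times_iff)

lemma poisson_has_derivative:
  assumes F: "smooth_on \<Omega> F" and t: "t \<in> I"
  shows "((\<lambda>s. F (z s)) has_real_derivative poisson H F (z t)) (at t)"
proof -
  have d: "F differentiable (at (z t))" by (rule smooth_on_imp_differentiable[OF F open_\<Omega> z_in[OF t]])
  have lin: "linear (frechet_derivative F (at (z t)))" by (rule linear_frechet_derivative[OF d])
  have "((\<lambda>s. F (z s)) has_derivative (\<lambda>r. frechet_derivative F (at (z t)) (r *\<^sub>R hamiltonian_vf H (z t)))) (at t)"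
    using has_derivative_compose[OF flow_velocity[OF \<alpha>W t, unfolded has_vector_derivative_def] d[unfolded frechet_derivative_works]] .
  moreover have "frechet_derivative F (at (z t)) (hamiltonian_vf H (z t)) = poisson H F (z t)"
    by (simp add: hamiltonian_vf_def frechet_derivative_pdx_pdv[OF d] poisson_def sum_subtractf sum_negf mult.commute)
  ultimately show ?thesis
    by (simp add: has_field_derivative_def linear_scale[OF lin] mult_commute_abs)
qed

lemma Q_has_vector_derivative: "t \<in> I \<Longrightarrow> (Q has_vector_derivative Q' t) (at t)"
  unfolding fibre_hessian_def
  by (intro has_vector_derivative_matrixI) (simp only: vec_lambda_beta, intro poisson_has_derivative smooth_on_pdv H)

lemma P_has_vector_derivative: "t \<in> I \<Longrightarrow> (P has_vector_derivative P' t) (at t)"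
  unfolding mixed_hessian_def
  by (intro has_vector_derivative_matrixI) (simp only: vec_lambda_beta, intro poisson_has_derivative smooth_on_pdv smooth_on_pdx H)

text \<open>Base and fibre components of the product rule, applied to the frame and to its
  derivative. The base component of the pushed-forward frame is constantly zero, whence
  \<open>Y\<close>; in the equation for \<open>Y'\<close> the second derivative of the frame drops
  out because it is vertical.\<close>

lemma frame_structure:
  assumes t: "t \<in> I"
  shows "Y t = - (Q t ** B t)"
    and "(B has_vector_derivative B1 t) (at t)"
    and "(Y has_vector_derivative P t ** Y t + Q t ** Z t) (at t)"
    and "(Z has_vector_derivative - (base_hessian H (z t) ** Y t) - transpose (P t) ** Z t + N t) (at t)"
proof -
  note fst_vd = bounded_linear.has_vector_derivative[OF bounded_linear_fst]
  note snd_vd = bounded_linear.has_vector_derivative[OF bounded_linear_snd]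
  note dE = D_field_has_vector_derivative[OF t frame_has_vector_derivative(1)[OF t]]
  note dF = D_field_has_vector_derivative[OF t frame_has_vector_derivative(2)[OF t]]
  have "Q t *v snd (D t (e i t)) + fst (D t (vd (e i) t)) = 0" for i
  proof -
    have "((\<lambda>s. fst (D s (e i s))) has_vector_derivative Q t *v snd (D t (e i t)) + fst (D t (vd (e i) t))) (at t)"
      using fst_vd[OF dE] by (simp add: frame_vertical[OF t])
    moreover have "((\<lambda>s. fst (D s (e i s))) has_vector_derivative 0) (at t)"
      by (rule has_vector_derivative_transform_within_open[OF has_vector_derivative_const[of 0] _ t])
        (auto simp: frame_vertical)
    ultimately show ?thesis by (rule vector_derivative_unique_at)
  qed
  then have "fst (D t (vd (e i) t)) = - (Q t *v snd (D t (e i t)))" for i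
    by (metis add_eq_0_iff)
  then show "Y t = - (Q t ** B t)"
    by (simp add: Y_def B_def matrix_of_columns_mult matrix_of_columns_linear)
  have "((\<lambda>s. snd (D s (e i s))) has_vector_derivative snd (D t (vd (e i) t)) - transpose (P t) *v snd (D t (e i t))) (at t)" for i
    using snd_vd[OF dE] by (simp add: frame_vertical[OF t])
  from matrix_of_columns_has_vector_derivative[OF this]
  show "(B has_vector_derivative B1 t) (at t)"
    unfolding B_def[abs_def] B1_def Z_def matrix_of_columns_linear matrix_of_columns_mult .
  have "((\<lambda>s. fst (D s (vd (e i) s))) has_vector_derivative
     P t *v fst (D t (vd (e i) t)) + Q t *v snd (D t (vd (e i) t))) (at t)" for i
    using fst_vd[OF dF] by (simp add: frame_vertical[OF t])
  from matrix_of_columns_has_vector_derivative[OF this]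
  show "(Y has_vector_derivative P t ** Y t + Q t ** Z t) (at t)"
    unfolding Y_def[abs_def] Z_def matrix_of_columns_linear matrix_of_columns_mult .
  have "((\<lambda>s. snd (D s (vd (e i) s))) has_vector_derivative
     - (base_hessian H (z t) *v fst (D t (vd (e i) t))) - transpose (P t) *v snd (D t (vd (e i) t))
       + snd (D t (vd (vd (e i)) t))) (at t)" for i
    using snd_vd[OF dF] by simp
  from matrix_of_columns_has_vector_derivative[OF this]
  show "(Z has_vector_derivative - (base_hessian H (z t) ** Y t) - transpose (P t) ** Z t + N t) (at t)"
    unfolding Y_def Z_def[abs_def] N_def matrix_of_columns_linear matrix_of_columns_mult .
qed

lemma B1_has_vector_derivative:
  assumes t: "t \<in> I" shows "(B1 has_vector_derivative B2 t) (at t)"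
proof -
  have "((\<lambda>s. Z s - transpose (P s) ** B s) has_vector_derivative B2 t) (at t)"
    using has_vector_derivative_diff[OF frame_structure(4)[OF t]
      has_vector_derivative_matrix_mult[OF has_vector_derivative_transpose[OF P_has_vector_derivative[OF t]] frame_structure(2)[OF t]]]
    by (simp only: B2_def matrix_mult_distribs)
  then show ?thesis by (simp only: B1_def[abs_def])
qed

text \<open>Compares two values of \<open>Y'\<close>: one from \<open>Y = - QB\<close>, one from the
  variational equation.\<close>

lemma frame_equation:
  assumes t: "t \<in> I"
  shows "2 *\<^sub>R (Q t ** B1 t) = - (Q' t ** B t) + P t ** Q t ** B t - Q t ** transpose (P t) ** B t"
proof -
  have "((\<lambda>s. - (Q s ** B s)) has_vector_derivative - (Q t ** B1 t + Q' t ** B t)) (at t)"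
    by (intro has_vector_derivative_minus has_vector_derivative_matrix_mult frame_structure(2) Q_has_vector_derivative t)
  then have "(Y has_vector_derivative - (Q t ** B1 t + Q' t ** B t)) (at t)"
    by (rule has_vector_derivative_transform_within_open[OF _ _ t]) (auto simp: frame_structure(1))
  from vector_derivative_unique_at[OF this frame_structure(3)[OF t]]
  have "- (Q t ** B1 t + Q' t ** B t) = P t ** - (Q t ** B t) + Q t ** (B1 t + transpose (P t) ** B t)"
    by (simp add: frame_structure(1)[OF t] B1_def)
  then have "Q t ** B1 t + Q t ** B1 t = - (Q' t ** B t) + P t ** Q t ** B t - Q t ** transpose (P t) ** B t"
    by (simp add: matrix_mult_distribs matrix_mul_assoc algebra_simps)
  then show ?thesis by (simp add: scaleR_2)
qed

text \<open>Solves the definition of \<open>B2\<close> for \<open>N\<close>, which carries the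
  curvature, in the shape of \<open>n\<close> in \<open>trace_bochner_identity\<close>.\<close>

lemma N_eq:
  assumes t: "t \<in> I"
  shows "N t = B2 t + transpose (P' t) ** B t + 2 *\<^sub>R (transpose (P t) ** B1 t)
     - base_hessian H (z t) ** Q t ** B t + transpose (P t) ** transpose (P t) ** B t"
proof -
  have "Z t = B1 t + transpose (P t) ** B t" by (simp add: B1_def)
  then show ?thesis
    by (simp add: B2_def frame_structure(1)[OF t] matrix_mult_distribs matrix_mul_assoc scaleR_2)
qed

lemma transpose_Q: "t \<in> I \<Longrightarrow> transpose (Q t) = Q t"
  by (rule transpose_fibre_hessian[OF H open_\<Omega> z_in])

lemma transpose_Q':
  assumes t: "t \<in> I" shows "transpose (Q' t) = Q' t"
proof -
  have "((\<lambda>s. transpose (Q s)) has_vector_derivative transpose (Q' t)) (at t)"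
    by (rule has_vector_derivative_transpose[OF Q_has_vector_derivative[OF t]])
  then have "(Q has_vector_derivative transpose (Q' t)) (at t)"
    by (rule has_vector_derivative_transform_within_open[OF _ _ t]) (auto simp: transpose_Q)
  then show ?thesis using Q_has_vector_derivative[OF t] by (rule vector_derivative_unique_at)
qed

lemma frame_0:
  "e i 0 = (0, column i (B 0))" "vd (e i) 0 = (column i (Y 0), column i (Z 0))"
  "vd (vd (e i)) 0 = (0, column i (N 0))"
  using frame_vertical[OF zero_in_I, of i]
  by (simp_all add: D_0 B_def Y_def Z_def N_def matrix_of_columns_def column_def prod_eq_iff)

text \<open>\<open>e j 0\<close> has no base component, so its \<open>symp\<close> product with the
  frame velocity sees only \<open>Y = - QB\<close>.\<close>

lemma orthonormal_0: "transpose (B 0) ** Q 0 ** B 0 = mat 1"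
proof -
  have "symp (vd (e i) 0) (e j 0) = (transpose (B 0) ** (Q 0 ** B 0)) $ j $ i" for i j
    unfolding frame_0 frame_structure(1)[OF zero_in_I]
    by (simp add: symp_def column_def transpose_def matrix_matrix_mult_def[of "\<chi> i j. B 0 $ j $ i"])
  moreover have "symp (vd (e i) 0) (e j 0) = (if i = j then 1 else 0)" for i j
    using frame zero_in_I by (simp add: canonical_frame_def)
  ultimately have "(transpose (B 0) ** (Q 0 ** B 0)) $ j $ i = (if j = i then 1 else 0)" for i j
    by metis
  then show ?thesis by (simp add: vec_eq_iff mat_def flip: matrix_mul_assoc)
qed

text \<open>The \<open>symp\<close> condition is formulated at \<open>\<alpha>\<close> and gives the
  relation at time 0, where \<open>D\<close> is the identity. It persists because the frame
  equation, added to its transpose, makes the derivative vanish.\<close>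

lemma orthonormal:
  assumes t: "t \<in> I" shows "transpose (B t) ** Q t ** B t = mat 1"
proof -
  have "((\<lambda>s. transpose (B s) ** Q s ** B s) has_vector_derivative 0) (at s)" if s: "s \<in> I" for s
  proof -
    have "((\<lambda>s. transpose (B s) ** Q s ** B s) has_vector_derivative
        transpose (B s) ** Q s ** B1 s + (transpose (B s) ** Q' s + transpose (B1 s) ** Q s) ** B s) (at s)"
      by (intro has_vector_derivative_matrix_mult has_vector_derivative_transpose Q_has_vector_derivative frame_structure(2) s)
    moreover have "2 *\<^sub>R (transpose (B s) ** Q s ** B1 s + (transpose (B s) ** Q' s + transpose (B1 s) ** Q s) ** B s) = 0"
    proof -
      have 1: "2 *\<^sub>R (transpose (B s) ** Q s ** B1 s) = transpose (B s) ** (2 *\<^sub>R (Q s ** B1 s))"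
        by (simp add: matrix_mult_distribs matrix_mul_assoc)
      have "2 *\<^sub>R (transpose (B1 s) ** Q s ** B s) = transpose (2 *\<^sub>R (Q s ** B1 s)) ** B s"
        by (simp add: transpose_linear matrix_transpose_mul transpose_Q[OF s] matrix_mult_distribs)
      also have "\<dots> = - (transpose (B s) ** Q' s ** B s) + transpose (B s) ** Q s ** transpose (P s) ** B s
         - transpose (B s) ** P s ** Q s ** B s"
        unfolding frame_equation[OF s]
        by (simp add: transpose_linear matrix_transpose_mul transpose_Q[OF s] transpose_Q'[OF s] matrix_mult_distribs matrix_mul_assoc)
      finally have 2: "2 *\<^sub>R (transpose (B1 s) ** Q s ** B s) = - (transpose (B s) ** Q' s ** B s)
         + transpose (B s) ** Q s ** transpose (P s) ** B s - transpose (B s) ** P s ** Q s ** B s" .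
      show ?thesis
        unfolding matrix_mult_distribs scaleR_add_right 1 2 frame_equation[OF s]
        by (simp add: matrix_mult_distribs matrix_mul_assoc scaleR_2)
    qed
    ultimately show ?thesis by simp
  qed
  then have "((\<lambda>s. transpose (B s) ** Q s ** B s) has_derivative (\<lambda>h. 0)) (at s within I)" if "s \<in> I" for s
    using that by (auto simp: has_vector_derivative_def intro: has_derivative_at_withinI)
  then have "transpose (B t) ** Q t ** B t = transpose (B 0) ** Q 0 ** B 0"
    using convex_real_interval(8) t zero_in_I
    by (intro has_derivative_zero_unique[of I "\<lambda>s. transpose (B s) ** Q s ** B s"])
  then show ?thesis by (simp only: orthonormal_0)
qed

end

section \<open>The Bochner--Weitzenboeck formula\<close>

text \<open>\<open>representation\<close> refers to the set \<open>range b\<close>, so the vectors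
  must be independent and also pairwise distinct. Both hold because an injective linear map sends
  the standard basis to them.\<close>

lemma coeff_in_vertical:
  fixes B R :: "real ^ 'n ^ 'n"
  assumes RB: "R ** B = mat 1"
  shows "coeff_in (\<lambda>k. (0 :: real ^ 'n, column k B)) (0, \<zeta>) j = (R *v \<zeta>) $ j"
proof -
  let ?b = "\<lambda>k. (0 :: real ^ 'n, column k B)"
  let ?l = "\<lambda>c. (0 :: real ^ 'n, B *v c)"
  have BR: "B ** R = mat 1" using RB by (simp add: matrix_left_right_inverse)
  have b: "?b k = ?l (axis k 1)" for k by (simp add: matrix_vector_mult_basis)
  have l: "linear ?l"
    by (intro linearI) (simp_all add: matrix_vector_right_distrib matrix_vector_mult_scaleR)
  have "R *v (B *v c) = c" for c by (simp add: matrix_vector_mul_assoc RB)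
  then have inj: "inj ?l" by (intro injI) (metis prod.inject)
  then have inj_b: "inj ?b" unfolding b by (intro injI) (metis injD axis_eq_axis zero_neq_one)
  have "range ?b = ?l ` range (\<lambda>k. axis k 1)" unfolding b by (simp add: image_image)
  moreover have "independent (range (\<lambda>k :: 'n. axis k (1 :: real)))"
    by (rule independent_mono[OF independent_Basis]) (auto simp: Basis_vec_def)
  ultimately have ind: "independent (range ?b)"
    using linear_independent_injective_image[OF l] inj by (metis inj_on_subset subset_UNIV)
  have rep: "(0, \<zeta>) = (\<Sum>k\<in>UNIV. (R *v \<zeta>) $ k *\<^sub>R ?b k)"
  proof -
    have "(\<Sum>k\<in>UNIV. (R *v \<zeta>) $ k *\<^sub>R column k B) = B *v (R *v \<zeta>)"
      unfolding matrix_mult_sum by (simp add: scalar_mult_eq_scaleR)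
    also have "\<dots> = \<zeta>" by (simp add: matrix_vector_mul_assoc BR)
    finally show ?thesis by (simp add: prod_eq_iff fst_sum snd_sum)
  qed
  have "representation (range ?b) (\<Sum>k\<in>UNIV. (R *v \<zeta>) $ k *\<^sub>R ?b k) =
      (\<lambda>w. \<Sum>k\<in>UNIV. representation (range ?b) ((R *v \<zeta>) $ k *\<^sub>R ?b k) w)"
    by (rule representation_sum[OF ind]) (intro span_scale span_base rangeI)
  also have "\<dots> = (\<lambda>w. \<Sum>k\<in>UNIV. (R *v \<zeta>) $ k * representation (range ?b) (?b k) w)"
    by (simp only: representation_scale[OF ind span_base[OF rangeI]])
  finally have "representation (range ?b) (\<Sum>k\<in>UNIV. (R *v \<zeta>) $ k *\<^sub>R ?b k) (?b j) =
      (\<Sum>k\<in>UNIV. (R *v \<zeta>) $ k * representation (range ?b) (?b k) (?b j))"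
    by (rule fun_cong)
  also have "\<dots> = (\<Sum>k\<in>UNIV. (R *v \<zeta>) $ k * (if k = j then 1 else 0))"
    by (intro sum.cong refl) (simp only: representation_basis[OF ind rangeI] inj_eq[OF inj_b] eq_commute[of j])
  also have "\<dots> = (R *v \<zeta>) $ j" by (simp add: if_distrib cong: if_cong)
  finally show ?thesis unfolding coeff_in_def rep .
qed

section \<open>Curvature, Hessian and weight in terms of the frame matrices\<close>

context framed_orbit
begin

abbreviation "R \<equiv> transpose (B 0) ** Q 0"

lemma RB: "R ** B 0 = mat 1"
  using orthonormal_0 .

lemma frame_coeff: "coeff_in (\<lambda>k. e k 0) (0, \<zeta>) j = (R *v \<zeta>) $ j"
  unfolding frame_0 using coeff_in_vertical[OF RB] .

text \<open>\<open>R\<close> maps the columns of \<open>B 0\<close> to the standard basis; the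
  curvature operator therefore sends \<open>e i 0\<close> to minus column \<open>i\<close> of
  \<open>N 0\<close>, whose coefficients \<open>R\<close> reads off.\<close>

lemma ricci_eq: "ricci e = - trace (R ** N 0)"
proof -
  have col: "R *v column i (B 0) = axis i 1" for i
    by (metis RB matrix_vector_mul_assoc matrix_vector_mul_lid matrix_vector_mult_basis)
  have "coeff_in (\<lambda>k. e k 0) (curvature_op e 0 (e i 0)) i = - (R ** N 0) $ i $ i" for i
  proof -
    have "curvature_op e 0 (e i 0) = (\<Sum>k\<in>UNIV. (if i = k then 1 else 0) *\<^sub>R - vd (vd (e k)) 0)"
      unfolding curvature_op_def
      by (subst (2) frame_0(1)) (simp add: frame_coeff col axis_def eq_commute cong: if_cong)
    also have "\<dots> = - vd (vd (e i)) 0"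
      by (simp add: if_distrib if_distribR cong: if_cong)
    also have "\<dots> = (0, - column i (N 0))" by (simp add: frame_0)
    finally have "coeff_in (\<lambda>k. e k 0) (curvature_op e 0 (e i 0)) i = (R *v - column i (N 0)) $ i"
      by (simp only: frame_coeff)
    also have "\<dots> = - (R ** N 0) $ i $ i"
      by (simp add: matrix_vector_mult_def column_def sum_negf matrix_matrix_mult_def[of R])
    finally show ?thesis .
  qed
  then show ?thesis by (simp add: ricci_def trace_def sum_negf)
qed

text \<open>With \<open>S\<close> the second derivatives of \<open>u\<close>, the image of
  \<open>d(du)\<close> consists of the pairs \<open>(h, S h)\<close>, so the Hessian sends
  \<open>(h, k)\<close> to the vertical vector \<open>k - S h\<close>. On the frame velocities
  \<open>h\<close> and \<open>k\<close> are the columns of \<open>Y = - QB\<close> and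
  \<open>Z = B' + P^T B\<close>.\<close>

lemma hess_HS_sq_eq:
  assumes u: "smooth_on U u" and x: "x \<in> U" and \<alpha>: "\<alpha> = dsec u x"
  defines "G \<equiv> R ** (second_partials u x ** Q 0 ** B 0 + B1 0 + transpose (P 0) ** B 0)"
  shows "hess_HS_sq e u x = trace (G ** transpose G)"
proof -
  let ?S = "second_partials u x"
  have S: "h v* ?S = ?S *v h" for h
    by (metis transpose_second_partials[OF u U x] transpose_matrix_vector)
  have range: "range (frechet_derivative (dsec u) (at x)) = {(h, ?S *v h) | h. True}"
    unfolding frechet_derivative_at[OF dsec_has_derivative[OF u U x], symmetric] S by auto
  have hess: "ham_hess u x (h, k) = (0, k - ?S *v h)" for h k
  proof -
    have "(THE w. w \<in> vertical \<and> (h, k) + w \<in> range (frechet_derivative (dsec u) (at x))) = (0, ?S *v h - k)"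
      unfolding range by (rule the_equality) (auto simp: vertical_def eq_diff_eq add.commute)
    then show ?thesis by (simp add: ham_hess_def)
  qed
  have "coeff_in (\<lambda>k. e k 0) (ham_hess u x (vd (e i) 0)) j = G $ j $ i" for i j
  proof -
    have "column i (Z 0) - ?S *v column i (Y 0) = column i (?S ** Q 0 ** B 0 + B1 0 + transpose (P 0) ** B 0)"
    proof -
      have mv: "A *v column i C = column i (A ** C)" for A C :: "real ^ 'n ^ 'n"
        by (simp add: vec_eq_iff column_def matrix_vector_mult_def matrix_matrix_mult_def)
      have "column i (Z 0) - ?S *v column i (Y 0) = column i (Z 0 - ?S ** Y 0)"
        unfolding mv by (simp add: vec_eq_iff column_def)
      also have "Z 0 - ?S ** Y 0 = ?S ** Q 0 ** B 0 + B1 0 + transpose (P 0) ** B 0"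
        by (simp add: frame_structure(1)[OF zero_in_I] B1_def matrix_mult_distribs matrix_mul_assoc)
      finally show ?thesis .
    qed
    then show ?thesis
      unfolding frame_0(2) hess frame_coeff
      by (simp add: G_def column_def matrix_vector_mult_def matrix_matrix_mult_def[of R])
  qed
  then have "hess_HS_sq e u x = (\<Sum>i\<in>UNIV. \<Sum>j\<in>UNIV. (G $ j $ i)\<^sup>2)" by (simp add: hess_HS_sq_def)
  also have "\<dots> = trace (G ** transpose G)"
    by (subst sum.swap) (simp add: trace_def matrix_matrix_mult_def transpose_def power2_eq_square)
  finally show ?thesis .
qed

text \<open>Duality and \<open>B^T Q B = 1\<close> give \<open>det L_vv = (det B)^2\<close> along
  the orbit, and the logarithm is taken of the square, whose sign is known. By Jacobi's formula its
  half has the derivative \<open>trace (B' B^-1)\<close>, where \<open>B^-1\<close> is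
  \<open>B^T Q\<close>, a form that can be differentiated once more.\<close>

lemma weight_along_derivatives:
  fixes L \<sigma>
  assumes \<sigma>: "smooth_on U \<sigma>"
    and legendre: "\<forall>y\<in>U. \<forall>a. a \<noteq> 0 \<longrightarrow>
       det (fibre_hessian L (y, \<chi> i. pdv i H (y, a))) * det (fibre_hessian H (y, a)) = 1"
  defines "\<psi> \<equiv> weight_along L \<sigma> (\<lambda>t. fst (\<Phi> t \<alpha>))"
  shows "deriv \<psi> 0 = (\<Sum>i\<in>UNIV. pdv i H \<alpha> * pd i \<sigma> (fst \<alpha>)) + trace (B1 0 ** R)"
    and "deriv (deriv \<psi>) 0 =
      (\<Sum>i\<in>UNIV. orbit_accel H \<alpha> i * pd i \<sigma> (fst \<alpha>))
      + (\<Sum>i\<in>UNIV. \<Sum>k\<in>UNIV. pdv k H \<alpha> * pdv i H \<alpha> * pd k (pd i \<sigma>) (fst \<alpha>))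
      + (trace (B2 0 ** R) + trace (B1 0 ** transpose (B1 0) ** Q 0) + trace (B1 0 ** transpose (B 0) ** Q' 0))"
proof -
  define g where "g t = (\<Sum>i\<in>UNIV. pdv i H (z t) * pd i \<sigma> (fst (z t))) + trace (B1 t ** (transpose (B t) ** Q t))" for t
  have base: "((\<lambda>t. f (fst (z t))) has_real_derivative (\<Sum>k\<in>UNIV. pdv k H (z t) * pd k f (fst (z t)))) (at t)"
    if f: "smooth_on U f" and t: "t \<in> I" for f t
  proof -
    have d: "f differentiable (at (fst (z t)))"
      using smooth_on_imp_differentiable[OF f U] z_in[OF t] by (simp add: mem_Times_iff)
    have "((\<lambda>t. fst (z t)) has_vector_derivative (\<chi> i. pdv i H (z t))) (at t)"
      using bounded_linear.has_vector_derivative[OF bounded_linear_fst flow_velocity[OF \<alpha>W t]]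
      by (simp add: hamiltonian_vf_def)
    from has_derivative_compose[OF this[unfolded has_vector_derivative_def] d[unfolded frechet_derivative_works]]
    show ?thesis
      unfolding has_field_derivative_def
      by (rule has_derivative_eq_rhs)
        (simp add: fun_eq_iff frechet_derivative_pd[OF d] sum_distrib_left mult_ac)
  qed
  have det2: "det (fibre_hessian L (fst (z t), vd (\<lambda>t. fst (\<Phi> t \<alpha>)) t)) = (det (B t))\<^sup>2"
    and detB: "det (B t) \<noteq> 0" if t: "t \<in> I" for t
  proof -
    have "vd (\<lambda>t. fst (\<Phi> t \<alpha>)) t = (\<chi> i. pdv i H (z t))"
      using bounded_linear.has_vector_derivative[OF bounded_linear_fst flow_velocity[OF \<alpha>W t]]
      by (simp add: vd_def vector_derivative_at hamiltonian_vf_def)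
    then have L: "det (fibre_hessian L (fst (z t), vd (\<lambda>t. fst (\<Phi> t \<alpha>)) t)) * det (Q t) = 1"
      using legendre[THEN bspec, of "fst (z t)", THEN spec, of "snd (z t)"] z_in[OF t]
      by (simp add: mem_Times_iff)
    have "det (transpose (B t) ** Q t ** B t) = 1" by (simp add: orthonormal[OF t])
    then have BQ: "(det (B t))\<^sup>2 * det (Q t) = 1"
      by (simp add: det_mul det_transpose power2_eq_square mult_ac)
    then show "det (B t) \<noteq> 0" by auto
    have "det (Q t) \<noteq> 0" using L by auto
    then show "det (fibre_hessian L (fst (z t), vd (\<lambda>t. fst (\<Phi> t \<alpha>)) t)) = (det (B t))\<^sup>2"
      using L BQ by (metis mult_right_cancel)
  qed
  have \<psi>: "\<psi> t = \<sigma> (fst (z t)) + ln ((det (B t))\<^sup>2) / 2" if t: "t \<in> I" for t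
    unfolding \<psi>_def weight_along_def det2[OF t] using detB[OF t] ln_sqrt[of "(det (B t))\<^sup>2"] by simp
  have d\<psi>: "(\<psi> has_real_derivative g t) (at t)" if t: "t \<in> I" for t
  proof -
    have BR: "transpose (B t) ** Q t ** B t = mat 1" by (rule orthonormal[OF t])
    have "B1 t = (B1 t ** (transpose (B t) ** Q t)) ** B t"
      using BR by (simp flip: matrix_mul_assoc)
    then have "((\<lambda>t. det (B t)) has_real_derivative trace (B1 t ** (transpose (B t) ** Q t)) * det (B t)) (at t)"
      using frame_structure(2)[OF t] by (intro has_real_derivative_det) simp
    then have "((\<lambda>t. (det (B t))\<^sup>2) has_real_derivative
        2 * det (B t) * (trace (B1 t ** (transpose (B t) ** Q t)) * det (B t))) (at t)"
      by (auto intro!: derivative_eq_intros)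
    moreover have "0 < (det (B t))\<^sup>2" using detB[OF t] by simp
    ultimately have "((\<lambda>t. ln ((det (B t))\<^sup>2)) has_real_derivative
        inverse ((det (B t))\<^sup>2) * (2 * det (B t) * (trace (B1 t ** (transpose (B t) ** Q t)) * det (B t)))) (at t)"
      by (intro DERIV_chain2[OF DERIV_ln])
    then have "((\<lambda>t. ln ((det (B t))\<^sup>2)) has_real_derivative 2 * trace (B1 t ** (transpose (B t) ** Q t))) (at t)"
      by (rule DERIV_cong) (use detB[OF t] in \<open>simp add: power2_eq_square field_simps\<close>)
    from DERIV_add[OF base[OF \<sigma> t] DERIV_cdivide[OF this, of 2]]
    have "((\<lambda>t. \<sigma> (fst (z t)) + ln ((det (B t))\<^sup>2) / 2) has_real_derivative g t) (at t)"
      by (simp add: g_def)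
    then show ?thesis
      by (rule has_field_derivative_transform_within_open[OF _ _ t]) (simp_all add: \<psi>)
  qed
  show "deriv \<psi> 0 = (\<Sum>i\<in>UNIV. pdv i H \<alpha> * pd i \<sigma> (fst \<alpha>)) + trace (B1 0 ** R)"
    using DERIV_imp_deriv[OF d\<psi>[OF zero_in_I]] by (simp add: g_def z_0)
  note zero = zero_in_I
  have "poisson H (pdv i H) \<alpha> = orbit_accel H \<alpha> i" for i
    unfolding poisson_def orbit_accel_def
    using pdv_pdv_commute[OF H open_\<Omega> z_in[OF zero]] z_0 by simp
  then have acc: "((\<lambda>t. pdv i H (z t)) has_real_derivative orbit_accel H \<alpha> i) (at 0)" for i
    using poisson_has_derivative[OF smooth_on_pdv[OF H] zero, of i] by (simp add: z_0)
  have "((\<lambda>t. trace (B1 t ** (transpose (B t) ** Q t))) has_vector_derivative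
      trace (B1 0 ** (transpose (B 0) ** Q' 0 + transpose (B1 0) ** Q 0) + B2 0 ** R)) (at 0)"
    by (rule has_vector_derivative_trace[OF has_vector_derivative_matrix_mult[OF B1_has_vector_derivative[OF zero]
          has_vector_derivative_matrix_mult[OF has_vector_derivative_transpose[OF frame_structure(2)[OF zero]]
            Q_has_vector_derivative[OF zero]]]])
  then have "((\<lambda>t. trace (B1 t ** (transpose (B t) ** Q t))) has_real_derivative
      trace (B1 0 ** (transpose (B 0) ** Q' 0 + transpose (B1 0) ** Q 0) + B2 0 ** R)) (at 0)"
    by (simp only: has_real_derivative_iff_has_vector_derivative)
  then have "(g has_real_derivative
      (\<Sum>i\<in>UNIV. pdv i H (z 0) * (\<Sum>k\<in>UNIV. pdv k H (z 0) * pd k (pd i \<sigma>) (fst (z 0)))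
        + orbit_accel H \<alpha> i * pd i \<sigma> (fst (z 0)))
      + trace (B1 0 ** (transpose (B 0) ** Q' 0 + transpose (B1 0) ** Q 0) + B2 0 ** R)) (at 0)"
    unfolding g_def[abs_def]
    by (intro DERIV_add DERIV_sum DERIV_mult' acc base[OF smooth_on_pd[OF \<sigma>] zero])
  \<comment> \<open>The formula for \<open>deriv \<psi>\<close> holds only on \<open>I\<close>, so
    the second derivative is compared through a neighbourhood of 0.\<close>
  moreover have "deriv (deriv \<psi>) 0 = deriv g 0"
  proof (rule deriv_cong_ev)
    show "\<forall>\<^sub>F t in nhds 0. deriv \<psi> t = g t"
      using eventually_nhds_in_open[OF open_greaterThanLessThan zero]
      by (rule eventually_mono) (rule DERIV_imp_deriv[OF d\<psi>])
  qed simp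
  ultimately have "deriv (deriv \<psi>) 0 =
      (\<Sum>i\<in>UNIV. pdv i H \<alpha> * (\<Sum>k\<in>UNIV. pdv k H \<alpha> * pd k (pd i \<sigma>) (fst \<alpha>)) + orbit_accel H \<alpha> i * pd i \<sigma> (fst \<alpha>))
      + trace (B1 0 ** (transpose (B 0) ** Q' 0 + transpose (B1 0) ** Q 0) + B2 0 ** R)"
    by (simp add: DERIV_imp_deriv z_0)
  then show "deriv (deriv \<psi>) 0 =
      (\<Sum>i\<in>UNIV. orbit_accel H \<alpha> i * pd i \<sigma> (fst \<alpha>))
      + (\<Sum>i\<in>UNIV. \<Sum>k\<in>UNIV. pdv k H \<alpha> * pdv i H \<alpha> * pd k (pd i \<sigma>) (fst \<alpha>))
      + (trace (B2 0 ** R) + trace (B1 0 ** transpose (B1 0) ** Q 0) + trace (B1 0 ** transpose (B 0) ** Q' 0))"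
    by (simp add: sum.distrib sum_distrib_left mult_ac matrix_mult_distribs trace_linear matrix_mul_assoc)
qed

text \<open>Everything is evaluated at time 0, where the orbit passes through
  \<open>dsec u x\<close>. The second claim bounds the squared trace of the Hessian matrix
  \<open>G\<close>, which is \<open>\<Delta>u + \<psi>'\<close>, by Cauchy--Schwarz on its diagonal;
  the off-diagonal squares only help.\<close>

lemma bochner_weitzenboeck:
  assumes u: "smooth_on U u" and \<sigma>: "smooth_on U \<sigma>" and x: "x \<in> U" and \<alpha>: "\<alpha> = dsec u x"
    and legendre: "\<forall>y\<in>U. \<forall>a. a \<noteq> 0 \<longrightarrow>
       det (fibre_hessian L (y, \<chi> i. pdv i H (y, a))) * det (fibre_hessian H (y, a)) = 1"
  defines "\<psi> \<equiv> weight_along L \<sigma> (\<lambda>t. fst (\<Phi> t \<alpha>))"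
  shows "bochner_lhs H \<sigma> u x = ricci e + deriv (deriv \<psi>) 0 + hess_HS_sq e u x"
    and "(ham_laplacian H \<sigma> u x + deriv \<psi> 0)\<^sup>2 \<le> CARD('n) * hess_HS_sq e u x"
proof -
  let ?S = "second_partials u x"
  have z0: "\<Phi> 0 (dsec u x) = dsec u x" using z_0 \<alpha> by simp
  have x0: "snd (dsec u x) \<noteq> 0" using z_in[OF zero_in_I] by (simp add: z0 \<alpha> mem_Times_iff)
  note \<psi>' = weight_along_derivatives[OF \<sigma> legendre, folded \<psi>_def]
  define G where "G = R ** (?S ** Q 0 ** B 0 + B1 0 + transpose (P 0) ** B 0)"
  have hess: "hess_HS_sq e u x = trace (G ** transpose G)"
    unfolding G_def by (rule hess_HS_sq_eq[OF u x \<alpha>])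
  have V: "pd k (\<lambda>y. pdv i H (dsec u y)) x = (P 0 + Q 0 ** ?S) $ i $ k" for i k
    using pd_ham_grad[OF U H u x x0] by (simp add: z0 \<alpha>)
  note syms = transpose_Q[OF zero_in_I] transpose_Q'[OF zero_in_I] transpose_second_partials[OF u U x]
  note trace_id = trace_bochner_identity(1)[where ?B2.0="B2 0" and P'="P' 0" and Hxx="base_hessian H (z 0)",
        OF syms orthonormal_0 frame_equation[OF zero_in_I], folded N_eq[OF zero_in_I] G_def]
    trace_bochner_identity(2)[OF syms orthonormal_0 frame_equation[OF zero_in_I], folded G_def]
  have "(\<Sum>i\<in>UNIV. \<Sum>k\<in>UNIV. pd k (\<lambda>y. pdv i H (dsec u y)) x * pd i (\<lambda>y. pdv k H (dsec u y)) x)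
      = trace ((P 0 + Q 0 ** ?S) ** (P 0 + Q 0 ** ?S))"
    unfolding V by (simp add: trace_def matrix_matrix_mult_def[of "P 0 + Q 0 ** ?S"])
  moreover have "(\<Sum>i\<in>UNIV. pd i (\<lambda>y. orbit_accel H (dsec u y) i) x) =
      trace (P' 0) + trace (P 0 ** P 0) - trace (base_hessian H (z 0) ** Q 0)
      + trace ((Q' 0 + P 0 ** Q 0 - Q 0 ** transpose (P 0)) ** ?S)"
    using sum_pd_orbit_accel[OF U H u x x0] by (simp add: z0 \<alpha>)
  moreover have "fst \<alpha> = x" by (simp add: \<alpha> dsec_def)
  ultimately show "bochner_lhs H \<sigma> u x = ricci e + deriv (deriv \<psi>) 0 + hess_HS_sq e u x"
    using trace_id(1) sum.swap[of "\<lambda>k i. pdv k H \<alpha> * pdv i H \<alpha> * pd k (pd i \<sigma>) x" UNIV UNIV]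
    unfolding bochner_lhs_flat[OF U H u \<sigma> x x0, folded \<alpha>] \<psi>'(2) ricci_eq hess
    by simp
  have "ham_laplacian H \<sigma> u x + deriv \<psi> 0 = trace G"
    unfolding trace_id(2) \<psi>'(1)
    by (simp add: ham_laplacian_def divergence_def ham_grad_def V trace_def sum_subtractf \<open>fst \<alpha> = x\<close> flip: \<alpha>)
  also have "(trace G)\<^sup>2 \<le> CARD('n) * trace (G ** transpose G)"
  proof -
    have "(trace G)\<^sup>2 \<le> CARD('n) * (\<Sum>i\<in>UNIV. (G $ i $ i)\<^sup>2)"
      using sum_squared_le_sum_of_squares[of "\<lambda>i. G $ i $ i" UNIV] by (simp add: trace_def mult.commute)
    also have "(\<Sum>i\<in>UNIV. (G $ i $ i)\<^sup>2) \<le> (\<Sum>i\<in>UNIV. \<Sum>j\<in>UNIV. (G $ i $ j)\<^sup>2)"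
      by (intro sum_mono member_le_sum) auto
    also have "(\<Sum>i\<in>UNIV. \<Sum>j\<in>UNIV. (G $ i $ j)\<^sup>2) = trace (G ** transpose G)"
      by (simp add: trace_def matrix_matrix_mult_def transpose_def power2_eq_square)
    finally show ?thesis by (simp add: mult_left_mono)
  qed
  finally show "(ham_laplacian H \<sigma> u x + deriv \<psi> 0)\<^sup>2 \<le> CARD('n) * hess_HS_sq e u x"
    unfolding hess .
qed

end

text \<open>Completing the square absorbs the cross term between \<open>a\<close>, the Laplacian,
  and \<open>b\<close>, the derivative of the weight; equality holds for
  \<open>(N - n) * a = - N * b\<close>.\<close>

lemma square_quotient_bound:
  fixes a b :: real
  assumes "0 < n" "n < N"
  shows "a\<^sup>2 / N - b\<^sup>2 / (N - n) \<le> (a + b)\<^sup>2 / n"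
proof -
  have "(a + b)\<^sup>2 / n - (a\<^sup>2 / N - b\<^sup>2 / (N - n)) = ((N - n) * a + N * b)\<^sup>2 / (n * N * (N - n))"
    using assms by (simp add: divide_simps) (simp add: algebra_simps power2_eq_square)
  also have "\<dots> \<ge> 0" using assms by (intro divide_nonneg_nonneg mult_nonneg_nonneg) auto
  finally show ?thesis by simp
qed

lemma log_density_smooth:
  assumes "smooth_positive_measure A \<mm>" "c \<in> A"
  shows "smooth_on (coord_dom c) (log_density c \<mm>)"
proof -
  have "\<exists>\<sigma>. is_log_density c \<mm> \<sigma>" using assms by (simp add: smooth_positive_measure_def)
  then have "is_log_density c \<mm> (log_density c \<mm>)" unfolding log_density_def by (rule someI_ex)
  then show ?thesis by (simp add: is_log_density_def)
qed

theorem theorem4p4: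
  fixes A :: "('m::{t2_space, second_countable_topology}, 'n::finite) chart set"
    and \<mm> :: "'m measure"
    and \<L> :: "'m \<Rightarrow> ('m, 'n) tvec \<Rightarrow> real"
    and u :: "'m \<Rightarrow> real"
    and c :: "('m, 'n) chart"
    and p :: 'm
    and H L :: "(real ^ 'n) \<times> (real ^ 'n) \<Rightarrow> real"
    and \<sigma> u\<^sub>c :: "real ^ 'n \<Rightarrow> real"
    and x :: "real ^ 'n"
    and \<alpha> :: "(real ^ 'n) \<times> (real ^ 'n)"
    and W :: "((real ^ 'n) \<times> (real ^ 'n)) set"
    and \<epsilon> :: real
    and \<Phi> :: "real \<Rightarrow> (real ^ 'n) \<times> (real ^ 'n) \<Rightarrow> (real ^ 'n) \<times> (real ^ 'n)"
    and e :: "'n \<Rightarrow> real \<Rightarrow> (real ^ 'n) \<times> (real ^ 'n)"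
    and \<psi> :: "real \<Rightarrow> real"
  assumes "2 \<le> CARD('n)"
    and "smooth_atlas A"
    and "connected (UNIV :: 'm set)"
    and "smooth_positive_measure A \<mm>"
    and "lagrangian A \<L>"
    and "regular_hamiltonian A \<L>"
    and "smooth_function A u"
    \<comment> \<open>coordinate expressions in an arbitrary chart \<open>c\<close> around \<open>p\<close>\<close>
    and "c \<in> A" and "p \<in> fst c"
    and "H = ham_in A \<L> c" and "L = lag_in A \<L> c"
    and "\<sigma> = log_density c \<mm>" and "u\<^sub>c = u \<circ> coord_inv c"
    and "x = snd c p" and "\<alpha> = dsec u\<^sub>c x"
    and "snd \<alpha> \<noteq> 0"
    \<comment> \<open>the local Hamiltonian flow near \<open>\<alpha>\<close> and a canonical frame along it\<close>
    and "local_flow (hamiltonian_vf H) (coord_dom c \<times> (- {0})) W \<epsilon> \<Phi>" and "\<alpha> \<in> W"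
    and "canonical_frame \<Phi> \<alpha> \<epsilon> e"
    and "\<psi> = weight_along L \<sigma> (\<lambda>t. fst (\<Phi> t \<alpha>))"
  shows "ereal (bochner_lhs H \<sigma> u\<^sub>c x)
           = weighted_ricci CARD('n) \<infinity> (ricci e) \<psi> + ereal (hess_HS_sq e u\<^sub>c x)
       \<and> (\<forall>N::real. N \<ge> CARD('n) \<longrightarrow>
           ereal (bochner_lhs H \<sigma> u\<^sub>c x)
             \<ge> weighted_ricci CARD('n) (ereal N) (ricci e) \<psi>
               + ereal ((ham_laplacian H \<sigma> u\<^sub>c x)\<^sup>2 / N))"
proof -
  let ?U = "coord_dom c" and ?n = "real CARD('n)"
  note A = \<open>smooth_atlas A\<close> and c = \<open>c \<in> A\<close>
  have U: "open ?U" by (rule open_coord_dom[OF A c])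
  have x: "x \<in> ?U" using coord_inv_chart(2)[OF A c \<open>p \<in> fst c\<close>] \<open>x = snd c p\<close> by simp
  have H: "smooth_on (?U \<times> - {0}) H"
    using \<open>regular_hamiltonian A \<L>\<close> c \<open>H = ham_in A \<L> c\<close> by (simp add: regular_hamiltonian_def)
  have u: "smooth_on ?U u\<^sub>c"
    using \<open>smooth_function A u\<close> c \<open>u\<^sub>c = u \<circ> coord_inv c\<close> by (simp add: smooth_function_def)
  have \<sigma>: "smooth_on ?U \<sigma>"
    using log_density_smooth[OF \<open>smooth_positive_measure A \<mm>\<close> c] \<open>\<sigma> = log_density c \<mm>\<close> by simp
  have legendre: "\<forall>y\<in>?U. \<forall>a. a \<noteq> 0 \<longrightarrow>
      det (fibre_hessian L (y, \<chi> i. pdv i H (y, a))) * det (fibre_hessian H (y, a)) = 1"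
    using det_fibre_hessian_legendre[OF A \<open>lagrangian A \<L>\<close> \<open>regular_hamiltonian A \<L>\<close> c]
      \<open>H = ham_in A \<L> c\<close> \<open>L = lag_in A \<L> c\<close> by simp
  interpret framed_orbit ?U H W \<epsilon> \<Phi> \<alpha> e
    by unfold_locales
      (fact U H \<open>local_flow (hamiltonian_vf H) (?U \<times> - {0}) W \<epsilon> \<Phi>\<close> \<open>\<alpha> \<in> W\<close> \<open>canonical_frame \<Phi> \<alpha> \<epsilon> e\<close>)+
  let ?\<Delta> = "ham_laplacian H \<sigma> u\<^sub>c x" and ?h = "hess_HS_sq e u\<^sub>c x"
  note bochner = bochner_weitzenboeck[OF u \<sigma> x \<open>\<alpha> = dsec u\<^sub>c x\<close> legendre, folded \<open>\<psi> = weight_along L \<sigma> _\<close>]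
  have bound: "(?\<Delta> + deriv \<psi> 0)\<^sup>2 / ?n \<le> ?h"
    using bochner(2) by (simp add: divide_le_eq mult.commute)
  have "weighted_ricci ?n (ereal N) (ricci e) \<psi> + ereal (?\<Delta>\<^sup>2 / N) \<le> ereal (bochner_lhs H \<sigma> u\<^sub>c x)"
    if N: "?n \<le> N" for N
  proof (cases "N = ?n")
    case True
    \<comment> \<open>Either the derivative of the weight vanishes and the bound is already the
      claim, or \<open>weighted_ricci\<close> is minus infinity.\<close>
    then show ?thesis
      using bound bochner(1) by (auto simp: weighted_ricci_def)
  next
    case False
    then have "?\<Delta>\<^sup>2 / N - (deriv \<psi> 0)\<^sup>2 / (N - ?n) \<le> (?\<Delta> + deriv \<psi> 0)\<^sup>2 / ?n"
      using N by (intro square_quotient_bound) auto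
    then show ?thesis
      using bound bochner(1) False by (simp add: weighted_ricci_def)
  qed
  then show ?thesis
    using bochner(1) by (simp add: weighted_ricci_def)
qed

end
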